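(* Let $B, C\subset \mathbb{P}^2$ be integral projective plane curves over $\mathbb{C}$, each of degree at least $2$, such that $B\cap C=\{q\}$ consists of a single point. Assume that $q$ is an $(m',n')$-point for $B$ and an $(m,n)$-point for $C$. Then there is an isomorphism of tropical curves $\Gamma^{(m,n)}\cong\Gamma^{(m',n')}$; equivalently, $m'/n'=m/n$.
   Context: All curves are over $\mathbb{C}$. A point $q$ of an integral curve $C$ is unibranch if it has exactly one preimage in the normalization of $C$. For an integral plane curve $C\subset\mathbb{P}^2$ of degree at least $2$ and a unibranch point $q\in C$ (smooth or singular), let $L$ be the tangent line to $C$ at $q$; we say $q$ is an $(m,n)$-point of $C$ if $m=\operatorname{mult}_q(C)$ is the multiplicity of $C$ at $q$ and $n=(C\cdot L)_q$ is the intersection multiplicity; one has $n>m>0$. Euclidean sequence. For integers $n>m>0$ with $c=\gcd(m,n)$, put $l_0=n$, $l_1=m$, $l_j=l_{j-2}-l_{j-1}\lfloor l_{j-2}/l_{j-1}\rfloor$ for $2\le j\le r+1$, where $r$ is determined by $l_0>l_1>\dots>l_r=c>l_{r+1}=0$. Put $k_j=\lfloor l_{j-1}/l_j\rfloor$ for $j=1,\dots,r$ (so $k_r\ge 2$). Tropical curves here are finite graphs, possibly with legs (half-edges attached to a single vertex), with a positive real length on every edge and every leg. An isomorphism of tropical curves is an isomorphism of the underlying graphs with legs (bijections on vertices, edges and legs compatible with incidence) that preserves lengths. The contact tropical curve $\Gamma^{(m,n)}$ of the pair $(m,n)$ has $r+2$ vertices $C_*,E_*,A^1_1,\dots,A^1_r$.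 If $r>1$, its edges are: $C_*E_*$ of length $1$; $E_*A^1_r$ of length $1$; $E_*A^1_{r-1}$ of length $k_r$; and $A^1_{j+1}A^1_{j-1}$ of length $k_j$ for every $j=2,\dots,r-1$; moreover, if $k_1>1$ there is exactly one leg, attached to $A^1_2$, of length $k_1-1$, and if $k_1=1$ there is no leg. If $r=1$, its edges are $C_*E_*$ and $E_*A^1_1$, both of length $1$, and there is exactly one leg, attached to $E_*$, of length $k_1-1$. *)

theory Defs
  imports
    "HOL-Analysis.Analysis"
    "HOL-Algebra.QuotRing"
    "HOL-Algebra.Embedded_Algebras"
    "HOL-Algebra.Polynomials"
    "HOL-Algebra.Algebraic_Closure_Type"
begin

section \<open>Forms in three variables and points of the projective plane\<close>

text \<open>
  The type \<^typ>\<open>complex poly poly poly\<close> plays the role of the polynomial ring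
  in X, Y, Z; the outermost variable is X and the innermost one is Z.
\<close>

type_synonym form = "complex poly poly poly"

definition homogeneous :: "nat \<Rightarrow> form \<Rightarrow> bool" where
  "homogeneous d F \<longleftrightarrow>
     (\<forall>i j k. Polynomial.coeff (Polynomial.coeff (Polynomial.coeff F i) j) k \<noteq> 0
        \<longrightarrow> i + j + k = d)"

definition form_eval :: "form \<Rightarrow> complex ^ 3 \<Rightarrow> complex" where
  "form_eval F v = poly (poly (poly F [:[:v $ 1:]:]) [:v $ 2:]) (v $ 3)"

definition integral_plane_curve :: "nat \<Rightarrow> form \<Rightarrow> bool" where
  "integral_plane_curve d F \<longleftrightarrow> homogeneous d F \<and> Factorial_Ring.irreducible F"

text \<open>A point of the projective plane is the set of its homogeneous coordinate vectors.\<close>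

definition proj_point :: "complex ^ 3 \<Rightarrow> (complex ^ 3) set" where
  "proj_point v = {c *s v | c. c \<noteq> 0}"

definition curve_points :: "form \<Rightarrow> (complex ^ 3) set set" where
  "curve_points F = {proj_point v | v. v \<noteq> 0 \<and> form_eval F v = 0}"


section \<open>Local rings and function fields\<close>

text \<open>
  Fractions of forms of equal degree, with numerator in \<open>N\<close> and denominator in
  \<open>D\<close>. All rings of rational functions on the plane used below consist of such fractions;
  the set \<open>D\<close> never contains 0.
\<close>

definition form_fractions :: "form set \<Rightarrow> form set \<Rightarrow> form fract set" where
  "form_fractions N D =
     {Fraction_Field.Fract g h | g h.
        g \<in> N \<and> h \<in> D \<and> (\<exists>e. homogeneous e g \<and> homogeneous e h)}"

definition fraction_ring :: "form fract set \<Rightarrow> form fract ring" where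
  "fraction_ring S = ring_of_type_algebra\<lparr>carrier := S\<rparr>"

text \<open>The local ring of the plane at the point with homogeneous coordinates \<open>v\<close>.\<close>

definition local_ring :: "complex ^ 3 \<Rightarrow> form fract ring" where
  "local_ring v = fraction_ring (form_fractions UNIV {h. form_eval h v \<noteq> 0})"

text \<open>
  The local ring of the plane at the generic point of the curve \<open>F = 0\<close> and its maximal
  ideal. Their quotient, the residue field at the generic point, is the function field of
  the curve; \<open>restrict_to_curve\<close> is the residue map.
\<close>

definition generic_ring :: "form \<Rightarrow> form fract ring" where
  "generic_ring F = fraction_ring (form_fractions UNIV {h. \<not> F dvd h})"

definition generic_ideal :: "form \<Rightarrow> form fract set" where
  "generic_ideal F = form_fractions {g. F dvd g} {h. \<not> F dvd h}"

definition function_field :: "form \<Rightarrow> form fract set ring" where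
  "function_field F = generic_ring F Quot generic_ideal F"

definition restrict_to_curve :: "form \<Rightarrow> form fract \<Rightarrow> form fract set" where
  "restrict_to_curve F x = generic_ideal F +>\<^bsub>generic_ring F\<^esub> x"

text \<open>
  For a point \<open>v\<close> of the curve \<open>F = 0\<close>: the local ring of the curve at that point, as a
  subring of the function field, and its maximal ideal.
\<close>

definition curve_local_ring :: "form \<Rightarrow> complex ^ 3 \<Rightarrow> form fract set set" where
  "curve_local_ring F v =
     restrict_to_curve F ` form_fractions UNIV {h. form_eval h v \<noteq> 0}"

definition curve_max_ideal :: "form \<Rightarrow> complex ^ 3 \<Rightarrow> form fract set set" where
  "curve_max_ideal F v =
     restrict_to_curve F ` form_fractions {g. form_eval g v = 0} {h. form_eval h v \<noteq> 0}"


section \<open>Normalization and unibranch points\<close>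

definition integral_closure :: "('a, 'b) ring_scheme \<Rightarrow> 'a set \<Rightarrow> 'a set" where
  "integral_closure K A =
     {x \<in> carrier K. \<exists>p. polynomial\<^bsub>K\<^esub> A p \<and> p \<noteq> [] \<and> Polynomials.lead_coeff p = \<one>\<^bsub>K\<^esub>
        \<and> ring.eval K p x = \<zero>\<^bsub>K\<^esub>}"

text \<open>
  Over the spectrum of the local ring \<open>O\<close> of the curve at \<open>v\<close>, the normalization of the
  curve is the spectrum of the integral closure of \<open>O\<close> in the function field. The
  preimages of the point are the primes of the integral closure that contract to the
  maximal ideal of \<open>O\<close>.
\<close>

definition local_normalization :: "form \<Rightarrow> complex ^ 3 \<Rightarrow> form fract set ring" where
  "local_normalization F v =
     (function_field F)
       \<lparr>carrier := integral_closure (function_field F) (curve_local_ring F v)\<rparr>"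

definition normalization_preimages :: "form \<Rightarrow> complex ^ 3 \<Rightarrow> form fract set set set" where
  "normalization_preimages F v =
     {P. primeideal P (local_normalization F v)
       \<and> P \<inter> curve_local_ring F v = curve_max_ideal F v}"

definition unibranch :: "form \<Rightarrow> complex ^ 3 \<Rightarrow> bool" where
  "unibranch F v \<longleftrightarrow> form_eval F v = 0 \<and> (\<exists>!P. P \<in> normalization_preimages F v)"


section \<open>Intersection multiplicity\<close>

text \<open>
  The local equations of \<open>F = 0\<close> at \<open>v\<close> are the fractions \<open>F / h\<close> with \<open>h\<close> a form of the
  same degree not vanishing at \<open>v\<close>; they differ by units. The intersection multiplicity is
  the complex dimension of the local ring of the plane modulo the local equations of the two
  curves.
\<close>

definition intersection_ring :: "form \<Rightarrow> form \<Rightarrow> complex ^ 3 \<Rightarrow> form fract set ring" where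
  "intersection_ring F G v =
     local_ring v Quot
       (Idl\<^bsub>local_ring v\<^esub> (form_fractions {F, G} {h. form_eval h v \<noteq> 0}))"

definition intersection_constants :: "form \<Rightarrow> form \<Rightarrow> complex ^ 3 \<Rightarrow> form fract set set" where
  "intersection_constants F G v =
     range (\<lambda>c. (Idl\<^bsub>local_ring v\<^esub> (form_fractions {F, G} {h. form_eval h v \<noteq> 0}))
                 +>\<^bsub>local_ring v\<^esub> Fraction_Field.Fract [:[:[:c:]:]:] 1)"

definition has_intersection_multiplicity :: "form \<Rightarrow> form \<Rightarrow> complex ^ 3 \<Rightarrow> nat \<Rightarrow> bool" where
  "has_intersection_multiplicity F G v n \<longleftrightarrow>
     ring.dimension (intersection_ring F G v) n (intersection_constants F G v)
       (carrier (intersection_ring F G v))"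


section \<open>Multiplicity, tangent lines and (m,n)-points\<close>

text \<open>\<open>translate v F\<close> is the polynomial \<open>F(v + (X,Y,Z))\<close>.\<close>

definition translate :: "complex ^ 3 \<Rightarrow> form \<Rightarrow> form" where
  "translate v F =
     map_poly (map_poly (\<lambda>p. pcompose p [:v $ 3, 1:]))
       (map_poly (\<lambda>p. pcompose p [:[:v $ 2:], 1:])
         (pcompose F [:[:[:v $ 1:]:], 1:]))"

definition homogeneous_part :: "nat \<Rightarrow> form \<Rightarrow> form" where
  "homogeneous_part s P =
     (\<Sum>i\<le>s. \<Sum>j\<le>s - i. Polynomial.monom (Polynomial.monom (Polynomial.monom
        (Polynomial.coeff (Polynomial.coeff (Polynomial.coeff P i) j) (s - i - j))
        (s - i - j)) j) i)"

text \<open>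
  Write \<open>f(x,y) = F(v + x e1 + y e2)\<close> for the equation of the curve in an affine chart
  centred at the point \<open>v\<close>, where \<open>e1, e2, v\<close> is a basis. As \<open>F\<close> is homogeneous of some
  degree \<open>d\<close>,
  \<open>F(v + x e1 + y e2 + w v) = (1 + w)^d f(x / (1 + w), y / (1 + w))\<close>,
  so the lowest homogeneous part of the translate is the lowest homogeneous part of \<open>f\<close>,
  of degree the multiplicity, and it is the equation of the projective tangent cone. The
  tangent lines at the point are the linear components of that cone; at a unibranch point
  there is only one.
\<close>

definition multiplicity_at :: "form \<Rightarrow> complex ^ 3 \<Rightarrow> nat" where
  "multiplicity_at F v = (LEAST s. homogeneous_part s (translate v F) \<noteq> 0)"

definition tangent_line :: "form \<Rightarrow> complex ^ 3 \<Rightarrow> form \<Rightarrow> bool" where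
  "tangent_line F v L \<longleftrightarrow>
     homogeneous 1 L \<and> L \<noteq> 0 \<and> form_eval L v = 0
     \<and> L dvd homogeneous_part (multiplicity_at F v) (translate v F)"

definition mn_point :: "form \<Rightarrow> complex ^ 3 \<Rightarrow> nat \<Rightarrow> nat \<Rightarrow> bool" where
  "mn_point F v m n \<longleftrightarrow>
     unibranch F v \<and> m = multiplicity_at F v
     \<and> (\<exists>L. tangent_line F v L \<and> has_intersection_multiplicity F L v n)"


section \<open>Tropical curves\<close>

text \<open>
  \<open>end_points e\<close> is the set of end points of the edge \<open>e\<close>, a singleton if \<open>e\<close> is a loop; multiple
  edges and multiple legs are allowed.
\<close>

record ('v, 'e, 'l) tropical_graph =
  verts :: "'v set"
  edges :: "'e set"
  end_points :: "'e \<Rightarrow> 'v set"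
  edge_length :: "'e \<Rightarrow> real"
  legs :: "'l set"
  leg_vertex :: "'l \<Rightarrow> 'v"
  leg_length :: "'l \<Rightarrow> real"

definition tropical_curve :: "('v, 'e, 'l) tropical_graph \<Rightarrow> bool" where
  "tropical_curve \<Gamma> \<longleftrightarrow>
     finite (verts \<Gamma>) \<and> finite (edges \<Gamma>) \<and> finite (legs \<Gamma>)
     \<and> (\<forall>e \<in> edges \<Gamma>. end_points \<Gamma> e \<subseteq> verts \<Gamma> \<and> card (end_points \<Gamma> e) \<in> {1, 2} \<and> edge_length \<Gamma> e > 0)
     \<and> (\<forall>l \<in> legs \<Gamma>. leg_vertex \<Gamma> l \<in> verts \<Gamma> \<and> leg_length \<Gamma> l > 0)"

definition tropical_iso ::
  "('v, 'e, 'l) tropical_graph \<Rightarrow> ('w, 'f, 'k) tropical_graph \<Rightarrow> bool" where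
  "tropical_iso \<Gamma> \<Delta> \<longleftrightarrow>
     tropical_curve \<Gamma> \<and> tropical_curve \<Delta> \<and>
     (\<exists>\<phi> \<epsilon> \<psi>. bij_betw \<phi> (verts \<Gamma>) (verts \<Delta>)
        \<and> bij_betw \<epsilon> (edges \<Gamma>) (edges \<Delta>)
        \<and> bij_betw \<psi> (legs \<Gamma>) (legs \<Delta>)
        \<and> (\<forall>e \<in> edges \<Gamma>. end_points \<Delta> (\<epsilon> e) = \<phi> ` end_points \<Gamma> e \<and> edge_length \<Delta> (\<epsilon> e) = edge_length \<Gamma> e)
        \<and> (\<forall>l \<in> legs \<Gamma>. leg_vertex \<Delta> (\<psi> l) = \<phi> (leg_vertex \<Gamma> l) \<and> leg_length \<Delta> (\<psi> l) = leg_length \<Gamma> l))"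


section \<open>The contact tropical curve\<close>

text \<open>The sequences \<open>l_j\<close>, \<open>k_j\<close> and the index \<open>r\<close>; meaningful for \<open>n > m > 0\<close>.\<close>

fun euclid_seq :: "nat \<Rightarrow> nat \<Rightarrow> nat \<Rightarrow> nat" where
  "euclid_seq m n 0 = n"
| "euclid_seq m n (Suc 0) = m"
| "euclid_seq m n (Suc (Suc j)) =
     euclid_seq m n j - euclid_seq m n (Suc j) * (euclid_seq m n j div euclid_seq m n (Suc j))"

definition euclid_len :: "nat \<Rightarrow> nat \<Rightarrow> nat" where
  "euclid_len m n = (LEAST j. euclid_seq m n (Suc j) = 0)"

definition euclid_quot :: "nat \<Rightarrow> nat \<Rightarrow> nat \<Rightarrow> nat" where
  "euclid_quot m n j = euclid_seq m n (j - 1) div euclid_seq m n j"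

datatype contact_vertex = C_vertex | E_vertex | A_vertex nat

text \<open>
  Contact curves have neither loops nor multiple edges, so an edge is given by its set of end
  points and its length, and a leg by its vertex and its length.
\<close>

definition contact_edges :: "nat \<Rightarrow> nat \<Rightarrow> (contact_vertex set \<times> real) set" where
  "contact_edges m n =
     (let r = euclid_len m n; k = (\<lambda>j. real (euclid_quot m n j)) in
      if r > 1 then
        {({C_vertex, E_vertex}, 1), ({E_vertex, A_vertex r}, 1),
         ({E_vertex, A_vertex (r - 1)}, k r)}
        \<union> {({A_vertex (j + 1), A_vertex (j - 1)}, k j) | j. 2 \<le> j \<and> j \<le> r - 1}
      else {({C_vertex, E_vertex}, 1), ({E_vertex, A_vertex 1}, 1)})"

definition contact_legs :: "nat \<Rightarrow> nat \<Rightarrow> (contact_vertex \<times> real) set" where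
  "contact_legs m n =
     (let r = euclid_len m n; k = (\<lambda>j. real (euclid_quot m n j)) in
      if r > 1 then (if k 1 > 1 then {(A_vertex 2, k 1 - 1)} else {})
      else {(E_vertex, k 1 - 1)})"

definition contact_curve ::
  "nat \<Rightarrow> nat \<Rightarrow>
   (contact_vertex, contact_vertex set \<times> real, contact_vertex \<times> real) tropical_graph" where
  "contact_curve m n =
     \<lparr>verts = {C_vertex, E_vertex} \<union> A_vertex ` {1..euclid_len m n},
      edges = contact_edges m n, end_points = fst, edge_length = snd,
      legs = contact_legs m n, leg_vertex = fst, leg_length = snd\<rparr>"

end

theory Submission
  imports Defs
begin

text \<open>
  Why the theorem holds. Choose affine coordinates centred at the common point, with the tangent
  line of \<open>C\<close> as the axis \<open>y = 0\<close>. At a unibranch point the Newton polygon of the local equation is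
  the single segment from \<open>y^m\<close> to \<open>x^n\<close> (\<open>newton_polygon\<close>). Were the slopes of the two curves
  different, say \<open>n / m < n' / m'\<close>, then for the weights \<open>m'\<close> of \<open>x\<close> and \<open>n'\<close> of \<open>y\<close> the initial form
  of the equation of \<open>C\<close> would be a constant multiple of \<open>x^n\<close>, while that of \<open>B\<close> contains \<open>y^m'\<close>. As the curves
  meet nowhere else, the \<open>n m'\<close> monomials \<open>x^i y^j\<close> with \<open>i < n\<close> and \<open>j < m'\<close> would then span the
  polynomials modulo the two equations (\<open>weighted_span\<close>). This quotient has dimension at least the product of
  the degrees (\<open>bezout_weighted_bound\<close>), so \<open>dB * dC \<le> n m'\<close>. But \<open>n \<le> dC\<close>
  and \<open>m' < n' \<le> dB\<close>, because \<open>n\<close> and \<open>n'\<close> are the vanishing orders at the point of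
  the equations restricted to the tangent lines. If the tangent lines
  were different, the same count with weights \<open>1, 1\<close> would give \<open>dB * dC \<le> m m'\<close>, which
  is absurd for the same reason. So \<open>m' / n' = m / n\<close>, and the contact curve depends on this quotient
  only, since the Euclidean algorithm commutes with scaling.

  The Newton polygon is read off from the preimages of the point in the normalization. Let \<open>p, q\<close> be
  weights for which \<open>y^m\<close> belongs to the initial form of the equation. The function \<open>u = y^p / x^q\<close> is
  integral over the local ring (\<open>slope_integral\<close>), and each root \<open>c\<close> of the initial form at \<open>x = 1\<close> gives a
  place of the function field, centred at the point, in which \<open>u\<close> takes the value \<open>c^p\<close>
  (\<open>weighted_place\<close>). By Zorn's lemma such a place extends to the integral closure
  (\<open>maximal_place_integrally_closed\<close>), and its centre is a preimage of the point. Only one preimage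
  exists, so \<open>c^p\<close> is the same for all roots (\<open>initial_form_roots\<close>). With weights \<open>1, 1\<close> this makes
  the tangent cone a power of one line; with the weights of the first edge of the Newton polygon it
  rules out a second edge.
\<close>

section \<open>Polynomial substitutions\<close>

text \<open>
  Evaluations of forms land in many rings, among them polynomial rings and fields of fractions.
  A predicate on functions allows one to compose them freely and to compare them on generators.
\<close>

definition ring_morphism :: "('a::comm_ring_1 \<Rightarrow> 'b::comm_ring_1) \<Rightarrow> bool" where
  "ring_morphism h \<longleftrightarrow> h 0 = 0 \<and> h 1 = 1 \<and> (\<forall>a b. h (a + b) = h a + h b) \<and> (\<forall>a b. h (a * b) = h a * h b)"

lemma ring_morphism_zero: "ring_morphism h \<Longrightarrow> h 0 = 0"
  and ring_morphism_one: "ring_morphism h \<Longrightarrow> h 1 = 1"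
  and ring_morphism_add: "ring_morphism h \<Longrightarrow> h (a + b) = h a + h b"
  and ring_morphism_mult: "ring_morphism h \<Longrightarrow> h (a * b) = h a * h b"
  by (simp_all add: ring_morphism_def)

lemma ring_morphism_uminus: "ring_morphism h \<Longrightarrow> h (- a) = - h a"
  using ring_morphism_add[of h "- a" a] by (simp add: ring_morphism_zero eq_neg_iff_add_eq_0)

lemma ring_morphism_diff: "ring_morphism h \<Longrightarrow> h (a - b) = h a - h b"
  using ring_morphism_add[of h a "- b"] by (simp add: ring_morphism_uminus)

lemma ring_morphism_power: "ring_morphism h \<Longrightarrow> h (a ^ n) = h a ^ n"
  by (induction n) (simp_all add: ring_morphism_one ring_morphism_mult)

lemma ring_morphism_sum: "ring_morphism h \<Longrightarrow> h (sum f A) = (\<Sum>i\<in>A. h (f i))"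
  by (induction A rule: infinite_finite_induct) (simp_all add: ring_morphism_zero ring_morphism_add)

lemma ring_morphism_prod: "ring_morphism h \<Longrightarrow> h (prod f A) = (\<Prod>i\<in>A. h (f i))"
  by (induction A rule: infinite_finite_induct) (simp_all add: ring_morphism_one ring_morphism_mult)

lemma ring_morphism_dvd: "ring_morphism h \<Longrightarrow> a dvd b \<Longrightarrow> h a dvd h b"
  by (auto simp: dvd_def ring_morphism_mult)

lemma ring_morphism_comp: "ring_morphism h \<Longrightarrow> ring_morphism k \<Longrightarrow> ring_morphism (\<lambda>x. k (h x))"
  by (simp add: ring_morphism_def)

lemma ring_morphism_const: "ring_morphism (\<lambda>c. [:c:])"
  by (simp add: ring_morphism_def one_pCons)

lemma ring_morphism_poly: "ring_morphism (\<lambda>p. poly p a)"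
  by (simp add: ring_morphism_def)

lemmas ring_morphism_simps = ring_morphism_zero ring_morphism_one ring_morphism_add ring_morphism_mult
  ring_morphism_uminus ring_morphism_diff ring_morphism_power ring_morphism_sum ring_morphism_prod

definition subst :: "('a::comm_ring_1 \<Rightarrow> 'b::comm_ring_1) \<Rightarrow> 'b \<Rightarrow> 'a poly \<Rightarrow> 'b" where
  "subst h a p = poly (map_poly h p) a"

lemma subst_zero [simp]: "subst h a 0 = 0"
  by (simp add: subst_def)

lemma subst_pCons: "ring_morphism h \<Longrightarrow> subst h a (pCons c p) = h c + a * subst h a p"
  by (cases "p = 0 \<and> c = 0") (auto simp: subst_def map_poly_pCons ring_morphism_zero)

lemma subst_const: "ring_morphism h \<Longrightarrow> subst h a [:c:] = h c"
  by (simp add: subst_pCons)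

lemma subst_add: "ring_morphism h \<Longrightarrow> subst h a (p + q) = subst h a p + subst h a q"
  by (induction p q rule: poly_induct2) (simp_all add: subst_pCons ring_morphism_simps algebra_simps)

lemma subst_smult: "ring_morphism h \<Longrightarrow> subst h a (Polynomial.smult c p) = h c * subst h a p"
  by (induction p) (simp_all add: subst_pCons ring_morphism_simps algebra_simps)

lemma subst_mult: "ring_morphism h \<Longrightarrow> subst h a (p * q) = subst h a p * subst h a q"
  by (induction p) (simp_all add: subst_pCons subst_add subst_smult ring_morphism_simps algebra_simps)

lemma ring_morphism_subst: "ring_morphism h \<Longrightarrow> ring_morphism (subst h a)"
  by (simp add: ring_morphism_def[of "subst h a"] subst_add subst_mult one_pCons subst_const ring_morphism_one)

lemma subst_monom: "ring_morphism h \<Longrightarrow> subst h a (Polynomial.monom c n) = h c * a ^ n"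
  by (induction n) (simp_all add: monom_0 monom_Suc subst_pCons ring_morphism_zero algebra_simps)

lemma ring_morphism_poly_eqI:
  assumes "ring_morphism h" "ring_morphism k" "\<And>c. h [:c:] = k [:c:]" "h [:0, 1:] = k [:0, 1:]"
  shows "h p = k p"
proof (induction p)
  case (pCons c p)
  have "pCons c p = [:c:] + [:0, 1:] * p" by simp
  then show ?case by (simp only: ring_morphism_add ring_morphism_mult assms pCons)
qed (simp add: assms ring_morphism_zero)

section \<open>Polynomials in two variables\<close>

text \<open>
  Polynomials in \<open>x\<close> and \<open>y\<close>; the outer variable is \<open>y\<close>.
\<close>

type_synonym bipoly = "complex poly poly"

abbreviation bicoeff :: "bipoly \<Rightarrow> nat \<Rightarrow> nat \<Rightarrow> complex" where
  "bicoeff P i j \<equiv> Polynomial.coeff (Polynomial.coeff P j) i"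

abbreviation bimonom :: "complex \<Rightarrow> nat \<Rightarrow> nat \<Rightarrow> bipoly" where
  "bimonom c i j \<equiv> Polynomial.monom (Polynomial.monom c i) j"

lemma bicoeff_bimonom: "bicoeff (bimonom c i j) a b = (if a = i \<and> b = j then c else 0)"
  by simp

lemma bicoeff_bimonom_mult:
  "bicoeff (bimonom c i j * P) a b = (if i \<le> a \<and> j \<le> b then c * bicoeff P (a - i) (b - j) else 0)"
  by (simp add: coeff_monom_mult)

lemma bipoly_sum_monoms:
  "P = (\<Sum>j\<le>Polynomial.degree P. \<Sum>i\<le>Polynomial.degree (Polynomial.coeff P j). bimonom (bicoeff P i j) i j)"
proof -
  have "P = (\<Sum>j\<le>Polynomial.degree P. Polynomial.monom (Polynomial.coeff P j) j)"
    by (simp add: poly_as_sum_of_monoms)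
  also have "\<dots> = (\<Sum>j\<le>Polynomial.degree P. Polynomial.monom
      (\<Sum>i\<le>Polynomial.degree (Polynomial.coeff P j). Polynomial.monom (bicoeff P i j) i) j)"
    by (simp add: poly_as_sum_of_monoms)
  finally show ?thesis by (simp add: monom_sum)
qed

interpretation bipoly: vector_space "\<lambda>c. Polynomial.smult [:c:] :: bipoly \<Rightarrow> bipoly"
proof
  fix a b :: complex and P :: bipoly
  have "[:a + b:] = [:a:] + [:b:]" by simp
  then show "Polynomial.smult [:a + b:] P = Polynomial.smult [:a:] P + Polynomial.smult [:b:] P"
    by (simp only: smult_add_left)
  show "Polynomial.smult [:1:] P = P" by (simp flip: one_pCons)
qed (simp_all add: smult_add_right mult.commute)

lemma bipoly_in_subspace:
  assumes "bipoly.subspace W" "\<And>i j. bicoeff P i j \<noteq> 0 \<Longrightarrow> bimonom 1 i j \<in> W"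
  shows "P \<in> W"
proof -
  have "bimonom (bicoeff P i j) i j \<in> W" for i j
  proof (cases "bicoeff P i j = 0")
    case False
    have "bimonom (bicoeff P i j) i j = Polynomial.smult [:bicoeff P i j:] (bimonom 1 i j)"
      by (simp add: smult_monom)
    then show ?thesis using assms False bipoly.subspace_scale by presburger
  qed (simp add: bipoly.subspace_0 assms)
  then show ?thesis
    by (subst bipoly_sum_monoms) (intro bipoly.subspace_sum assms(1))
qed

text \<open>
  The substitution \<open>x = t^p\<close>, \<open>y = z t^q\<close>, with \<open>t\<close> as the outer variable of the result. It sorts a
  polynomial by weight: the coefficient of \<open>t^N\<close> is the part of weight \<open>N\<close> at \<open>x = 1\<close>, \<open>y = z\<close>. In particular
  for \<open>p = q = 1\<close> the degree in \<open>t\<close> is the total degree, and it is additive because the coefficients lie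
  in an integral domain.
\<close>

definition weighted_subst :: "nat \<Rightarrow> nat \<Rightarrow> bipoly \<Rightarrow> bipoly" where
  "weighted_subst p q = subst (subst (\<lambda>c. [:[:c:]:]) (Polynomial.monom 1 p)) (bimonom 1 1 q)"

lemma ring_morphism_const2: "ring_morphism (\<lambda>c. [:[:c:]:])"
  by (intro ring_morphism_comp[OF ring_morphism_const ring_morphism_const])

lemma ring_morphism_weighted_subst: "ring_morphism (weighted_subst p q)"
  unfolding weighted_subst_def by (intro ring_morphism_subst ring_morphism_const2)

lemma weighted_subst_bimonom:
  "weighted_subst p q (bimonom c i j) = bimonom c j (p * i + q * j)"
  unfolding weighted_subst_def
  by (simp add: subst_monom ring_morphism_subst ring_morphism_const2 monom_power mult_monom smult_monom)

lemma weighted_subst_coeff: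
  assumes "p > 0"
  shows "Polynomial.coeff (Polynomial.coeff (weighted_subst p q P) N) j
    = (if q * j \<le> N \<and> p dvd N - q * j then bicoeff P ((N - q * j) div p) j else 0)"
proof -
  let ?n = "\<lambda>j'. Polynomial.degree (Polynomial.coeff P j')"
  have "weighted_subst p q P = (\<Sum>j'\<le>Polynomial.degree P. \<Sum>i\<le>?n j'. bimonom (bicoeff P i j') j' (p * i + q * j'))"
    by (subst bipoly_sum_monoms[of P]) (simp add: ring_morphism_sum ring_morphism_weighted_subst weighted_subst_bimonom)
  then have "Polynomial.coeff (Polynomial.coeff (weighted_subst p q P) N) j =
     (\<Sum>j'\<le>Polynomial.degree P. \<Sum>i\<le>?n j'. if p * i + q * j' = N \<and> j' = j then bicoeff P i j' else 0)"
    by (simp add: coeff_sum if_distrib[of "\<lambda>q. Polynomial.coeff q _"] cong: if_cong) (intro sum.cong refl; auto)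
  also have "\<dots> = (\<Sum>j'\<le>Polynomial.degree P. if j' = j then (\<Sum>i\<le>?n j. if p * i + q * j = N then bicoeff P i j else 0) else 0)"
    by (intro sum.cong refl) (auto intro!: sum.cong)
  also have "\<dots> = (\<Sum>i\<le>?n j. if p * i + q * j = N then bicoeff P i j else 0)"
  proof (cases "j \<le> Polynomial.degree P")
    case False
    then have "Polynomial.coeff P j = 0" by (simp add: Polynomial.coeff_eq_0)
    then have "(\<Sum>i\<le>?n j. if p * i + q * j = N then bicoeff P i j else 0) = 0"
      by (intro sum.neutral ballI) (simp only: coeff_0 if_cancel)
    then show ?thesis using False by (simp only: sum.delta finite_atMost atMost_iff if_False)
  qed (simp only: sum.delta finite_atMost atMost_iff if_True)
  also have "\<dots> = (if q * j \<le> N \<and> p dvd N - q * j then bicoeff P ((N - q * j) div p) j else 0)"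
  proof (cases "q * j \<le> N \<and> p dvd N - q * j")
    case True
    then have "p * i + q * j = N \<longleftrightarrow> i = (N - q * j) div p" for i using assms by (auto simp: dvd_def)
    then show ?thesis using True by (auto simp: coeff_eq_0)
  next
    case False
    then have "p * i + q * j \<noteq> N" for i by auto
    then show ?thesis by (subst if_not_P[OF False]) simp
  qed
  finally show ?thesis .
qed

section \<open>Extension of complex places\<close>

text \<open>
  The graph of a ring homomorphism from a subring of a field to the complex numbers. Partially defined
  homomorphisms are thereby ordered by inclusion, and the union of a chain is an upper bound.
\<close>

definition place_graph :: "('a::field \<times> complex) set \<Rightarrow> bool" where
  "place_graph \<Gamma> \<longleftrightarrow> (1, 1) \<in> \<Gamma>
     \<and> (\<forall>a z b w. (a, z) \<in> \<Gamma> \<longrightarrow> (b, w) \<in> \<Gamma> \<longrightarrow> (a - b, z - w) \<in> \<Gamma> \<and> (a * b, z * w) \<in> \<Gamma>)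
     \<and> (\<forall>z. (0, z) \<in> \<Gamma> \<longrightarrow> z = 0)"

text \<open>
  The polynomial \<open>h\<close> has coefficients in the domain of the homomorphism, which maps it to \<open>k\<close>.
\<close>

definition specializes :: "('a::field \<times> complex) set \<Rightarrow> 'a poly \<Rightarrow> complex poly \<Rightarrow> bool" where
  "specializes \<Gamma> h k \<longleftrightarrow> (\<forall>i. (Polynomial.coeff h i, Polynomial.coeff k i) \<in> \<Gamma>)"

lemma specializes_oneD: "specializes \<Gamma> h 1 \<Longrightarrow> (Polynomial.coeff h i, if i = 0 then 1 else 0) \<in> \<Gamma>"
  unfolding specializes_def by (drule spec[of _ i]) (cases "i = 0"; simp)

lemma place_graph_one: "place_graph \<Gamma> \<Longrightarrow> (1, 1) \<in> \<Gamma>"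
  and place_graph_diff: "place_graph \<Gamma> \<Longrightarrow> (a, z) \<in> \<Gamma> \<Longrightarrow> (b, w) \<in> \<Gamma> \<Longrightarrow> (a - b, z - w) \<in> \<Gamma>"
  and place_graph_mult: "place_graph \<Gamma> \<Longrightarrow> (a, z) \<in> \<Gamma> \<Longrightarrow> (b, w) \<in> \<Gamma> \<Longrightarrow> (a * b, z * w) \<in> \<Gamma>"
  and place_graph_zero_value: "place_graph \<Gamma> \<Longrightarrow> (0, z) \<in> \<Gamma> \<Longrightarrow> z = 0"
  unfolding place_graph_def by blast+

lemma place_graph_zero: "place_graph \<Gamma> \<Longrightarrow> (0, 0) \<in> \<Gamma>"
  using place_graph_diff[OF _ place_graph_one place_graph_one] by fastforce

lemma place_graph_add:
  assumes "place_graph \<Gamma>" "(a, z) \<in> \<Gamma>" "(b, w) \<in> \<Gamma>"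
  shows "(a + b, z + w) \<in> \<Gamma>"
  using place_graph_diff[OF assms(1,2) place_graph_diff[OF assms(1) place_graph_zero[OF assms(1)] assms(3)]]
  by simp

lemma place_graph_value_unique:
  assumes "place_graph \<Gamma>" "(a, z) \<in> \<Gamma>" "(a, w) \<in> \<Gamma>"
  shows "z = w"
  using place_graph_zero_value[OF assms(1), of "z - w"] place_graph_diff[OF assms] by simp

lemma place_graph_sum:
  assumes "place_graph \<Gamma>" "\<And>i. i \<in> A \<Longrightarrow> (f i, g i) \<in> \<Gamma>"
  shows "(sum f A, sum g A) \<in> \<Gamma>"
  using assms(2)
  by (induction A rule: infinite_finite_induct) (auto intro: place_graph_add place_graph_zero assms(1))

lemma place_graph_power:
  assumes "place_graph \<Gamma>" "(a, z) \<in> \<Gamma>"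
  shows "(a ^ n, z ^ n) \<in> \<Gamma>"
  by (induction n) (auto intro: place_graph_mult place_graph_one assms)

lemma poly_eq_sum:
  fixes p :: "'a::comm_semiring_1 poly"
  assumes "Polynomial.degree p \<le> N"
  shows "poly p x = (\<Sum>i\<le>N. Polynomial.coeff p i * x ^ i)"
  unfolding poly_altdef using assms
  by (intro sum.mono_neutral_left) (auto simp: coeff_eq_0)

lemma place_graph_poly:
  assumes "place_graph \<Gamma>" "specializes \<Gamma> h k" "(a, z) \<in> \<Gamma>"
  shows "(poly h a, poly k z) \<in> \<Gamma>"
proof -
  define N where "N = max (Polynomial.degree h) (Polynomial.degree k)"
  have "poly h a = (\<Sum>i\<le>N. Polynomial.coeff h i * a ^ i)"
    and "poly k z = (\<Sum>i\<le>N. Polynomial.coeff k i * z ^ i)"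
    unfolding N_def by (intro poly_eq_sum; simp)+
  then show ?thesis
    using assms by (auto simp: specializes_def intro!: place_graph_sum place_graph_mult place_graph_power)
qed

lemma specializes_diff:
  "place_graph \<Gamma> \<Longrightarrow> specializes \<Gamma> h k \<Longrightarrow> specializes \<Gamma> h' k' \<Longrightarrow> specializes \<Gamma> (h - h') (k - k')"
  by (simp add: specializes_def place_graph_diff)

lemma specializes_mult:
  "place_graph \<Gamma> \<Longrightarrow> specializes \<Gamma> h k \<Longrightarrow> specializes \<Gamma> h' k' \<Longrightarrow> specializes \<Gamma> (h * h') (k * k')"
  by (auto simp: specializes_def coeff_mult intro!: place_graph_sum place_graph_mult)

lemma specializes_monom:
  "place_graph \<Gamma> \<Longrightarrow> (c, z) \<in> \<Gamma> \<Longrightarrow> specializes \<Gamma> (Polynomial.monom c n) (Polynomial.monom z n)"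
  by (auto simp: specializes_def place_graph_zero)

lemma specializes_reflect:
  assumes "place_graph \<Gamma>" "specializes \<Gamma> h k"
  shows "\<exists>k'. specializes \<Gamma> (reflect_poly h) k'
      \<and> (\<forall>i. Polynomial.coeff k' i = (if i > Polynomial.degree h then 0 else Polynomial.coeff k (Polynomial.degree h - i)))"
proof -
  define c where "c i = (if i > Polynomial.degree h then 0 else Polynomial.coeff k (Polynomial.degree h - i))" for i
  define k' where "k' = Abs_poly c"
  have "Polynomial.coeff k' = c"
    unfolding k'_def by (rule Abs_poly_inverse) (auto simp: c_def MOST_nat)
  then show ?thesis
    using assms by (intro exI[of _ k']) (auto simp: specializes_def coeff_reflect_poly c_def place_graph_zero)
qed

lemma specializes_lift:
  assumes "place_graph \<Gamma>" "\<And>z. \<exists>c. (c, z) \<in> \<Gamma>"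
  shows "\<exists>h. specializes \<Gamma> h k"
proof (induction k)
  case 0
  show ?case by (rule exI[of _ 0]) (simp add: specializes_def place_graph_zero assms)
next
  case (pCons z k)
  then obtain h c where "specializes \<Gamma> h k" "(c, z) \<in> \<Gamma>" using assms by blast
  then show ?case
    by (intro exI[of _ "pCons c h"]) (auto simp: specializes_def coeff_pCons split: nat.splits)
qed

lemma specializes_project:
  assumes "place_graph \<Gamma>" "\<And>i. Polynomial.coeff h i \<in> Domain \<Gamma>"
  shows "\<exists>k. specializes \<Gamma> h k"
  using assms(2)
proof (induction h)
  case 0
  show ?case by (rule exI[of _ 0]) (simp add: specializes_def place_graph_zero assms)
next
  case (pCons c h)
  have "Polynomial.coeff h i \<in> Domain \<Gamma>" for i
    using pCons(3)[of "Suc i"] by simp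
  then obtain k where "specializes \<Gamma> h k" using pCons by blast
  moreover obtain z where "(c, z) \<in> \<Gamma>" using pCons(3)[of 0] by auto
  ultimately show ?case
    by (intro exI[of _ "pCons z k"]) (auto simp: specializes_def coeff_pCons split: nat.splits)
qed

definition maximal_place :: "('a::field \<times> complex) set \<Rightarrow> bool" where
  "maximal_place \<Gamma> \<longleftrightarrow> place_graph \<Gamma> \<and> (\<forall>z. \<exists>c. (c, z) \<in> \<Gamma>)
     \<and> (\<forall>\<Gamma>'. place_graph \<Gamma>' \<longrightarrow> \<Gamma> \<subseteq> \<Gamma>' \<longrightarrow> \<Gamma>' = \<Gamma>)"

lemma maximal_place_exists:
  assumes "place_graph \<Gamma>\<^sub>0" "\<And>z. \<exists>c. (c, z) \<in> \<Gamma>\<^sub>0"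
  shows "\<exists>\<Gamma>. maximal_place \<Gamma> \<and> \<Gamma>\<^sub>0 \<subseteq> \<Gamma>"
proof -
  let ?P = "{\<Gamma>. place_graph \<Gamma> \<and> \<Gamma>\<^sub>0 \<subseteq> \<Gamma>}"
  have "\<exists>M \<in> ?P. \<forall>N \<in> ?P. M \<subseteq> N \<longrightarrow> N = M"
  proof (rule subset_Zorn_nonempty)
    show "?P \<noteq> {}" using assms by blast
    fix \<C> assume ne: "\<C> \<noteq> {}" and ch: "subset.chain ?P \<C>"
    then have sub: "\<And>\<Gamma>. \<Gamma> \<in> \<C> \<Longrightarrow> place_graph \<Gamma> \<and> \<Gamma>\<^sub>0 \<subseteq> \<Gamma>" by (auto simp: subset.chain_def)
    have common: "\<exists>\<Gamma>\<in>\<C>. x \<in> \<Gamma> \<and> y \<in> \<Gamma>" if "x \<in> \<Union>\<C>" "y \<in> \<Union>\<C>" for x y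
    proof -
      obtain \<Gamma>1 \<Gamma>2 where "\<Gamma>1 \<in> \<C>" "\<Gamma>2 \<in> \<C>" "x \<in> \<Gamma>1" "y \<in> \<Gamma>2" using \<open>x \<in> \<Union>\<C>\<close> \<open>y \<in> \<Union>\<C>\<close> by blast
      moreover from this have "\<Gamma>1 \<subseteq> \<Gamma>2 \<or> \<Gamma>2 \<subseteq> \<Gamma>1" using ch by (simp add: subset_chain_def)
      ultimately show ?thesis by blast
    qed
    have "place_graph (\<Union>\<C>)"
      unfolding place_graph_def
    proof (intro conjI allI impI)
      obtain \<Gamma> where "\<Gamma> \<in> \<C>" using ne by blast
      then show "(1, 1) \<in> \<Union>\<C>" using sub place_graph_one by blast
      fix a z b w assume "(a, z) \<in> \<Union>\<C>" "(b, w) \<in> \<Union>\<C>"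
      then obtain \<Gamma> where "\<Gamma> \<in> \<C>" "(a, z) \<in> \<Gamma>" "(b, w) \<in> \<Gamma>" using common by blast
      then have "(a - b, z - w) \<in> \<Gamma>" "(a * b, z * w) \<in> \<Gamma>" "\<Gamma> \<in> \<C>"
        using sub place_graph_diff place_graph_mult by blast+
      then show "(a - b, z - w) \<in> \<Union>\<C>" "(a * b, z * w) \<in> \<Union>\<C>" by blast+
    next
      fix z :: complex assume "(0, z) \<in> \<Union>\<C>"
      then obtain \<Gamma> where "\<Gamma> \<in> \<C>" "(0, z) \<in> \<Gamma>" by blast
      then show "z = 0" using sub place_graph_zero_value by blast
    qed
    then show "\<Union>\<C> \<in> ?P" using ne sub by blast
  qed
  then obtain M where M: "M \<in> ?P" "\<forall>N \<in> ?P. M \<subseteq> N \<longrightarrow> N = M" by (rule bexE)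
  have "N = M" if "place_graph N" "M \<subseteq> N" for N
    using M(1) that by (intro M(2)[rule_format]) auto
  moreover have "\<exists>c. (c, z) \<in> M" for z
    using assms(2)[of z] M(1) by blast
  ultimately have "maximal_place M" "\<Gamma>\<^sub>0 \<subseteq> M"
    unfolding maximal_place_def using M(1) by auto
  then show ?thesis by blast
qed

text \<open>
  If no number \<open>\<gamma>\<close> can be assigned to \<open>a\<close>, then for every \<open>\<gamma>\<close> some polynomial vanishing at \<open>a\<close> specializes
  to one that does not vanish at \<open>\<gamma>\<close>. The specializations of the polynomials vanishing at \<open>a\<close> form an ideal of
  \<open>\<complex>[U]\<close>; having no common zero, it contains 1.
\<close>

lemma maximal_place_relation:
  fixes a :: "'a::field"
  assumes max: "maximal_place \<Gamma>" and a: "a \<notin> Domain \<Gamma>"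
  shows "\<exists>h. specializes \<Gamma> h 1 \<and> poly h a = 0"
proof -
  have pg: "place_graph \<Gamma>" and onto: "\<And>z. \<exists>c. (c, z) \<in> \<Gamma>"
    and maxi: "\<And>\<Gamma>'. place_graph \<Gamma>' \<Longrightarrow> \<Gamma> \<subseteq> \<Gamma>' \<Longrightarrow> \<Gamma>' = \<Gamma>"
    using max by (auto simp: maximal_place_def)
  define J where "J = {k. \<exists>h. specializes \<Gamma> h k \<and> poly h a = 0}"
  have Jdiff: "k - k' \<in> J" if "k \<in> J" "k' \<in> J" for k k'
    using that specializes_diff[OF pg] unfolding J_def by fastforce
  have Jmult: "k * k' \<in> J" if "k \<in> J" for k k'
    using that specializes_mult[OF pg] specializes_lift[OF pg onto, of k'] unfolding J_def by fastforce
  have no_root: "\<exists>k\<in>J. poly k \<gamma> \<noteq> 0" for \<gamma>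
  proof (rule ccontr)
    assume root: "\<not> ?thesis"
    define \<Gamma>' where "\<Gamma>' = {(poly h a, poly k \<gamma>) | h k. specializes \<Gamma> h k}"
    have "place_graph \<Gamma>'"
      unfolding place_graph_def
    proof (intro conjI allI impI)
      have "specializes \<Gamma> 1 1"
        using specializes_monom[OF pg place_graph_one[OF pg], of 0] by (simp add: monom_0 one_pCons)
      then show "(1, 1) \<in> \<Gamma>'" unfolding \<Gamma>'_def by force
      fix b z c w assume "(b, z) \<in> \<Gamma>'" "(c, w) \<in> \<Gamma>'"
      then obtain h k h' k' where "specializes \<Gamma> h k" "specializes \<Gamma> h' k'"
        "b = poly h a" "z = poly k \<gamma>" "c = poly h' a" "w = poly k' \<gamma>" unfolding \<Gamma>'_def by blast
      moreover from this have "specializes \<Gamma> (h - h') (k - k')" "specializes \<Gamma> (h * h') (k * k')"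
        using specializes_diff specializes_mult pg by blast+
      ultimately show "(b - c, z - w) \<in> \<Gamma>'" "(b * c, z * w) \<in> \<Gamma>'"
        unfolding \<Gamma>'_def by force+
    next
      fix z assume "(0, z) \<in> \<Gamma>'"
      then obtain h k where "specializes \<Gamma> h k" "poly h a = 0" "z = poly k \<gamma>" unfolding \<Gamma>'_def by force
      then show "z = 0" using root unfolding J_def by blast
    qed
    moreover have "\<Gamma> \<subseteq> \<Gamma>'"
    proof
      fix x assume "x \<in> \<Gamma>"
      then obtain c z where x: "x = (c, z)" "(c, z) \<in> \<Gamma>" by (cases x) auto
      then have "specializes \<Gamma> [:c:] [:z:]" using specializes_monom[OF pg, of c z 0] by (simp add: monom_0)
      then show "x \<in> \<Gamma>'" using x unfolding \<Gamma>'_def by force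
    qed
    ultimately have "\<Gamma>' = \<Gamma>" by (rule maxi)
    moreover have "specializes \<Gamma> (Polynomial.monom 1 1) (Polynomial.monom 1 1)"
      using specializes_monom[OF pg place_graph_one[OF pg]] .
    then have "(a, \<gamma>) \<in> \<Gamma>'" unfolding \<Gamma>'_def by (force simp: poly_monom)
    ultimately show False using a by blast
  qed
  obtain k0 where k0: "k0 \<in> J" "k0 \<noteq> 0" using no_root[of 0] by force
  define \<delta> where "\<delta> = arg_min Polynomial.degree (\<lambda>k. k \<in> J \<and> k \<noteq> 0)"
  have \<delta>: "\<delta> \<in> J" "\<delta> \<noteq> 0" "\<And>k. k \<in> J \<Longrightarrow> k \<noteq> 0 \<Longrightarrow> Polynomial.degree \<delta> \<le> Polynomial.degree k"
    using arg_min_nat_lemma[of "\<lambda>k. k \<in> J \<and> k \<noteq> 0" k0 Polynomial.degree] k0 unfolding \<delta>_def by auto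
  have dvd: "\<delta> dvd k" if "k \<in> J" for k
  proof (rule ccontr)
    assume nd: "\<not> \<delta> dvd k"
    have "k mod \<delta> = k - \<delta> * (k div \<delta>)" by (simp add: minus_mult_div_eq_mod)
    then have "k mod \<delta> \<in> J" using that \<delta> Jdiff Jmult by presburger
    moreover have "k mod \<delta> \<noteq> 0" using nd by (simp add: dvd_eq_mod_eq_0)
    ultimately show False using \<delta>(3) degree_mod_less[OF \<delta>(2), of k] by fastforce
  qed
  have "Polynomial.degree \<delta> = 0"
  proof (rule ccontr)
    assume "Polynomial.degree \<delta> \<noteq> 0"
    then obtain \<gamma> where "poly \<delta> \<gamma> = 0"
      using fundamental_theorem_of_algebra[of \<delta>] by (auto simp: constant_degree)
    then show False using no_root[of \<gamma>] dvd by (meson dvd_trans poly_eq_0_iff_dvd)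
  qed
  then obtain c where "\<delta> = [:c:]" "c \<noteq> 0" using \<delta>(2) by (auto elim: degree_eq_zeroE)
  then have "1 \<in> J" using Jmult[OF \<delta>(1), of "[:1/c:]"] by (simp add: one_pCons)
  then show ?thesis unfolding J_def by blast
qed

lemma maximal_place_inverse:
  assumes max: "maximal_place \<Gamma>" and t: "(t, z) \<in> \<Gamma>" and z: "z \<noteq> 0"
  shows "(inverse t, inverse z) \<in> \<Gamma>"
proof -
  have pg: "place_graph \<Gamma>" using max by (simp add: maximal_place_def)
  have t0: "t \<noteq> 0" using place_graph_zero_value[OF pg] t z by blast
  have "inverse t \<in> Domain \<Gamma>"
  proof (rule ccontr)
    assume "inverse t \<notin> Domain \<Gamma>"
    then obtain h where h: "specializes \<Gamma> h 1" "poly h (inverse t) = 0"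
      using maximal_place_relation[OF max] by blast
    obtain k' where k': "specializes \<Gamma> (reflect_poly h) k'"
      "\<And>i. Polynomial.coeff k' i = (if i > Polynomial.degree h then 0 else Polynomial.coeff 1 (Polynomial.degree h - i))"
      using specializes_reflect[OF pg h(1)] by blast
    have "k' = Polynomial.monom 1 (Polynomial.degree h)"
      by (rule poly_eqI) (auto simp: k'(2))
    then have "(poly (reflect_poly h) t, z ^ Polynomial.degree h) \<in> \<Gamma>"
      using place_graph_poly[OF pg k'(1) t] by (simp add: poly_monom)
    moreover have "poly (reflect_poly h) t = 0"
      using poly_reflect_poly_nz[OF t0, of h] h(2) by simp
    ultimately show False using place_graph_zero_value[OF pg, of "z ^ Polynomial.degree h"] z by auto
  qed
  then obtain w where w: "(inverse t, w) \<in> \<Gamma>" by auto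
  have "(1, z * w) \<in> \<Gamma>" using place_graph_mult[OF pg t w] t0 by simp
  then have "z * w = 1" using place_graph_value_unique[OF pg _ place_graph_one[OF pg]] by blast
  then show ?thesis using w z by (metis inverse_unique)
qed

text \<open>
  Chevalley's argument. If neither \<open>a\<close> nor its inverse were in the domain, both would be roots of
  polynomials that specialize to 1. The polynomial of smaller degree, read backwards, is monic up to a unit for the
  other element and lowers the degree of the other polynomial.
\<close>

lemma maximal_place_valuation:
  assumes max: "maximal_place \<Gamma>" and a0: "a \<noteq> 0"
  shows "a \<in> Domain \<Gamma> \<or> inverse a \<in> Domain \<Gamma>"
proof (rule ccontr)
  assume neg: "\<not> ?thesis"
  have pg: "place_graph \<Gamma>" using max by (simp add: maximal_place_def)
  define R where "R b h \<longleftrightarrow> specializes \<Gamma> h 1 \<and> poly h b = 0" for b h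
  have step: "\<exists>h''. R b h'' \<and> Polynomial.degree h'' < Polynomial.degree h"
    if b0: "b \<noteq> 0" and h: "R b h" and h': "R (inverse b) h'"
      and le: "Polynomial.degree h' \<le> Polynomial.degree h" for b h h'
  proof -
    let ?M = "Polynomial.degree h" and ?N = "Polynomial.degree h'"
    have M: "?M \<noteq> 0"
    proof
      assume "?M = 0"
      then obtain c where "h = [:c:]" by (auto elim: degree_eq_zeroE)
      then have "h = 0" using h by (simp add: R_def)
      then have "(0, 1) \<in> \<Gamma>" using h specializes_oneD[of \<Gamma> h 0] unfolding R_def by simp
      then show False using place_graph_zero_value[OF pg] by force
    qed
    obtain k' where k': "specializes \<Gamma> (reflect_poly h') k'"
      "\<And>i. Polynomial.coeff k' i = (if i > ?N then 0 else Polynomial.coeff 1 (?N - i))"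
      using specializes_reflect[OF pg, of h' 1] h' unfolding R_def by blast
    have k'_eq: "k' = Polynomial.monom 1 ?N"
      by (rule poly_eqI) (auto simp: k'(2))
    let ?v = "Polynomial.coeff h' 0"
    have v: "(?v, 1) \<in> \<Gamma>" using h' specializes_oneD[of \<Gamma> h' 0] unfolding R_def by simp
    then have v0: "?v \<noteq> 0" using place_graph_zero_value[OF pg] by fastforce
    have iv: "(inverse ?v, 1) \<in> \<Gamma>" using maximal_place_inverse[OF max v] by simp
    have lc: "(Polynomial.coeff h ?M, 0) \<in> \<Gamma>"
      using h M specializes_oneD[of \<Gamma> h ?M] unfolding R_def by simp
    have "(Polynomial.coeff h ?M * inverse ?v, 0) \<in> \<Gamma>" using place_graph_mult[OF pg lc iv] by simp
    then have "specializes \<Gamma> (Polynomial.monom (Polynomial.coeff h ?M * inverse ?v) (?M - ?N)) 0"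
      using specializes_monom[OF pg] by (metis monom_eq_0)
    from specializes_mult[OF pg this k'(1)]
    have sp: "specializes \<Gamma> (Polynomial.monom (Polynomial.coeff h ?M * inverse ?v) (?M - ?N) * reflect_poly h') 0"
      by simp
    define h'' where "h'' = h - Polynomial.monom (Polynomial.coeff h ?M * inverse ?v) (?M - ?N) * reflect_poly h'"
    have "specializes \<Gamma> h'' 1"
      using specializes_diff[OF pg _ sp, of h 1] h unfolding h''_def R_def by simp
    moreover have "poly (reflect_poly h') b = 0"
      using poly_reflect_poly_nz[OF b0, of h'] h' unfolding R_def by simp
    then have "poly h'' b = 0" using h by (simp add: h''_def R_def)
    moreover have "Polynomial.degree h'' < ?M"
    proof -
      have rd: "Polynomial.degree (reflect_poly h') = ?N" using v0 by (simp)
      have "Polynomial.degree h'' \<le> ?M" unfolding h''_def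
        using le rd degree_monom_le[of "Polynomial.coeff h ?M * inverse ?v" "?M - ?N"]
        by (intro degree_diff_le order.refl le_trans[OF degree_mult_le]) linarith
      moreover have "Polynomial.coeff h'' ?M = 0"
        unfolding h''_def using le v0 by (simp add: coeff_monom_mult coeff_reflect_poly)
      ultimately show ?thesis using M
        by (metis degree_0 le_neq_implies_less leading_coeff_0_iff neq0_conv)
    qed
    ultimately show ?thesis unfolding R_def by blast
  qed
  define h where "h = arg_min Polynomial.degree (R a)"
  define h' where "h' = arg_min Polynomial.degree (R (inverse a))"
  obtain h1 h2 where "R a h1" "R (inverse a) h2"
    using neg maximal_place_relation[OF max] unfolding R_def by blast
  then have h: "R a h" "\<And>k. R a k \<Longrightarrow> Polynomial.degree h \<le> Polynomial.degree k"
    and h': "R (inverse a) h'" "\<And>k. R (inverse a) k \<Longrightarrow> Polynomial.degree h' \<le> Polynomial.degree k"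
    unfolding h_def h'_def using arg_min_nat_lemma by metis+
  show False
  proof (cases "Polynomial.degree h' \<le> Polynomial.degree h")
    case True
    then show False using step[OF a0 h(1) h'(1)] h(2) by fastforce
  next
    case False
    then show False using step[OF _ h'(1), of h] a0 h(1) h'(2) by fastforce
  qed
qed

text \<open>
  If \<open>a\<close> were not in the domain, then its inverse would be, with value 0. Dividing the monic equation by
  the highest power of \<open>a\<close> and specializing would yield \<open>1 = 0\<close>.
\<close>

lemma maximal_place_integrally_closed:
  assumes max: "maximal_place \<Gamma>"
    and h: "\<And>i. Polynomial.coeff h i \<in> Domain \<Gamma>" "Polynomial.lead_coeff h = 1" "poly h a = 0"
  shows "a \<in> Domain \<Gamma>"
proof (rule ccontr)
  assume a: "a \<notin> Domain \<Gamma>"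
  have pg: "place_graph \<Gamma>" using max by (simp add: maximal_place_def)
  have a0: "a \<noteq> 0" using a place_graph_zero[OF pg] by blast
  obtain w where w: "(inverse a, w) \<in> \<Gamma>" using maximal_place_valuation[OF max a0] a by blast
  have w0: "w = 0" using maximal_place_inverse[OF max w] a by (metis Domain.DomainI inverse_inverse_eq)
  obtain k where k: "specializes \<Gamma> h k" using specializes_project[OF pg h(1)] by blast
  obtain k' where k': "specializes \<Gamma> (reflect_poly h) k'"
      "Polynomial.coeff k' 0 = Polynomial.coeff k (Polynomial.degree h)"
    using specializes_reflect[OF pg k] by fastforce
  have "(1, Polynomial.coeff k (Polynomial.degree h)) \<in> \<Gamma>" using k h(2) unfolding specializes_def by metis
  then have "Polynomial.coeff k' 0 = 1"
    using k'(2) place_graph_value_unique[OF pg _ place_graph_one[OF pg]] by metis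
  then have "poly k' w = 1" using w0 by (simp add: poly_0_coeff_0)
  moreover have "poly (reflect_poly h) (inverse a) = 0"
    using poly_reflect_poly_nz[of "inverse a" h] a0 h(3) by simp
  ultimately have "(0, 1) \<in> \<Gamma>" using place_graph_poly[OF pg k'(1) w] by simp
  then show False using place_graph_zero_value[OF pg] by fastforce
qed

section \<open>Plane affine curves meeting only in the origin\<close>

definition pair_ideal :: "'a::comm_ring_1 \<Rightarrow> 'a \<Rightarrow> 'a set" where
  "pair_ideal f g = {a * f + b * g | a b. True}"

lemma pair_ideal_0: "0 \<in> pair_ideal f g"
  and pair_ideal_add: "x \<in> pair_ideal f g \<Longrightarrow> y \<in> pair_ideal f g \<Longrightarrow> x + y \<in> pair_ideal f g"
  and pair_ideal_mult: "x \<in> pair_ideal f g \<Longrightarrow> c * x \<in> pair_ideal f g"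
  and pair_ideal_left: "f \<in> pair_ideal f g"
  and pair_ideal_right: "g \<in> pair_ideal f g"
proof -
  show "0 \<in> pair_ideal f g" unfolding pair_ideal_def by (rule CollectI, intro exI[of _ 0]) simp
  show "f \<in> pair_ideal f g" unfolding pair_ideal_def by (rule CollectI, rule exI[of _ 1], rule exI[of _ 0]) simp
  show "g \<in> pair_ideal f g" unfolding pair_ideal_def by (rule CollectI, rule exI[of _ 0], rule exI[of _ 1]) simp
  { assume "x \<in> pair_ideal f g" "y \<in> pair_ideal f g"
    then obtain a b a' b' where "x = a * f + b * g" "y = a' * f + b' * g" unfolding pair_ideal_def by blast
    then have "x + y = (a + a') * f + (b + b') * g" by (simp add: algebra_simps)
    then show "x + y \<in> pair_ideal f g" unfolding pair_ideal_def by blast }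
  { assume "x \<in> pair_ideal f g"
    then obtain a b where "x = a * f + b * g" unfolding pair_ideal_def by blast
    then have "c * x = (c * a) * f + (c * b) * g" by (simp add: algebra_simps)
    then show "c * x \<in> pair_ideal f g" unfolding pair_ideal_def by blast }
qed

lemma pair_ideal_diff: "x \<in> pair_ideal f g \<Longrightarrow> y \<in> pair_ideal f g \<Longrightarrow> x - y \<in> pair_ideal f g"
  using pair_ideal_add[of x f g "- 1 * y"] pair_ideal_mult[of y f g "- 1"] by simp

lemma pair_ideal_multR: "x \<in> pair_ideal f g \<Longrightarrow> x * c \<in> pair_ideal f g"
  using pair_ideal_mult[of x f g c] by (simp add: mult.commute)

lemma pair_ideal_cancel_power:
  assumes "y - x * k \<in> pair_ideal f g" "x ^ M \<in> pair_ideal f g"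
  shows "y ^ M \<in> pair_ideal f g"
proof -
  have "y - x * k dvd y ^ M - (x * k) ^ M"
    by (metis dvd_triv_left power_diff_sumr2)
  then obtain c where c: "y ^ M - (x * k) ^ M = (y - x * k) * c" by (auto simp: dvd_def)
  have "(x * k) ^ M \<in> pair_ideal f g"
    using pair_ideal_multR[OF assms(2)] by (simp add: power_mult_distrib)
  moreover have "(y - x * k) * c \<in> pair_ideal f g" by (rule pair_ideal_multR[OF assms(1)])
  ultimately show ?thesis using pair_ideal_add c by (metis diff_add_cancel)
qed

text \<open>
  Restriction to the vertical line \<open>x = a\<close>.
\<close>

definition at_line :: "complex \<Rightarrow> bipoly \<Rightarrow> complex poly" where
  "at_line a = map_poly (\<lambda>p. poly p a)"

lemma coeff_at_line: "Polynomial.coeff (at_line a P) j = poly (Polynomial.coeff P j) a"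
  by (simp add: at_line_def coeff_map_poly)

lemma at_line_add: "at_line a (P + Q) = at_line a P + at_line a Q"
  and at_line_diff: "at_line a (P - Q) = at_line a P - at_line a Q"
  and at_line_mult: "at_line a (P * Q) = at_line a P * at_line a Q"
  by (intro poly_eqI; simp add: coeff_at_line coeff_mult poly_sum)+

lemma poly_at_line: "poly (at_line a P) b = poly (poly P [:b:]) a"
  by (induction P) (simp_all add: at_line_def map_poly_pCons)

lemma at_line_one: "at_line a 1 = 1"
  by (intro poly_eqI) (simp add: coeff_at_line of_bool_def)

lemma at_line_lift: "at_line a (map_poly (\<lambda>c. [:c:]) p) = p"
  by (intro poly_eqI) (simp add: coeff_at_line coeff_map_poly)

lemma at_line_zero_dvd:
  assumes "at_line a P = 0"
  shows "[:[:- a, 1:]:] dvd P"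
proof -
  have "[:- a, 1:] dvd Polynomial.coeff P j" for j
    using assms coeff_at_line[of a P j] by (simp add: poly_eq_0_iff_dvd)
  then show ?thesis by (simp add: const_poly_dvd_iff)
qed

lemma only_zero_root_dvd_monom:
  fixes p :: "complex poly"
  assumes "p \<noteq> 0" "\<And>b. poly p b = 0 \<Longrightarrow> b = 0"
  shows "p dvd Polynomial.monom 1 (Polynomial.degree p)"
  using assms
proof (induction "Polynomial.degree p" arbitrary: p)
  case 0
  then obtain c where "p = [:c:]" "c \<noteq> 0" by (auto elim: degree_eq_zeroE)
  then have "is_unit p" by (simp add: is_unit_iff_degree)
  then show ?case by (rule unit_imp_dvd)
next
  case (Suc n)
  then obtain b where "poly p b = 0"
    using fundamental_theorem_of_algebra[of p] by (auto simp: constant_degree)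
  then have "poly p 0 = 0" using Suc.prems by auto
  then obtain q where q: "p = [:0, 1:] * q" by (auto simp: poly_eq_0_iff_dvd)
  have q0: "q \<noteq> 0" using q Suc.prems by auto
  then have qn: "n = Polynomial.degree q" using Suc.hyps(2) q by (simp add: degree_pCons_eq)
  have "q dvd Polynomial.monom 1 n"
    unfolding qn
  proof (intro Suc.hyps(1))
    fix b assume "poly q b = 0"
    then show "b = 0" using Suc.prems(2)[of b] q by simp
  qed (simp_all add: q0 qn)
  then have "p dvd [:0, 1:] * Polynomial.monom 1 n" unfolding q by (rule mult_dvd_mono[OF dvd_refl])
  then show ?case unfolding Suc.hyps(2)[symmetric] by (simp add: monom_Suc)
qed

lemma no_common_root_bezout:
  fixes p q :: "complex poly"
  assumes "\<And>b. poly p b = 0 \<Longrightarrow> poly q b = 0 \<Longrightarrow> False"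
  shows "coprime p q"
proof (rule ccontr)
  assume "\<not> coprime p q"
  then have nu: "\<not> is_unit (gcd p q)" by (simp add: coprime_iff_gcd_eq_1 is_unit_gcd)
  have "Polynomial.degree (gcd p q) \<noteq> 0 \<or> gcd p q = 0"
    using nu is_unit_iff_degree by blast
  then obtain b where "poly (gcd p q) b = 0"
    using fundamental_theorem_of_algebra[of "gcd p q"] by (auto simp: constant_degree)
  then show False using assms by (meson dvd_trans gcd_dvd1 gcd_dvd2 poly_eq_0_iff_dvd)
qed

text \<open>
  The leading coefficient of \<open>f\<close> in \<open>y\<close> is a nonzero constant, so no zero of \<open>f\<close> escapes to
  infinity along a vertical line.
\<close>

locale one_point_curves =
  fixes f g :: bipoly and d :: nat
  assumes lead_f: "Polynomial.degree f = d" "\<exists>c. Polynomial.lead_coeff f = [:c:]" "f \<noteq> 0"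
    and common: "\<And>a b. poly (poly f [:b:]) a = 0 \<Longrightarrow> poly (poly g [:b:]) a = 0 \<Longrightarrow> a = 0 \<and> b = 0"
begin

text \<open>
  An element of least degree in \<open>y\<close> divides \<open>f\<close> and \<open>g\<close> up to factors depending on \<open>x\<close> alone. If it
  involved \<open>y\<close>, its zeros on almost all vertical lines would be common zeros of \<open>f\<close> and \<open>g\<close>.
\<close>

lemma elimination: "\<exists>r. r \<noteq> 0 \<and> [:r:] \<in> pair_ideal f g"
proof -
  define h where "h = arg_min Polynomial.degree (\<lambda>h. h \<in> pair_ideal f g \<and> h \<noteq> 0)"
  have h: "h \<in> pair_ideal f g" "h \<noteq> 0"
    and h_min: "\<And>k. k \<in> pair_ideal f g \<Longrightarrow> k \<noteq> 0 \<Longrightarrow> Polynomial.degree h \<le> Polynomial.degree k"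
    using arg_min_nat_lemma[of "\<lambda>h. h \<in> pair_ideal f g \<and> h \<noteq> 0" f Polynomial.degree]
      pair_ideal_left lead_f(3) unfolding h_def by auto
  have quot: "\<exists>a q. a \<noteq> 0 \<and> Polynomial.smult a k = h * q" if k: "k \<in> pair_ideal f g" for k
  proof -
    obtain a q where aq: "a \<noteq> 0" "Polynomial.smult a k = h * q + pseudo_mod k h"
      using pseudo_mod(1)[OF h(2), of k] by blast
    have "pseudo_mod k h = [:a:] * k - h * q" using aq by simp
    then have "pseudo_mod k h \<in> pair_ideal f g"
      using pair_ideal_diff[OF pair_ideal_mult[OF k] pair_ideal_multR[OF h(1)]] by metis
    then have "pseudo_mod k h = 0" using h_min pseudo_mod(2)[OF h(2), of k] by fastforce
    then show ?thesis using aq by auto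
  qed
  obtain a p where a: "a \<noteq> 0" "Polynomial.smult a f = h * p" using quot pair_ideal_left by blast
  obtain a' p' where a': "a' \<noteq> 0" "Polynomial.smult a' g = h * p'" using quot pair_ideal_right by blast
  have "Polynomial.degree h = 0"
  proof (rule ccontr)
    assume deg: "Polynomial.degree h \<noteq> 0"
    let ?s = "a * a' * Polynomial.lead_coeff h * [:0, 1:]"
    have "?s \<noteq> 0" using a a' h by simp
    then have "finite {x. poly ?s x = 0}" by (rule poly_roots_finite)
    then obtain x where "x \<notin> {x. poly ?s x = 0}"
      using ex_new_if_finite[OF infinite_UNIV_char_0[where 'a = complex]] by blast
    then have x: "poly a x \<noteq> 0" "poly a' x \<noteq> 0" "poly (Polynomial.lead_coeff h) x \<noteq> 0" "x \<noteq> 0" by auto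
    have "Polynomial.degree (at_line x h) \<noteq> 0"
      using x(3) deg le_degree[of "at_line x h" "Polynomial.degree h"] by (simp add: coeff_at_line)
    then obtain y where y: "poly (at_line x h) y = 0"
      using fundamental_theorem_of_algebra[of "at_line x h"] by (auto simp: constant_degree)
    have "poly (poly (Polynomial.smult a f) [:y:]) x = 0" "poly (poly (Polynomial.smult a' g) [:y:]) x = 0"
      unfolding a(2) a'(2) using y by (simp_all add: poly_at_line)
    then have "poly (poly f [:y:]) x = 0" "poly (poly g [:y:]) x = 0" using x by auto
    then show False using common x(4) by blast
  qed
  then obtain r where "h = [:r:]" by (auto elim: degree_eq_zeroE)
  then show ?thesis using h by auto
qed

text \<open>
  On a line \<open>x = a\<close> with \<open>a \<noteq> 0\<close> the restrictions of \<open>f\<close> and \<open>g\<close> are coprime, so \<open>x - a\<close> is a unit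
  modulo the ideal and can be cancelled. What remains of \<open>r\<close> is a power of \<open>x\<close>.
\<close>

lemma power_of_x_multiple:
  assumes "r \<noteq> 0" "[:r:] * w \<in> pair_ideal f g"
  shows "\<exists>M. bimonom 1 M 0 * w \<in> pair_ideal f g"
  using assms
proof (induction "Polynomial.degree r" arbitrary: r w)
  case 0
  then obtain c where c: "r = [:c:]" "c \<noteq> 0" by (auto elim: degree_eq_zeroE)
  have "[:[:1/c:]:] * ([:r:] * w) \<in> pair_ideal f g" using 0 pair_ideal_mult by blast
  then have "bimonom 1 0 0 * w \<in> pair_ideal f g" using c by (simp add: monom_0 one_pCons)
  then show ?case by blast
next
  case (Suc n)
  then obtain a where "poly r a = 0"
    using fundamental_theorem_of_algebra[of r] by (auto simp: constant_degree)
  then obtain s where s: "r = [:- a, 1:] * s" by (auto simp: poly_eq_0_iff_dvd)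
  have s0: "s \<noteq> 0" using s Suc.prems by auto
  have "Polynomial.degree r = 1 + Polynomial.degree s"
    unfolding s using s0 by (subst degree_mult_eq) auto
  then have ds: "n = Polynomial.degree s" using Suc.hyps(2) by simp
  have mem: "[:[:- a, 1:]:] * ([:s:] * w) \<in> pair_ideal f g"
    using Suc.prems(2) unfolding s by (simp add: mult_ac)
  show ?case
  proof (cases "a = 0")
    case True
    have "[:s:] * ([:[:0, 1:]:] * w) \<in> pair_ideal f g" using mem True by (simp add: mult_ac)
    then obtain M where "bimonom 1 M 0 * ([:[:0, 1:]:] * w) \<in> pair_ideal f g"
      using Suc.hyps(1)[OF ds s0] by blast
    moreover have "bimonom 1 M 0 * [:[:0, 1:]:] = bimonom 1 (Suc M) 0"
      by (simp add: monom_0 monom_Suc)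
    ultimately show ?thesis by (metis mult.assoc)
  next
    case False
    have "coprime (at_line a f) (at_line a g)"
    proof (rule no_common_root_bezout)
      fix b assume "poly (at_line a f) b = 0" "poly (at_line a g) b = 0"
      then have "poly (poly f [:b:]) a = 0" "poly (poly g [:b:]) a = 0" by (simp_all only: poly_at_line)
      then show False using common False by blast
    qed
    then obtain u v where uv: "u * at_line a f + v * at_line a g = 1"
      by (metis bezout_coefficients_fst_snd coprime_imp_gcd_eq_1)
    define U where "U = map_poly (\<lambda>c. [:c:]) u"
    define V where "V = map_poly (\<lambda>c. [:c:]) v"
    have "at_line a (U * f + V * g - 1) = 0"
      by (simp add: at_line_add at_line_diff at_line_mult at_line_one U_def V_def at_line_lift uv)
    then obtain k where k: "U * f + V * g - 1 = [:[:- a, 1:]:] * k"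
      using at_line_zero_dvd by (metis dvdE)
    have "[:s:] * w = [:s:] * w * (U * f + V * g) - ([:[:- a, 1:]:] * ([:s:] * w)) * k"
      using k by (simp add: algebra_simps)
    moreover have "U * f + V * g \<in> pair_ideal f g" unfolding pair_ideal_def by blast
    ultimately have "[:s:] * w \<in> pair_ideal f g"
      using pair_ideal_diff pair_ideal_mult pair_ideal_multR mem by metis
    then show ?thesis using Suc.hyps(1)[OF ds s0] by blast
  qed
qed

lemma x_power: "\<exists>M. bimonom 1 M 0 \<in> pair_ideal f g"
proof -
  obtain r where "r \<noteq> 0" "[:r:] \<in> pair_ideal f g" using elimination by blast
  then show ?thesis using power_of_x_multiple[of r 1] by simp
qed

text \<open>
  On the line \<open>x = 0\<close> the only common zero is \<open>y = 0\<close>, so some power of \<open>y\<close> lies in the ideal up to a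
  multiple of \<open>x\<close>, and a power of \<open>x\<close> lies in the ideal.
\<close>

lemma y_power: "\<exists>M. bimonom 1 0 M \<in> pair_ideal f g"
proof -
  obtain M where M: "bimonom 1 M 0 \<in> pair_ideal f g" using x_power by blast
  define p where "p = gcd (at_line 0 f) (at_line 0 g)"
  have "at_line 0 f \<noteq> 0"
  proof
    assume "at_line 0 f = 0"
    then have "poly (poly f [:1:]) 0 = 0" "poly (Polynomial.lead_coeff f) 0 = 0"
      using poly_at_line[of 0 f 1] coeff_at_line[of 0 f d] lead_f(1) by auto
    then show False using lead_f(2,3) by auto
  qed
  then have "p \<noteq> 0" unfolding p_def by simp
  moreover have "b = 0" if "poly p b = 0" for b
  proof -
    have "poly (at_line 0 f) b = 0" "poly (at_line 0 g) b = 0"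
      using that unfolding p_def by (meson dvd_trans gcd_dvd1 gcd_dvd2 poly_eq_0_iff_dvd)+
    then have "poly (poly f [:b:]) 0 = 0" "poly (poly g [:b:]) 0 = 0" by (simp_all only: poly_at_line)
    then show ?thesis using common by blast
  qed
  ultimately have "p dvd Polynomial.monom 1 (Polynomial.degree p)" by (rule only_zero_root_dvd_monom)
  then obtain k where k: "Polynomial.monom 1 (Polynomial.degree p) = p * k" by (auto simp: dvd_def)
  obtain u v where uv: "u * at_line 0 f + v * at_line 0 g = p"
    unfolding p_def using bezout_coefficients_fst_snd by blast
  define U where "U = map_poly (\<lambda>c. [:c:]) (u * k)"
  define V where "V = map_poly (\<lambda>c. [:c:]) (v * k)"
  let ?y = "bimonom 1 0 (Polynomial.degree p)"
  have "at_line 0 ?y = p * k"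
    unfolding k[symmetric] by (intro poly_eqI) (simp add: coeff_at_line poly_monom)
  then have "at_line 0 (?y - (U * f + V * g)) = 0"
    by (simp add: at_line_add at_line_diff at_line_mult U_def V_def at_line_lift uv[symmetric] algebra_simps)
  then obtain q where q: "?y - (U * f + V * g) = [:[:0, 1:]:] * q"
    using at_line_zero_dvd[of 0] by (metis dvdE minus_zero)
  have "?y - [:[:0, 1:]:] * q = U * f + V * g" using q by (simp add: algebra_simps)
  then have "?y - [:[:0, 1:]:] * q \<in> pair_ideal f g" unfolding pair_ideal_def by blast
  moreover have "[:[:0, 1:]:] ^ M = bimonom 1 M 0"
    by (induction M) (simp_all add: monom_0 monom_Suc one_pCons)
  ultimately have "?y ^ M \<in> pair_ideal f g"
    using pair_ideal_cancel_power[of ?y "[:[:0, 1:]:]" q f g M] M by simp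
  then show ?thesis by (auto simp: monom_power)
qed

text \<open>
  Monomials of large weight lie in the ideal, by \<open>x_power\<close> and \<open>y_power\<close>. A monomial divisible by
  \<open>x^n\<close> is replaced by monomials of larger weight using \<open>g\<close>; one divisible by \<open>y^m\<close> is replaced using
  \<open>f\<close> by monomials of larger weight, or of equal weight and smaller degree in \<open>y\<close>.
\<close>

lemma weighted_span:
  assumes pq: "p > 0" "q > 0"
    and f0: "bicoeff f 0 m \<noteq> 0" "\<And>i j. bicoeff f i j \<noteq> 0 \<Longrightarrow> q * m \<le> p * i + q * j"
    and g0: "bicoeff g n 0 \<noteq> 0"
      "\<And>i j. bicoeff g i j \<noteq> 0 \<Longrightarrow> (i, j) \<noteq> (n, 0) \<Longrightarrow> p * n < p * i + q * j"
  shows "\<exists>w \<in> bipoly.span {bimonom 1 i j | i j. i < n \<and> j < m}. P - w \<in> pair_ideal f g"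
proof -
  let ?S = "bipoly.span {bimonom 1 i j | i j. i < n \<and> j < m}"
  define W where "W = {P. \<exists>w \<in> ?S. P - w \<in> pair_ideal f g}"
  have ideal_W: "P \<in> W" if "P \<in> pair_ideal f g" for P
    using that bipoly.span_zero unfolding W_def by force
  have sub: "bipoly.subspace W"
    unfolding bipoly.subspace_def
  proof (intro conjI allI impI ballI)
    show "0 \<in> W" using ideal_W pair_ideal_0 by blast
    fix P Q assume "P \<in> W" "Q \<in> W"
    then obtain w w' where w: "w \<in> ?S" "w' \<in> ?S" "P - w \<in> pair_ideal f g" "Q - w' \<in> pair_ideal f g"
      unfolding W_def by blast
    have "P + Q - (w + w') \<in> pair_ideal f g"
      using pair_ideal_add[OF w(3,4)] by (simp add: algebra_simps)
    then show "P + Q \<in> W" unfolding W_def using bipoly.span_add[OF w(1,2)] by blast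
  next
    fix c P assume "P \<in> W"
    then obtain w where w: "w \<in> ?S" "P - w \<in> pair_ideal f g" unfolding W_def by blast
    have "Polynomial.smult [:c:] P - Polynomial.smult [:c:] w \<in> pair_ideal f g"
      using pair_ideal_mult[OF w(2), of "[:[:c:]:]"] by (simp add: smult_diff_right)
    then show "Polynomial.smult [:c:] P \<in> W" unfolding W_def using bipoly.span_scale[OF w(1)] by blast
  qed
  have replace: "bimonom 1 i j \<in> W"
    if le: "a \<le> i" "b \<le> j" and h: "h \<in> pair_ideal f g" "bicoeff h a b \<noteq> 0"
      and other: "\<And>a' b'. bicoeff h a' b' \<noteq> 0 \<Longrightarrow> (a', b') \<noteq> (a, b) \<Longrightarrow> bimonom 1 (i - a + a') (j - b + b') \<in> W"
    for i j a b h
  proof -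
    let ?c = "bicoeff h a b"
    let ?D = "bimonom 1 (i - a) (j - b) * h - bimonom ?c i j"
    have "?D \<in> W"
    proof (rule bipoly_in_subspace[OF sub])
      fix s t assume nz: "bicoeff ?D s t \<noteq> 0"
      have Deq: "bicoeff ?D s t = (if i - a \<le> s \<and> j - b \<le> t then bicoeff h (s - (i - a)) (t - (j - b)) else 0)
          - (if s = i \<and> t = j then ?c else 0)"
        by (simp only: coeff_diff bicoeff_bimonom bicoeff_bimonom_mult mult_1)
      have st: "i - a \<le> s \<and> j - b \<le> t"
      proof (rule ccontr)
        assume neg: "\<not> ?thesis"
        then have "\<not> (s = i \<and> t = j)" by auto
        then show False using nz neg unfolding Deq by (simp split: if_splits)
      qed
      have ne: "\<not> (s = i \<and> t = j)"
      proof
        assume e: "s = i \<and> t = j"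
        then have "s - (i - a) = a" "t - (j - b) = b" using le by auto
        then show False using nz st e unfolding Deq by simp
      qed
      have "bicoeff h (s - (i - a)) (t - (j - b)) \<noteq> 0" using nz st ne unfolding Deq by simp
      moreover have "(s - (i - a), t - (j - b)) \<noteq> (a, b)" using ne st le by auto
      ultimately have "bimonom 1 (i - a + (s - (i - a))) (j - b + (t - (j - b))) \<in> W" by (rule other)
      then show "bimonom 1 s t \<in> W" using st by simp
    qed
    moreover have "bimonom 1 (i - a) (j - b) * h \<in> W" by (intro ideal_W pair_ideal_mult h)
    ultimately have "bimonom 1 (i - a) (j - b) * h - ?D \<in> W" using bipoly.subspace_diff[OF sub] by blast
    then have "bimonom ?c i j \<in> W" by simp
    from bipoly.subspace_scale[OF sub this, of "1 / ?c"] show ?thesis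
      using h(2) by (simp add: smult_monom)
  qed
  obtain M1 M2 where M1: "bimonom 1 M1 0 \<in> pair_ideal f g" and M2: "bimonom 1 0 M2 \<in> pair_ideal f g"
    using x_power y_power by blast
  define K where "K = p * M1 + q * M2"
  have mono: "bimonom 1 i j \<in> W" for i j
  proof (induction "(K - (p * i + q * j), j)" arbitrary: i j rule: wf_induct_rule[OF wf_lex_prod[OF wf_less_than wf_less_than]])
    case less: (1 i j)
    have IH1: "bimonom 1 a b \<in> W" if "p * i + q * j < p * a + q * b" "p * i + q * j < K" for a b
      using that by (intro less) auto
    have IH2: "bimonom 1 a b \<in> W" if "p * i + q * j = p * a + q * b" "b < j" for a b
      using that by (intro less) auto
    consider "M1 \<le> i" | "M2 \<le> j" | "i < M1" "j < M2" by linarith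
    then show ?case
    proof cases
      case 1
      have "bimonom 1 (i - M1) j * bimonom 1 M1 0 \<in> pair_ideal f g" using M1 by (rule pair_ideal_mult)
      then show ?thesis using 1 by (intro ideal_W) (simp add: mult_monom)
    next
      case 2
      have "bimonom 1 i (j - M2) * bimonom 1 0 M2 \<in> pair_ideal f g" using M2 by (rule pair_ideal_mult)
      then show ?thesis using 2 by (intro ideal_W) (simp add: mult_monom)
    next
      case 3
      have lessK: "p * i + q * j < K"
        unfolding K_def using 3 pq by (intro add_strict_mono) auto
      consider "n \<le> i" | "m \<le> j" | "i < n" "j < m" by linarith
      then show ?thesis
      proof cases
        case 1
        show ?thesis
        proof (rule replace[OF 1 _ pair_ideal_right g0(1)])
          fix a b assume "bicoeff g a b \<noteq> 0" "(a, b) \<noteq> (n, 0)"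
          then have lt: "p * n < p * a + q * b" using g0(2) by blast
          have "p * i = p * (i - n) + p * n" using 1 by (metis add_mult_distrib2 le_add_diff_inverse2)
          then show "bimonom 1 (i - n + a) (j - 0 + b) \<in> W"
            using lt by (intro IH1[OF _ lessK]) (simp add: algebra_simps)
        qed simp
      next
        case 2
        show ?thesis
        proof (rule replace[OF _ 2 pair_ideal_left f0(1)])
          fix a b assume ab: "bicoeff f a b \<noteq> 0" "(a, b) \<noteq> (0, m)"
          then have le: "q * m \<le> p * a + q * b" using f0(2) by blast
          have jm: "q * j = q * (j - m) + q * m" using 2 by (metis add_mult_distrib2 le_add_diff_inverse2)
          show "bimonom 1 (i - 0 + a) (j - m + b) \<in> W"
          proof (cases "q * m = p * a + q * b")
            case True
            have "a \<noteq> 0" using True ab pq by (cases "a = 0") auto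
            then have "q * b < q * m" using True pq by simp
            then have "b < m" by simp
            then show ?thesis using True jm 2 by (intro IH2) (auto simp: algebra_simps)
          next
            case False
            then show ?thesis using le jm by (intro IH1[OF _ lessK]) (simp add: algebra_simps)
          qed
        qed simp
      next
        case 3
        then have "bimonom 1 i j \<in> ?S" by (intro bipoly.span_base) blast
        then show ?thesis unfolding W_def using pair_ideal_0 by force
      qed
    qed
  qed
  have "P \<in> W" by (rule bipoly_in_subspace[OF sub mono])
  then show ?thesis unfolding W_def by (rule CollectD)
qed

end

lemma weighted_subst_1_coeff:
  "Polynomial.coeff (Polynomial.coeff (weighted_subst 1 1 P) N) j = (if j \<le> N then bicoeff P (N - j) j else 0)"
  by (simp only: weighted_subst_coeff zero_less_one mult_1 one_dvd simp_thms div_by_1)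

lemma bicoeff_weighted_subst_1:
  "bicoeff P i j = Polynomial.coeff (Polynomial.coeff (weighted_subst 1 1 P) (i + j)) j"
  by (simp only: weighted_subst_1_coeff) simp

lemma coeff_mult_above:
  fixes A F :: "'a::comm_ring_1 poly"
  assumes "\<And>i. Polynomial.coeff A i \<noteq> 0 \<Longrightarrow> i + d \<le> D" "Polynomial.degree F \<le> d"
  shows "Polynomial.coeff (A * F) D = (if d \<le> D then Polynomial.coeff A (D - d) * Polynomial.coeff F d else 0)"
proof -
  have "Polynomial.coeff (A * F) D = (\<Sum>i\<le>D. if i + d = D then Polynomial.coeff A i * Polynomial.coeff F d else 0)"
    unfolding coeff_mult
  proof (intro sum.cong refl)
    fix i assume "i \<in> {..D}"
    then show "Polynomial.coeff A i * Polynomial.coeff F (D - i) = (if i + d = D then Polynomial.coeff A i * Polynomial.coeff F d else 0)"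
      using assms(1)[of i] assms(2) coeff_eq_0[of F "D - i"] by (cases "Polynomial.coeff A i = 0") auto
  qed
  also have "\<dots> = (\<Sum>i\<le>D. if i = D - d then (if d \<le> D then Polynomial.coeff A i * Polynomial.coeff F d else 0) else 0)"
    by (intro sum.cong refl) auto
  finally show ?thesis by simp
qed

text \<open>
  The multiplier of \<open>g\<close> may be reduced modulo \<open>f\<close> to degree less than \<open>d\<close> in \<open>y\<close>. Then no cancellation of
  leading forms is possible: the top form of \<open>f\<close> is coprime to that of \<open>g\<close>, so it would divide the top form of
  the reduced multiplier, whose degree in \<open>y\<close> is too small.
\<close>

lemma degree_bounded_combination:
  assumes f: "Polynomial.degree f = d" "Polynomial.lead_coeff f = [:c:]" "c \<noteq> 0"
    and tdf: "\<And>i j. bicoeff f i j \<noteq> 0 \<Longrightarrow> i + j \<le> d"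
    and tdg: "\<And>i j. bicoeff g i j \<noteq> 0 \<Longrightarrow> i + j \<le> e"
    and inf: "\<And>z. poly (Polynomial.coeff (weighted_subst 1 1 f) d) z = 0 \<Longrightarrow>
        poly (Polynomial.coeff (weighted_subst 1 1 g) e) z = 0 \<Longrightarrow> False"
    and h: "h \<in> pair_ideal f g" and tdh: "\<And>i j. bicoeff h i j \<noteq> 0 \<Longrightarrow> i + j \<le> k"
  shows "\<exists>a b. h = a * f + b * g \<and> (\<forall>i j. bicoeff a i j \<noteq> 0 \<longrightarrow> i + j + d \<le> k)
     \<and> (\<forall>i j. bicoeff b i j \<noteq> 0 \<longrightarrow> i + j + e \<le> k \<and> j < d)"
proof -
  have f0: "f \<noteq> 0" using f by auto
  obtain a0 b0 where ab0: "h = a0 * f + b0 * g" using h unfolding pair_ideal_def by blast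
  obtain Q r where Qr: "pseudo_divmod b0 f = (Q, r)" by (cases "pseudo_divmod b0 f") auto
  \<comment> \<open>The factor by which pseudo-division multiplies is a constant, so it can be removed.\<close>
  define u where "u = c ^ (Suc (Polynomial.degree b0) - Polynomial.degree f)"
  have u: "u \<noteq> 0" using f(3) by (simp add: u_def)
  have "Polynomial.smult [:u:] b0 = f * Q + r"
    using pseudo_divmod(1)[OF f0 Qr] f(2) by (simp add: u_def poly_const_pow)
  then have "Polynomial.smult [:1/u:] (Polynomial.smult [:u:] b0) = Polynomial.smult [:1/u:] (f * Q) + Polynomial.smult [:1/u:] r"
    by (simp add: smult_add_right)
  then have b0: "b0 = f * Polynomial.smult [:1/u:] Q + Polynomial.smult [:1/u:] r"
    using u by (simp add: one_pCons[symmetric])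
  define b where "b = Polynomial.smult [:1/u:] r"
  define a where "a = a0 + Polynomial.smult [:1/u:] Q * g"
  have hab: "h = a * f + b * g"
    unfolding ab0 a_def by (subst b0) (simp add: b_def algebra_simps)
  have degb: "Polynomial.coeff b j = 0" if "d \<le> j" for j
  proof -
    have "r = 0 \<or> Polynomial.degree r < d" using pseudo_divmod(2)[OF f0 Qr] f(1) by simp
    then have "Polynomial.coeff r j = 0" using that by (auto intro: coeff_eq_0)
    then show ?thesis by (simp add: b_def)
  qed
  let ?\<sigma> = "weighted_subst 1 1"
  have deg\<sigma>: "Polynomial.degree (?\<sigma> P) \<le> n" if td: "\<And>i j. bicoeff P i j \<noteq> 0 \<Longrightarrow> i + j \<le> n" for P n
  proof (rule degree_le, intro allI impI)
    fix N assume "n < N"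
    show "Polynomial.coeff (?\<sigma> P) N = 0"
    proof (rule poly_eqI)
      fix j
      have "bicoeff P (N - j) j = 0" if "j \<le> N"
        using td[where i = "N - j" and j = j] \<open>n < N\<close> that by (intro ccontr[of "bicoeff P (N - j) j = 0"]) linarith
      then show "Polynomial.coeff (Polynomial.coeff (?\<sigma> P) N) j = Polynomial.coeff 0 j"
        unfolding weighted_subst_1_coeff by simp
    qed
  qed
  \<comment> \<open>The total degrees of the two summands; the largest one is attained by a leading form that cannot cancel.\<close>
  define S where "S = {N + d | N. Polynomial.coeff (?\<sigma> a) N \<noteq> 0} \<union> {N + e | N. Polynomial.coeff (?\<sigma> b) N \<noteq> 0}"
  have "S \<subseteq> {.. Polynomial.degree (?\<sigma> a) + d + Polynomial.degree (?\<sigma> b) + e}"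
    unfolding S_def by (auto dest: le_degree)
  then have fin: "finite S" by (rule finite_subset) simp
  have bound: "N \<le> k" if "N \<in> S" for N
  proof (rule ccontr)
    assume "\<not> N \<le> k"
    define D where "D = Max S"
    have maxD: "\<And>N. N \<in> S \<Longrightarrow> N \<le> D" unfolding D_def using Max_ge[OF fin] by blast
    have D: "D \<in> S" "k < D"
      using Max_in[OF fin] maxD[OF that] that \<open>\<not> N \<le> k\<close> unfolding D_def by (blast, linarith)
    let ?A = "if d \<le> D then Polynomial.coeff (?\<sigma> a) (D - d) else 0"
    let ?B = "if e \<le> D then Polynomial.coeff (?\<sigma> b) (D - e) else 0"
    let ?F = "Polynomial.coeff (?\<sigma> f) d" and ?G = "Polynomial.coeff (?\<sigma> g) e"
    have "?\<sigma> h = ?\<sigma> a * ?\<sigma> f + ?\<sigma> b * ?\<sigma> g"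
      unfolding hab by (simp add: ring_morphism_weighted_subst ring_morphism_add ring_morphism_mult)
    moreover have "Polynomial.coeff (?\<sigma> h) D = 0"
      using deg\<sigma>[of h k] tdh D(2) by (intro coeff_eq_0) fastforce
    moreover have "Polynomial.coeff (?\<sigma> a * ?\<sigma> f) D = ?A * ?F"
      using maxD deg\<sigma>[OF tdf] by (subst coeff_mult_above[of _ d]) (auto simp: S_def)
    moreover have "Polynomial.coeff (?\<sigma> b * ?\<sigma> g) D = ?B * ?G"
      using maxD deg\<sigma>[OF tdg] by (subst coeff_mult_above[of _ e]) (auto simp: S_def)
    ultimately have sum0: "?A * ?F + ?B * ?G = 0" by simp
    have "coprime ?F ?G" by (rule no_common_root_bezout) (rule inf)
    moreover have "?B * ?G = - (?A * ?F)" using sum0 by (simp add: eq_neg_iff_add_eq_0 add.commute)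
    then have "?F dvd ?B * ?G" by simp
    ultimately have dvdB: "?F dvd ?B" by (simp add: coprime_dvd_mult_left_iff)
    have Fd: "Polynomial.coeff ?F d = c"
      unfolding weighted_subst_1_coeff using f by simp
    have F0: "?F \<noteq> 0" using Fd f(3) by auto
    have "?B = 0"
    proof (rule ccontr)
      assume B0: "?B \<noteq> 0"
      have "d \<le> Polynomial.degree ?F" using Fd f(3) by (intro le_degree) simp
      also have "\<dots> \<le> Polynomial.degree ?B" using dvdB B0 by (rule dvd_imp_degree_le)
      finally have "Polynomial.coeff b (Polynomial.degree ?B) = 0" by (rule degb)
      then have "Polynomial.lead_coeff ?B = 0"
        by (cases "e \<le> D") (simp_all only: weighted_subst_1_coeff if_True if_False coeff_0, simp_all)
      then show False using B0 by (simp only: leading_coeff_0_iff)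
    qed
    then have "?A * ?F = 0" using sum0 by (simp only: mult_zero_left add_0_right)
    then have "?A = 0" using F0 by (simp only: mult_eq_0_iff simp_thms)
    from D(1) consider N where "D = N + d" "Polynomial.coeff (?\<sigma> a) N \<noteq> 0"
      | N where "D = N + e" "Polynomial.coeff (?\<sigma> b) N \<noteq> 0" unfolding S_def by blast
    then show False
    proof cases
      case 1
      then show False using \<open>?A = 0\<close> by simp
    next
      case 2
      then show False using \<open>?B = 0\<close> by simp
    qed
  qed
  have "i + j + d \<le> k" if "bicoeff a i j \<noteq> 0" for i j
  proof -
    have "bicoeff a i j = Polynomial.coeff (Polynomial.coeff (?\<sigma> a) (i + j)) j" by (rule bicoeff_weighted_subst_1)
    then have "Polynomial.coeff (?\<sigma> a) (i + j) \<noteq> 0" using that by (metis coeff_0)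
    then show ?thesis by (intro bound) (auto simp: S_def)
  qed
  moreover have "i + j + e \<le> k \<and> j < d" if "bicoeff b i j \<noteq> 0" for i j
  proof
    have "bicoeff b i j = Polynomial.coeff (Polynomial.coeff (?\<sigma> b) (i + j)) j" by (rule bicoeff_weighted_subst_1)
    then have "Polynomial.coeff (?\<sigma> b) (i + j) \<noteq> 0" using that by (metis coeff_0)
    then show "i + j + e \<le> k" by (intro bound) (auto simp: S_def)
    show "j < d" using that degb[of j] by (cases "d \<le> j") auto
  qed
  ultimately show ?thesis using hab by blast
qed

lemma bimonom_independent:
  "bipoly.independent ((\<lambda>(i, j). bimonom 1 i j) ` A)" and bimonom_inj: "inj_on (\<lambda>(i, j). bimonom 1 i j) A"
proof -
  show inj: "inj_on (\<lambda>(i, j). bimonom 1 i j) A"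
  proof (rule inj_onI, clarify)
    fix i j i' j' assume "bimonom 1 i j = bimonom 1 i' j'"
    then have "bicoeff (bimonom 1 i j) i j = bicoeff (bimonom 1 i' j') i j" by simp
    then show "i = i' \<and> j = j'" unfolding bicoeff_bimonom by (simp split: if_splits)
  qed
  show "bipoly.independent ((\<lambda>(i, j). bimonom 1 i j) ` A)"
    unfolding bipoly.independent_explicit_module
  proof (intro allI impI)
    fix t u and v :: bipoly
    assume t: "finite t" "t \<subseteq> (\<lambda>(i, j). bimonom 1 i j) ` A" and s: "(\<Sum>v\<in>t. Polynomial.smult [:u v:] v) = 0" and v: "v \<in> t"
    obtain i j where ij: "v = bimonom 1 i j" using t v by auto
    have "bicoeff (Polynomial.smult [:u w:] w) i j = (if w = v then u v else 0)" if w: "w \<in> t" for w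
    proof -
      obtain a b where ab: "w = bimonom 1 a b" using t w by auto
      show ?thesis
      proof (cases "w = v")
        case True then show ?thesis by (simp add: ij)
      next
        case False
        then have "\<not> (a = i \<and> b = j)" using ab ij by auto
        then show ?thesis using False ab by auto
      qed
    qed
    then have "(\<Sum>w\<in>t. bicoeff (Polynomial.smult [:u w:] w) i j) = (\<Sum>w\<in>t. if w = v then u v else 0)"
      by (intro sum.cong) auto
    moreover have "(\<Sum>w\<in>t. bicoeff (Polynomial.smult [:u w:] w) i j) = 0"
      using arg_cong[OF s, of "\<lambda>P. bicoeff P i j"] by (simp only: coeff_sum coeff_0)
    ultimately show "u v = 0" using t(1) v by simp
  qed
qed

lemma card_staircase: "card {(i, j). i + j + e \<le> k \<and> j < (d::nat)} = (\<Sum>j<d. Suc k - (e + j))"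
proof -
  have "{(i, j). i + j + e \<le> k \<and> j < d} = (\<lambda>(j, i). (i, j)) ` (SIGMA j:{..<d}. {i. i < Suc k - (e + j)})"
    by (auto simp: image_iff)
  then have "card {(i, j). i + j + e \<le> k \<and> j < d} = card (SIGMA j:{..<d}. {i. i < Suc k - (e + j)})"
    by (simp add: card_image inj_on_def)
  then show ?thesis by simp
qed

text \<open>
  The polynomials of total degree at most \<open>k\<close> are spanned by the \<open>n m\<close> monomials of \<open>weighted_span\<close>,
  by the multiples of \<open>f\<close> of degree at most \<open>k\<close>, and by the multiples of \<open>g\<close> of degree at most \<open>k\<close> whose
  cofactor has degree less than \<open>d\<close> in \<open>y\<close>. For large \<open>k\<close>, counting monomials gives \<open>d * e \<le> n * m\<close>.
\<close>

theorem bezout_weighted_bound: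
  assumes f: "Polynomial.degree f = d" "Polynomial.lead_coeff f = [:c:]" "c \<noteq> 0"
    and tdf: "\<And>i j. bicoeff f i j \<noteq> 0 \<Longrightarrow> i + j \<le> d"
    and tdg: "\<And>i j. bicoeff g i j \<noteq> 0 \<Longrightarrow> i + j \<le> e"
    and inf: "\<And>z. poly (Polynomial.coeff (weighted_subst 1 1 f) d) z = 0 \<Longrightarrow>
        poly (Polynomial.coeff (weighted_subst 1 1 g) e) z = 0 \<Longrightarrow> False"
    and common: "\<And>a b. poly (poly f [:b:]) a = 0 \<Longrightarrow> poly (poly g [:b:]) a = 0 \<Longrightarrow> a = 0 \<and> b = 0"
    and pq: "p > 0" "q > 0"
    and f0: "bicoeff f 0 m \<noteq> 0" "\<And>i j. bicoeff f i j \<noteq> 0 \<Longrightarrow> q * m \<le> p * i + q * j"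
    and g0: "bicoeff g n 0 \<noteq> 0"
      "\<And>i j. bicoeff g i j \<noteq> 0 \<Longrightarrow> (i, j) \<noteq> (n, 0) \<Longrightarrow> p * n < p * i + q * j"
  shows "d * e \<le> n * m"
proof -
  interpret one_point_curves f g d
  proof unfold_locales
    show "Polynomial.degree f = d" by (rule f(1))
    show "\<exists>c. Polynomial.lead_coeff f = [:c:]" using f(2) by blast
    show "f \<noteq> 0" using f(2,3) by auto
  qed (rule common)
  \<comment> \<open>Large enough for all truncated subtractions below to be exact.\<close>
  define k where "k = n + m + d + e"
  let ?mon = "\<lambda>(i, j). bimonom 1 i j"
  define T1 where "T1 = {(i, j). i < n \<and> j < m}"
  define T2 where "T2 = {(i, j). i + j + d \<le> k}"
  define T3 where "T3 = {(i, j). i + j + e \<le> k \<and> j < d}"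
  define V where "V = {(i, j). i + j \<le> k}"
  define T where "T = ?mon ` T1 \<union> (\<lambda>x. ?mon x * f) ` T2 \<union> (\<lambda>x. ?mon x * g) ` T3"
  have V_fin: "finite V" by (rule finite_subset[of _ "{..k} \<times> {..k}"]) (auto simp: V_def)
  have T1_eq: "T1 = {..<n} \<times> {..<m}" by (auto simp: T1_def)
  have fin: "finite T1" "finite T2" "finite T3"
    using T1_eq by (auto simp: T2_def T3_def V_def intro!: finite_subset[OF _ V_fin])
  have span_mult: "P * h \<in> bipoly.span T"
    if sub: "\<And>i j. bicoeff P i j \<noteq> 0 \<Longrightarrow> bimonom 1 i j * h \<in> T" for P h
  proof -
    have "bipoly.subspace {P. P * h \<in> bipoly.span T}"
      unfolding bipoly.subspace_def
      by (auto simp: bipoly.span_zero distrib_right bipoly.span_add bipoly.span_scale)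
    then have "P \<in> {P. P * h \<in> bipoly.span T}"
      by (rule bipoly_in_subspace) (use sub bipoly.span_base in blast)
    then show ?thesis by blast
  qed
  have "?mon ` V \<subseteq> bipoly.span T"
  proof
    fix P assume "P \<in> ?mon ` V"
    then obtain i j where P: "P = bimonom 1 i j" "i + j \<le> k" by (auto simp: V_def)
    obtain w where w: "w \<in> bipoly.span {bimonom 1 i j | i j. i < n \<and> j < m}" "P - w \<in> pair_ideal f g"
      using weighted_span[OF pq f0 g0] by blast
    have "{bimonom 1 i j | i j. i < n \<and> j < m} = ?mon ` T1" by (auto simp: T1_def image_iff)
    then have w1: "w \<in> bipoly.span (?mon ` T1)" using w(1) by simp
    have "bicoeff w i j = 0" if "\<not> i + j \<le> k" for i j
    proof -
      have "bipoly.subspace {w. bicoeff w i j = 0}" by (auto simp: bipoly.subspace_def)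
      moreover have "?mon ` T1 \<subseteq> {w. bicoeff w i j = 0}" using that by (auto simp: T1_def k_def)
      ultimately show ?thesis using w1 bipoly.span_minimal by blast
    qed
    then have tdPw: "i' + j' \<le> k" if "bicoeff (P - w) i' j' \<noteq> 0" for i' j'
      using that P by (cases "i' + j' \<le> k") (auto split: if_splits)
    have "\<exists>a b. P - w = a * f + b * g \<and> (\<forall>i j. bicoeff a i j \<noteq> 0 \<longrightarrow> i + j + d \<le> k)
      \<and> (\<forall>i j. bicoeff b i j \<noteq> 0 \<longrightarrow> i + j + e \<le> k \<and> j < d)"
      by (rule degree_bounded_combination[OF f _ _ _ w(2)]) (fact tdf tdg inf tdPw)+
    then obtain a b where ab: "P - w = a * f + b * g"
        "\<forall>i j. bicoeff a i j \<noteq> 0 \<longrightarrow> i + j + d \<le> k"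
        "\<forall>i j. bicoeff b i j \<noteq> 0 \<longrightarrow> i + j + e \<le> k \<and> j < d"
      by blast
    have "a * f \<in> bipoly.span T"
      by (rule span_mult) (use ab(2) in \<open>force simp: T_def T2_def\<close>)
    moreover have "b * g \<in> bipoly.span T"
      by (rule span_mult) (use ab(3) in \<open>force simp: T_def T3_def\<close>)
    moreover have "w \<in> bipoly.span T"
      using w1 bipoly.span_mono[of "?mon ` T1" T] by (auto simp: T_def)
    moreover have "P = a * f + b * g + w" using ab(1) by (simp add: algebra_simps)
    ultimately show "P \<in> bipoly.span T" by (simp add: bipoly.span_add)
  qed
  then have "card (?mon ` V) \<le> card T"
    using bipoly.independent_span_bound[OF _ bimonom_independent] fin by (simp add: T_def)
  then have "card V \<le> card T" using card_image[OF bimonom_inj, of V] by simp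
  also have "\<dots> \<le> card (?mon ` T1) + card ((\<lambda>x. ?mon x * f) ` T2) + card ((\<lambda>x. ?mon x * g) ` T3)"
    unfolding T_def by (intro order.trans[OF card_Un_le] add_mono card_Un_le order.refl)
  also have "\<dots> \<le> card T1 + card T2 + card T3"
    by (intro add_mono card_image_le fin)
  also have "card T1 = n * m" by (simp add: T1_eq)
  also have "card T3 = (\<Sum>j<d. Suc k - (e + j))" unfolding T3_def by (rule card_staircase)
  finally have le: "card V \<le> n * m + card T2 + (\<Sum>j<d. Suc k - (e + j))" .
  define V1 where "V1 = {(i, j). i + j + 0 \<le> k \<and> j < d}"
  have "V = V1 \<union> (\<lambda>(i, j). (i, j + d)) ` T2"
  proof -
    have "(i, j) \<in> (\<lambda>(i, j). (i, j + d)) ` T2" if "i + j \<le> k" "\<not> j < d" for i j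
      using that by (intro image_eqI[of _ _ "(i, j - d)"]) (auto simp: T2_def)
    then show ?thesis by (auto simp: V_def V1_def T2_def)
  qed
  moreover have "V1 \<inter> (\<lambda>(i, j). (i, j + d)) ` T2 = {}" by (auto simp: V1_def)
  moreover have "finite V1" by (rule finite_subset[OF _ V_fin]) (auto simp: V1_def V_def)
  moreover have "card ((\<lambda>(i, j). (i, j + d)) ` T2) = card T2" by (intro card_image) (auto simp: inj_on_def)
  ultimately have "card V = card V1 + card T2" using fin(2) by (simp add: card_Un_disjoint)
  then have "card V1 \<le> n * m + (\<Sum>j<d. Suc k - (e + j))" using le by simp
  moreover have "card V1 = (\<Sum>j<d. Suc k - (0 + j))" unfolding V1_def by (rule card_staircase)
  moreover have "(\<Sum>j<d. Suc k - (0 + j)) = (\<Sum>j<d. e + (Suc k - (e + j)))"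
    by (intro sum.cong refl) (simp add: k_def)
  ultimately show ?thesis by (simp add: sum.distrib)
qed

section \<open>Forms and fractions of forms\<close>

abbreviation tricoeff :: "form \<Rightarrow> nat \<Rightarrow> nat \<Rightarrow> nat \<Rightarrow> complex" where
  "tricoeff F i j k \<equiv> Polynomial.coeff (Polynomial.coeff (Polynomial.coeff F i) j) k"

abbreviation form_const :: "complex \<Rightarrow> form" where
  "form_const c \<equiv> [:[:[:c:]:]:]"

lemma ring_morphism_form_const: "ring_morphism form_const"
  by (intro ring_morphism_comp[OF ring_morphism_const2 ring_morphism_const])

lemma homogeneousD: "homogeneous d F \<Longrightarrow> tricoeff F i j k \<noteq> 0 \<Longrightarrow> i + j + k = d"
  by (simp add: homogeneous_def)

lemma homogeneousI: "(\<And>i j k. tricoeff F i j k \<noteq> 0 \<Longrightarrow> i + j + k = d) \<Longrightarrow> homogeneous d F"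
  by (simp add: homogeneous_def)

lemma homogeneous_0: "homogeneous d 0"
  by (simp add: homogeneous_def)

lemma homogeneous_add:
  assumes "homogeneous d F" "homogeneous d G"
  shows "homogeneous d (F + G)"
proof (rule homogeneousI)
  fix i j k assume "tricoeff (F + G) i j k \<noteq> 0"
  then have "tricoeff F i j k \<noteq> 0 \<or> tricoeff G i j k \<noteq> 0" by auto
  then show "i + j + k = d" using assms homogeneousD by blast
qed

lemma homogeneous_uminus: "homogeneous d F \<Longrightarrow> homogeneous d (- F)"
  by (simp add: homogeneous_def)

lemma homogeneous_mult:
  assumes "homogeneous d F" "homogeneous e G"
  shows "homogeneous (d + e) (F * G)"
proof (rule homogeneousI)
  fix i j k assume "tricoeff (F * G) i j k \<noteq> 0"
  then obtain i' where i: "i' \<le> i" "Polynomial.coeff (Polynomial.coeff (Polynomial.coeff F i' * Polynomial.coeff G (i - i')) j) k \<noteq> 0"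
    unfolding coeff_mult[of F] coeff_sum by (auto elim!: sum.not_neutral_contains_not_neutral)
  then obtain j' where j: "j' \<le> j" "Polynomial.coeff (Polynomial.coeff (Polynomial.coeff F i') j' * Polynomial.coeff (Polynomial.coeff G (i - i')) (j - j')) k \<noteq> 0"
    unfolding coeff_mult[of "Polynomial.coeff F i'"] coeff_sum by (auto elim!: sum.not_neutral_contains_not_neutral)
  then obtain k' where k: "k' \<le> k" "tricoeff F i' j' k' * tricoeff G (i - i') (j - j') (k - k') \<noteq> 0"
    unfolding coeff_mult[of "Polynomial.coeff (Polynomial.coeff F i') j'"] by (auto elim!: sum.not_neutral_contains_not_neutral)
  then have "i' + j' + k' = d" "(i - i') + (j - j') + (k - k') = e"
    using assms homogeneousD by (metis mult_eq_0_iff)+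
  then show "i + j + k = d + e" using i(1) j(1) k(1) by linarith
qed

lemma homogeneous_const: "homogeneous 0 (form_const c)"
  by (rule homogeneousI) (auto simp: coeff_pCons split: nat.splits if_splits)

lemma homogeneous_1: "homogeneous 0 1"
  using homogeneous_const[of 1] by (simp add: one_pCons)

lemma homogeneous_power: "homogeneous d F \<Longrightarrow> homogeneous (d * n) (F ^ n)"
  by (induction n) (auto simp: homogeneous_1 dest: homogeneous_mult)

definition linear_form :: "complex ^ 3 \<Rightarrow> form" where
  "linear_form w = [:[:[:0, w $ 3:], [:w $ 2:]:], [:[:w $ 1:]:]:]"

lemma homogeneous_linear_form: "homogeneous 1 (linear_form w)"
  by (rule homogeneousI) (auto simp: linear_form_def coeff_pCons split: nat.splits if_splits)

text \<open>
  Evaluation of a form at a triple of elements of a commutative algebra, with structure map \<open>\<iota>\<close>.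
\<close>

definition form_subst :: "(complex \<Rightarrow> 'a::comm_ring_1) \<Rightarrow> 'a \<Rightarrow> 'a \<Rightarrow> 'a \<Rightarrow> form \<Rightarrow> 'a" where
  "form_subst \<iota> a b c = subst (subst (subst \<iota> c) b) a"

lemma ring_morphism_form_subst: "ring_morphism \<iota> \<Longrightarrow> ring_morphism (form_subst \<iota> a b c)"
  unfolding form_subst_def by (intro ring_morphism_subst)

lemma form_subst_const: "ring_morphism \<iota> \<Longrightarrow> form_subst \<iota> a b c (form_const z) = \<iota> z"
  unfolding form_subst_def by (simp add: subst_const ring_morphism_subst)

lemma form_subst_linear_form:
  "ring_morphism \<iota> \<Longrightarrow> form_subst \<iota> a b c (linear_form w) = \<iota> (w $ 1) * a + \<iota> (w $ 2) * b + \<iota> (w $ 3) * c"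
  unfolding form_subst_def linear_form_def
  by (simp add: subst_pCons ring_morphism_subst ring_morphism_zero algebra_simps)

lemma ring_morphism_form_eval: "ring_morphism (\<lambda>F. form_eval F v)"
  unfolding form_eval_def
  by (intro ring_morphism_comp[OF ring_morphism_poly] ring_morphism_comp[OF ring_morphism_comp[OF ring_morphism_poly ring_morphism_poly] ring_morphism_poly] )

lemma form_eval_const: "form_eval (form_const z) v = z"
  by (simp add: form_eval_def)

lemma form_eval_linear_form: "form_eval (linear_form w) v = w $ 1 * v $ 1 + w $ 2 * v $ 2 + w $ 3 * v $ 3"
  by (simp add: form_eval_def linear_form_def algebra_simps)

text \<open>
  Linear forms serve as generators, so that the three variables need not be treated one by one.
\<close>

lemma form_morphism_eqI:
  fixes h k :: "form \<Rightarrow> 'a::comm_ring_1"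
  assumes "ring_morphism h" "ring_morphism k" "\<And>c. h (form_const c) = k (form_const c)"
    "\<And>w. h (linear_form w) = k (linear_form w)"
  shows "h F = k F"
proof -
  have z: "h [:[:[:0, 1:]:]:] = k [:[:[:0, 1:]:]:]"
    using assms(4)[of "axis 3 1"] by (simp add: linear_form_def axis_def)
  have y: "h [:[:0, 1:]:] = k [:[:0, 1:]:]"
    using assms(4)[of "axis 2 1"] by (simp add: linear_form_def axis_def one_pCons)
  have x: "h [:0, 1:] = k [:0, 1:]"
    using assms(4)[of "axis 1 1"] by (simp add: linear_form_def axis_def one_pCons)
  have 1: "h [:[:p:]:] = k [:[:p:]:]" for p
    using ring_morphism_comp[OF ring_morphism_const2 assms(1)] ring_morphism_comp[OF ring_morphism_const2 assms(2)]
    by (rule ring_morphism_poly_eqI) (simp_all only: assms(3) z)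
  have 2: "h [:p:] = k [:p:]" for p
    using ring_morphism_comp[OF ring_morphism_const assms(1)] ring_morphism_comp[OF ring_morphism_const assms(2)]
    by (rule ring_morphism_poly_eqI) (simp_all only: 1 y)
  show ?thesis
    by (rule ring_morphism_poly_eqI[of h k]) (simp_all add: assms(1,2) 2 x)
qed

lemma form_subst_homogeneous:
  assumes \<iota>: "ring_morphism \<iota>" and F: "homogeneous d F"
  shows "form_subst \<iota> (s * a) (s * b) (s * c) F = s ^ d * form_subst \<iota> a b c F"
proof -
  let ?m = "\<lambda>i j k. Polynomial.monom (Polynomial.monom (Polynomial.monom (tricoeff F i j k) k) j) i"
  have "F = (\<Sum>i\<le>Polynomial.degree F. Polynomial.monom (Polynomial.coeff F i) i)"
    by (simp add: poly_as_sum_of_monoms)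
  also have "\<dots> = (\<Sum>i\<le>Polynomial.degree F. \<Sum>j\<le>Polynomial.degree (Polynomial.coeff F i).
      \<Sum>k\<le>Polynomial.degree (Polynomial.coeff (Polynomial.coeff F i) j). ?m i j k)"
    by (intro sum.cong refl) (subst bipoly_sum_monoms, simp add: monom_sum)
  finally have sum: "F = \<dots>" .
  have mon: "form_subst \<iota> a b c (?m i j k) = \<iota> (tricoeff F i j k) * c ^ k * b ^ j * a ^ i" for a b c i j k
    unfolding form_subst_def by (simp add: subst_monom ring_morphism_subst \<iota>)
  have scale: "form_subst \<iota> (s * a) (s * b) (s * c) (?m i j k) = s ^ d * form_subst \<iota> a b c (?m i j k)" for i j k
  proof (cases "tricoeff F i j k = 0")
    case True
    then show ?thesis unfolding mon by (simp add: ring_morphism_zero \<iota>)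
  next
    case False
    then have d: "d = i + j + k" using F homogeneousD by blast
    show ?thesis unfolding mon d by (simp add: power_mult_distrib power_add mult_ac)
  qed
  show ?thesis
    by (subst (1 2) sum) (simp only: ring_morphism_sum ring_morphism_form_subst \<iota> sum_distrib_left scale)
qed

lemma form_eval_eq_form_subst: "form_eval F v = form_subst (\<lambda>c. c) (v $ 1) (v $ 2) (v $ 3) F"
proof (rule form_morphism_eqI[of "\<lambda>F. form_eval F v"])
  have id: "ring_morphism (\<lambda>c::complex. c)" by (simp add: ring_morphism_def)
  show "ring_morphism (form_subst (\<lambda>c. c) (v $ 1) (v $ 2) (v $ 3))" by (intro ring_morphism_form_subst id)
qed (simp_all add: ring_morphism_form_eval form_eval_const form_eval_linear_form form_subst_const form_subst_linear_form ring_morphism_def[of "\<lambda>c. c"])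

lemma form_eval_scale: "homogeneous d F \<Longrightarrow> form_eval F (c *s v) = c ^ d * form_eval F v"
  unfolding form_eval_eq_form_subst
  using form_subst_homogeneous[of "\<lambda>c. c" d F c "v $ 1" "v $ 2" "v $ 3"] by (simp add: ring_morphism_def)

definition form_fract :: "form \<Rightarrow> form fract" where
  "form_fract g = Fraction_Field.Fract g 1"

lemma ring_morphism_form_fract: "ring_morphism form_fract"
  by (simp add: ring_morphism_def form_fract_def Zero_fract_def One_fract_def)

lemma form_fract_eq_0: "form_fract g = 0 \<longleftrightarrow> g = 0"
  by (simp add: form_fract_def Zero_fract_def eq_fract)

lemma form_fract_eq_iff: "form_fract g = form_fract h \<longleftrightarrow> g = h"
  by (simp add: form_fract_def eq_fract)

lemma Fract_eq_divide: "h \<noteq> 0 \<Longrightarrow> Fraction_Field.Fract g h = form_fract g / form_fract h"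
  by (simp add: form_fract_def)

text \<open>
  Below, the denominators are the forms not vanishing at a point or those not divisible by a prime form.
\<close>

definition denominators :: "form set \<Rightarrow> bool" where
  "denominators D \<longleftrightarrow> 0 \<notin> D \<and> 1 \<in> D \<and> (\<forall>g h. g \<in> D \<longrightarrow> h \<in> D \<longrightarrow> g * h \<in> D)"

lemma form_fractionsE:
  assumes "x \<in> form_fractions N D" "denominators D"
  obtains e g h where "g \<in> N" "h \<in> D" "h \<noteq> 0" "homogeneous e g" "homogeneous e h" "x = form_fract g / form_fract h"
  using assms unfolding form_fractions_def denominators_def
  by (smt (verit, best) Fract_eq_divide mem_Collect_eq)

lemma form_fractionsI:
  assumes "g \<in> N" "h \<in> D" "homogeneous e g" "homogeneous e h" "denominators D"
  shows "form_fract g / form_fract h \<in> form_fractions N D"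
proof -
  have "h \<noteq> 0" using assms by (auto simp: denominators_def)
  then show ?thesis using assms Fract_eq_divide[of h g] unfolding form_fractions_def by force
qed

lemma form_fractions_const: "denominators D \<Longrightarrow> form_fract (form_const c) \<in> form_fractions UNIV D"
  using form_fractionsI[of "form_const c" UNIV 1 D 0]
  by (simp add: homogeneous_const homogeneous_1 denominators_def ring_morphism_one[OF ring_morphism_form_fract])

lemma form_fractions_0: "denominators D \<Longrightarrow> 0 \<in> N \<Longrightarrow> 0 \<in> form_fractions N D"
  using form_fractionsI[of 0 N 1 D 0]
  by (simp add: homogeneous_0 homogeneous_1 denominators_def ring_morphism_zero[OF ring_morphism_form_fract])

lemma form_fractions_1: "denominators D \<Longrightarrow> 1 \<in> form_fractions UNIV D"
  using form_fractions_const[of D 1] ring_morphism_one[OF ring_morphism_form_fract] by (simp add: one_pCons)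

lemma form_fractions_add:
  assumes D: "denominators D" and N: "\<And>g h a b. g \<in> N \<Longrightarrow> h \<in> N \<Longrightarrow> g * a + h * b \<in> N"
    and "x \<in> form_fractions N D" "y \<in> form_fractions N D"
  shows "x + y \<in> form_fractions N D"
proof -
  obtain e g h where x: "g \<in> N" "h \<in> D" "h \<noteq> 0" "homogeneous e g" "homogeneous e h" "x = form_fract g / form_fract h"
    using assms(3) D by (rule form_fractionsE)
  obtain e' g' h' where y: "g' \<in> N" "h' \<in> D" "h' \<noteq> 0" "homogeneous e' g'" "homogeneous e' h'" "y = form_fract g' / form_fract h'"
    using assms(4) D by (rule form_fractionsE)
  have "x + y = form_fract (g * h' + g' * h) / form_fract (h * h')"
    using x y by (simp add: ring_morphism_add[OF ring_morphism_form_fract] ring_morphism_mult[OF ring_morphism_form_fract]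
        form_fract_eq_0 add_frac_eq)
  moreover have "homogeneous (e + e') (g * h' + g' * h)"
    using homogeneous_add homogeneous_mult x y by (metis add.commute)
  moreover have "homogeneous (e + e') (h * h')" using homogeneous_mult x y by blast
  moreover have "h * h' \<in> D" using x y D by (auto simp: denominators_def)
  ultimately show ?thesis using form_fractionsI[of "g * h' + g' * h" N] N x y D by metis
qed

lemma form_fractions_mult:
  assumes D: "denominators D" and N: "\<And>g a. g \<in> N \<Longrightarrow> g * a \<in> N"
    and "x \<in> form_fractions N D" "y \<in> form_fractions UNIV D"
  shows "x * y \<in> form_fractions N D"
proof -
  obtain e g h where x: "g \<in> N" "h \<in> D" "h \<noteq> 0" "homogeneous e g" "homogeneous e h" "x = form_fract g / form_fract h"
    using assms(3) D by (rule form_fractionsE)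
  obtain e' g' h' where y: "h' \<in> D" "h' \<noteq> 0" "homogeneous e' g'" "homogeneous e' h'" "y = form_fract g' / form_fract h'"
    using assms(4) D by (rule form_fractionsE)
  have "x * y = form_fract (g * g') / form_fract (h * h')"
    using x y by (simp add: ring_morphism_mult[OF ring_morphism_form_fract])
  moreover have "homogeneous (e + e') (g * g')" "homogeneous (e + e') (h * h')" using homogeneous_mult x y by blast+
  moreover have "h * h' \<in> D" using x y D by (auto simp: denominators_def)
  ultimately show ?thesis using form_fractionsI[of "g * g'" N] N x y D by metis
qed

lemma form_fractions_uminus:
  assumes D: "denominators D" and N: "\<And>g a. g \<in> N \<Longrightarrow> g * a \<in> N" and "x \<in> form_fractions N D"
  shows "- x \<in> form_fractions N D"
proof -
  have "form_fract (form_const (- 1)) = - 1"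
    using ring_morphism_uminus[OF ring_morphism_comp[OF ring_morphism_form_const ring_morphism_form_fract], of 1]
      ring_morphism_one[OF ring_morphism_comp[OF ring_morphism_form_const ring_morphism_form_fract]]
    by (simp only:)
  then show ?thesis
    using form_fractions_mult[OF D N assms(3) form_fractions_const[OF D, of "- 1"]] by simp
qed

lemma denominators_eval: "denominators {h. form_eval h v \<noteq> 0}"
  using ring_morphism_form_eval[of v] by (auto simp: denominators_def ring_morphism_def)

lemma denominators_prime: "prime_elem F \<Longrightarrow> denominators {h. \<not> F dvd h}"
  by (auto simp: denominators_def prime_elem_dvd_mult_iff)

section \<open>The function field of a curve\<close>

lemma form_irreducible_imp_prime: "Factorial_Ring.irreducible (F :: form) \<Longrightarrow> prime_elem F"
  by (rule irreducible_imp_prime_elem)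

lemma ring_of_type_algebra_simps:
  "x \<oplus>\<^bsub>fraction_ring S\<^esub> y = x + y" "x \<otimes>\<^bsub>fraction_ring S\<^esub> y = x * y"
  "\<zero>\<^bsub>fraction_ring S\<^esub> = 0" "\<one>\<^bsub>fraction_ring S\<^esub> = 1" "carrier (fraction_ring S) = S"
  by (simp_all add: fraction_ring_def ring_of_type_algebra_def)

lemma fraction_ring_cring:
  assumes "denominators D"
  shows "cring (fraction_ring (form_fractions UNIV D))"
proof -
  let ?S = "form_fractions UNIV D"
  let ?R = "fraction_ring ?S"
  have add: "x + y \<in> ?S" if "x \<in> ?S" "y \<in> ?S" for x y
    using that by (rule form_fractions_add[OF assms UNIV_I])
  have mult: "x * y \<in> ?S" if "x \<in> ?S" "y \<in> ?S" for x y
    using that by (rule form_fractions_mult[OF assms UNIV_I])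
  have minus: "- x \<in> ?S" if "x \<in> ?S" for x
    using that by (rule form_fractions_uminus[OF assms UNIV_I])
  have "abelian_group ?R"
  proof (rule abelian_groupI)
    fix x assume "x \<in> carrier ?R"
    then show "\<exists>y\<in>carrier ?R. y \<oplus>\<^bsub>?R\<^esub> x = \<zero>\<^bsub>?R\<^esub>"
      using minus by (intro bexI[of _ "- x"]) (simp_all add: ring_of_type_algebra_simps)
  qed (simp_all add: ring_of_type_algebra_simps add form_fractions_0[OF assms] add_ac)
  moreover have "comm_monoid ?R"
    by (rule comm_monoidI) (simp_all add: ring_of_type_algebra_simps mult form_fractions_1[OF assms] mult_ac)
  ultimately show ?thesis
    by (rule cringI) (simp add: ring_of_type_algebra_simps distrib_right)
qed

text \<open>
  The elements of the function field are cosets. All computations are done with representatives in the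
  ring \<open>G\<close> of rational functions defined at the generic point, modulo its maximal ideal \<open>I\<close>.
\<close>

locale prime_form =
  fixes F :: form
  assumes prime_F: "prime_elem F"
begin

abbreviation "G \<equiv> form_fractions UNIV {h. \<not> F dvd h}"
abbreviation "I \<equiv> generic_ideal F"
abbreviation "K \<equiv> function_field F"
abbreviation "res \<equiv> restrict_to_curve F"

lemma denom: "denominators {h. \<not> F dvd h}"
  by (rule denominators_prime[OF prime_F])

lemma G_add: "x \<in> G \<Longrightarrow> y \<in> G \<Longrightarrow> x + y \<in> G"
  by (rule form_fractions_add[OF denom UNIV_I])

lemma G_mult: "x \<in> G \<Longrightarrow> y \<in> G \<Longrightarrow> x * y \<in> G"
  by (rule form_fractions_mult[OF denom UNIV_I])

lemma G_uminus: "x \<in> G \<Longrightarrow> - x \<in> G"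
  by (rule form_fractions_uminus[OF denom UNIV_I])

lemma G_0: "0 \<in> G" and G_1: "1 \<in> G"
  by (rule form_fractions_0[OF denom UNIV_I], rule form_fractions_1[OF denom])

lemma G_power: "x \<in> G \<Longrightarrow> x ^ n \<in> G"
  by (induction n) (simp_all add: G_1 G_mult)

lemma G_sum: "(\<And>i. i \<in> A \<Longrightarrow> f i \<in> G) \<Longrightarrow> sum f A \<in> G"
  by (induction A rule: infinite_finite_induct) (simp_all add: G_0 G_add)

lemma I_subset_G: "I \<subseteq> G"
  unfolding generic_ideal_def form_fractions_def by blast

lemma I_add: "x \<in> I \<Longrightarrow> y \<in> I \<Longrightarrow> x + y \<in> I"
  unfolding generic_ideal_def by (rule form_fractions_add[OF denom]) simp_all

lemma I_mult: "x \<in> I \<Longrightarrow> y \<in> G \<Longrightarrow> x * y \<in> I"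
  unfolding generic_ideal_def by (rule form_fractions_mult[OF denom]) simp_all

lemma I_uminus: "x \<in> I \<Longrightarrow> - x \<in> I"
  unfolding generic_ideal_def by (rule form_fractions_uminus[OF denom]) simp_all

lemma I_0: "0 \<in> I"
  unfolding generic_ideal_def by (rule form_fractions_0[OF denom]) simp

lemma I_multL: "y \<in> G \<Longrightarrow> x \<in> I \<Longrightarrow> y * x \<in> I"
  using I_mult by (simp add: mult.commute)

lemma I_diff: "x \<in> I \<Longrightarrow> y \<in> I \<Longrightarrow> x - y \<in> I"
  using I_add[of x "- y"] I_uminus[of y] by simp

lemma one_notin_I: "1 \<notin> I"
proof
  assume "1 \<in> I"
  then obtain e g h where gh: "F dvd g" "\<not> F dvd h" "h \<noteq> 0" "1 = form_fract g / form_fract h"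
    unfolding generic_ideal_def using denom by (auto elim: form_fractionsE)
  then have "form_fract g = form_fract h" by (simp add: form_fract_eq_0)
  then show False using gh by (simp add: form_fract_eq_iff)
qed

lemma generic_ring_eq: "generic_ring F = fraction_ring G"
  by (simp add: generic_ring_def)

sublocale R: cring "generic_ring F"
  unfolding generic_ring_eq by (rule fraction_ring_cring[OF denom])

lemma generic_simps:
  "x \<oplus>\<^bsub>generic_ring F\<^esub> y = x + y" "x \<otimes>\<^bsub>generic_ring F\<^esub> y = x * y"
  "\<zero>\<^bsub>generic_ring F\<^esub> = 0" "\<one>\<^bsub>generic_ring F\<^esub> = 1" "carrier (generic_ring F) = G"
  by (simp_all add: generic_ring_eq ring_of_type_algebra_simps)

lemma generic_minus: "x \<in> G \<Longrightarrow> \<ominus>\<^bsub>generic_ring F\<^esub> x = - x"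
  by (rule R.minus_equality) (simp_all add: generic_simps G_uminus)

lemma ideal_I: "ideal I (generic_ring F)"
proof (rule idealI)
  show "ring (generic_ring F)" by (rule R.ring_axioms)
  show "subgroup I (add_monoid (generic_ring F))"
  proof (rule R.add.subgroupI)
    show "I \<subseteq> carrier (generic_ring F)" using I_subset_G by (simp add: generic_simps)
    show "I \<noteq> {}" using I_0 by blast
  next
    fix a assume "a \<in> I"
    then show "\<ominus>\<^bsub>generic_ring F\<^esub> a \<in> I"
      using I_uminus generic_minus[of a] I_subset_G by force
  next
    fix a b assume "a \<in> I" "b \<in> I"
    then show "a \<oplus>\<^bsub>generic_ring F\<^esub> b \<in> I" using I_add by (simp add: generic_simps)
  qed
next
  fix a x assume "a \<in> I" "x \<in> carrier (generic_ring F)"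
  then show "x \<otimes>\<^bsub>generic_ring F\<^esub> a \<in> I" "a \<otimes>\<^bsub>generic_ring F\<^esub> x \<in> I"
    using I_mult I_multL by (simp_all add: generic_simps)
qed

lemma res_eq: "res x = {i + x | i. i \<in> I}"
  unfolding restrict_to_curve_def a_r_coset_def' by (auto simp: generic_simps)

lemma res_eq_iff: "res x = res y \<longleftrightarrow> x - y \<in> I"
proof
  assume "res x = res y"
  moreover have "x \<in> res x" unfolding res_eq using I_0 by force
  ultimately obtain i where "x = i + y" "i \<in> I" unfolding res_eq by blast
  then show "x - y \<in> I" by simp
next
  assume xy: "x - y \<in> I"
  have "i + x \<in> res y" if "i \<in> I" for i
    unfolding res_eq using that xy I_add[of i "x - y"] by (intro CollectI exI[of _ "i + (x - y)"]) simp
  moreover have "i + y \<in> res x" if "i \<in> I" for i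
    unfolding res_eq using that xy I_diff[of i "x - y"] by (intro CollectI exI[of _ "i - (x - y)"]) simp
  ultimately show "res x = res y" unfolding res_eq by blast
qed

sublocale K: cring "function_field F"
  unfolding function_field_def by (rule ideal.quotient_is_cring[OF ideal_I R.cring_axioms])

lemma K_carrier: "carrier K = res ` G"
  unfolding function_field_def FactRing_def A_RCOSETS_def'
  by (auto simp: restrict_to_curve_def generic_simps)

lemma K_mult: "x \<in> G \<Longrightarrow> y \<in> G \<Longrightarrow> res x \<otimes>\<^bsub>K\<^esub> res y = res (x * y)"
  using ideal.rcoset_mult_add[OF ideal_I, of x y]
  by (simp add: function_field_def FactRing_def restrict_to_curve_def generic_simps)

lemma K_add: "x \<in> G \<Longrightarrow> y \<in> G \<Longrightarrow> res x \<oplus>\<^bsub>K\<^esub> res y = res (x + y)"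
  using abelian_subgroup.a_rcos_sum[OF abelian_subgroupI3[OF ideal.axioms(1)[OF ideal_I] R.abelian_group_axioms], of x y]
  by (simp add: function_field_def FactRing_def restrict_to_curve_def generic_simps)

lemma K_one: "\<one>\<^bsub>K\<^esub> = res 1"
  by (simp add: function_field_def FactRing_def restrict_to_curve_def generic_simps)

lemma K_zero: "\<zero>\<^bsub>K\<^esub> = res 0"
proof -
  have "res 0 = I" unfolding res_eq by simp
  then show ?thesis by (simp add: function_field_def FactRing_def)
qed

lemma res_in_K: "x \<in> G \<Longrightarrow> res x \<in> carrier K"
  by (simp add: K_carrier)

lemma K_pow: "x \<in> G \<Longrightarrow> res x [^]\<^bsub>K\<^esub> (n::nat) = res (x ^ n)"
  by (induction n) (simp_all add: K_one K_mult G_power mult.commute)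

lemma K_minus: "x \<in> G \<Longrightarrow> \<ominus>\<^bsub>K\<^esub> res x = res (- x)"
  by (rule K.minus_equality) (simp_all add: res_in_K G_uminus K_add K_zero)

lemma poly_in_G:
  assumes "\<And>i. Polynomial.coeff p i \<in> G" "x \<in> G"
  shows "poly p x \<in> G"
  unfolding poly_altdef by (intro G_sum G_mult G_power assms)

lemma coeff_Poly_in: "set xs \<subseteq> A \<Longrightarrow> 0 \<in> A \<Longrightarrow> Polynomial.coeff (Poly xs) i \<in> A"
  by (auto simp: nth_default_def)

lemma Poly_snoc: "Poly (xs @ [x]) = Poly xs + Polynomial.monom x (length xs)"
  by (induction xs) (simp_all add: monom_0 monom_Suc)

lemma K_eval:
  assumes "set as \<subseteq> G" "x \<in> G"
  shows "K.eval (map res as) (res x) = res (poly (Poly (rev as)) x)"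
  using assms(1)
proof (induction as)
  case Nil
  then show ?case by (simp add: K_zero)
next
  case (Cons a as)
  have G': "poly (Poly (rev as)) x \<in> G"
    using Cons assms by (intro poly_in_G coeff_Poly_in) (auto simp: G_0)
  have "K.eval (map res (a # as)) (res x) = res a \<otimes>\<^bsub>K\<^esub> (res x [^]\<^bsub>K\<^esub> length as) \<oplus>\<^bsub>K\<^esub> K.eval (map res as) (res x)"
    by simp
  also have "\<dots> = res (a * x ^ length as + poly (Poly (rev as)) x)"
    using Cons assms G' by (simp add: K_pow K_mult K_add G_power G_mult)
  also have "a * x ^ length as + poly (Poly (rev as)) x = poly (Poly (rev (a # as))) x"
    by (simp add: Poly_snoc poly_monom)
  finally show ?case .
qed

text \<open>
  The value of the monic polynomial at a representative lies in \<open>I\<close> and can be subtracted from its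
  constant term. The representative is therefore a root of a monic polynomial in the ambient field, with
  coefficients in \<open>A\<close> up to elements of \<open>I\<close>; a constant polynomial is excluded since 1 is not in \<open>I\<close>.
\<close>

lemma integral_closureE:
  assumes y: "y \<in> integral_closure K (res ` A)" and A: "A \<subseteq> G" "0 \<in> A" "1 \<in> A"
  obtains x h where "x \<in> G" "y = res x" "Polynomial.lead_coeff h = 1" "poly h x = 0"
    "\<And>i. \<exists>a\<in>A. Polynomial.coeff h i - a \<in> I"
proof -
  obtain p where p: "polynomial\<^bsub>K\<^esub> (res ` A) p" "p \<noteq> []" "Polynomials.lead_coeff p = \<one>\<^bsub>K\<^esub>"
    "K.eval p y = \<zero>\<^bsub>K\<^esub>" and yK: "y \<in> carrier K"
    using y unfolding integral_closure_def by blast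
  obtain x where x: "x \<in> G" "y = res x" using yK K_carrier by blast
  have "set p \<subseteq> res ` A" using p(1,2) by (auto simp: polynomial_def)
  then have "p \<in> map res ` lists A" by (metis in_listsI lists_image subsetD)
  then obtain as where as: "set as \<subseteq> A" "p = map res as" by auto
  obtain a bs where ab: "as = a # bs" using p(2) as(2) by (cases as) auto
  have "res a = res 1" using p(3) as(2) ab K_one by simp
  then have a1: "a - 1 \<in> I" by (simp add: res_eq_iff)
  define h0 where "h0 = Poly (rev bs)"
  have asG: "set as \<subseteq> G" using as A by blast
  have "res (poly (Poly (rev as)) x) = res 0"
    using p(4) K_eval[OF asG x(1)] as(2) x(2) K_zero by simp
  then have I1: "poly (Poly (rev as)) x \<in> I" by (simp add: res_eq_iff)
  define c where "c = h0 + Polynomial.monom 1 (length bs)"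
  have rel: "Poly (rev as) = c + Polynomial.monom (a - 1) (length bs)"
  proof -
    have "Polynomial.monom a (length bs) = Polynomial.monom 1 (length bs) + Polynomial.monom (a - 1) (length bs)"
      by (simp add: add_monom)
    then show ?thesis unfolding c_def h0_def ab by (simp add: Poly_snoc)
  qed
  have "(a - 1) * x ^ length bs \<in> I" using a1 x by (intro I_mult G_power)
  then have cI: "poly c x \<in> I"
    using I_diff[OF I1, of "(a - 1) * x ^ length bs"] unfolding rel by (simp add: poly_monom)
  have h0A: "Polynomial.coeff h0 i \<in> A" for i
    unfolding h0_def using as(1) ab A by (intro coeff_Poly_in) auto
  have h0_deg: "Polynomial.coeff h0 i = 0" if "length bs \<le> i" for i
    unfolding h0_def using that by (simp add: nth_default_beyond)
  have xG: "x \<in> G" by (rule x(1))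
  show ?thesis
  proof (cases "length bs = 0")
    case True
    then have "c = 1" using h0_deg unfolding c_def by (simp add: h0_def monom_0 one_pCons)
    then show ?thesis using cI one_notin_I by simp
  next
    case False
    define h where "h = c - [:poly c x:]"
    have lead: "Polynomial.coeff h (length bs) = 1"
      using False h0_deg[of "length bs"] by (auto simp: h_def c_def coeff_pCons split: nat.splits)
    have "Polynomial.degree h = length bs"
    proof (rule antisym)
      show "Polynomial.degree h \<le> length bs"
        using h0_deg by (intro degree_le) (auto simp: h_def c_def coeff_pCons split: nat.splits)
      show "length bs \<le> Polynomial.degree h" using lead by (intro le_degree) simp
    qed
    then have "Polynomial.lead_coeff h = 1" using lead by simp
    moreover have "poly h x = 0" by (simp add: h_def)
    moreover have "\<exists>a\<in>A. Polynomial.coeff h i - a \<in> I" for i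
    proof -
      have "Polynomial.coeff c i \<in> A"
        using h0A[of i] h0_deg[of i] A by (cases "i = length bs") (auto simp: c_def)
      moreover have "Polynomial.coeff h i - Polynomial.coeff c i \<in> I"
        using cI I_0 I_uminus by (cases i) (auto simp: h_def)
      ultimately show ?thesis by blast
    qed
    ultimately show ?thesis using that xG x(2) by blast
  qed
qed

lemma integral_closureI:
  assumes x: "x \<in> G" and A: "A \<subseteq> G"
    and h: "\<And>i. Polynomial.coeff h i \<in> A" "Polynomial.lead_coeff h = 1" "poly h x \<in> I"
  shows "res x \<in> integral_closure K (res ` A)"
proof -
  define as where "as = rev (Polynomial.coeffs h)"
  have h0: "h \<noteq> 0" using h(2) by auto
  have as: "set as \<subseteq> A" unfolding as_def using h(1) by (auto simp: coeffs_def)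
  have hd: "hd as = 1" "as \<noteq> []"
    using h(2) h0 last_coeffs_eq_coeff_degree[OF h0] by (auto simp: as_def hd_rev)
  have ne: "res 1 \<noteq> res 0" using one_notin_I by (simp add: res_eq_iff)
  have "polynomial\<^bsub>K\<^esub> (res ` A) (map res as)"
    unfolding polynomial_def using as hd ne by (auto simp: hd_map K_zero)
  moreover have "map res as \<noteq> []" "Polynomials.lead_coeff (map res as) = \<one>\<^bsub>K\<^esub>"
    using hd by (simp_all add: hd_map K_one)
  moreover have "K.eval (map res as) (res x) = \<zero>\<^bsub>K\<^esub>"
    using K_eval[of as x] as A x h(3) by (simp add: as_def K_zero res_eq_iff subset_trans)
  ultimately show ?thesis unfolding integral_closure_def using res_in_K[OF x] by blast
qed

end

section \<open>Places of a unibranch point\<close>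

locale unibranch_form = prime_form +
  fixes v :: "complex ^ 3"
  assumes uni: "unibranch F v"
begin

abbreviation "O_v \<equiv> form_fractions UNIV {h. form_eval h v \<noteq> 0}"
abbreviation "A_norm \<equiv> integral_closure K (res ` O_v)"
abbreviation "N \<equiv> local_normalization F v"

lemma F_v: "form_eval F v = 0"
  using uni by (simp add: unibranch_def)

lemma denom_v: "denominators {h. form_eval h v \<noteq> 0}"
  by (rule denominators_eval)

lemma not_F_dvd: "form_eval h v \<noteq> 0 \<Longrightarrow> \<not> F dvd h"
  using ring_morphism_dvd[OF ring_morphism_form_eval, of F h v] F_v by auto

lemma O_subset_G: "O_v \<subseteq> G"
  using not_F_dvd unfolding form_fractions_def by blast

lemma O_mult: "x \<in> O_v \<Longrightarrow> y \<in> O_v \<Longrightarrow> x * y \<in> O_v"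
  by (rule form_fractions_mult[OF denom_v UNIV_I])

lemma O_uminus: "x \<in> O_v \<Longrightarrow> - x \<in> O_v"
  by (rule form_fractions_uminus[OF denom_v UNIV_I])

lemma O_0: "0 \<in> O_v" and O_1: "1 \<in> O_v"
  by (rule form_fractions_0[OF denom_v UNIV_I], rule form_fractions_1[OF denom_v])

lemma O_const: "form_fract (form_const c) \<in> O_v"
  by (rule form_fractions_const[OF denom_v])

text \<open>
  The existence of a prime ideal of the normalization includes that the normalization is a ring.
\<close>

lemma N_cring: "cring N"
proof -
  obtain P where "primeideal P N"
    using uni unfolding unibranch_def normalization_preimages_def by blast
  then show ?thesis by (simp add: primeideal_def)
qed

lemma N_simps: "carrier N = A_norm" "x \<otimes>\<^bsub>N\<^esub> y = x \<otimes>\<^bsub>K\<^esub> y" "x \<oplus>\<^bsub>N\<^esub> y = x \<oplus>\<^bsub>K\<^esub> y"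
  "\<one>\<^bsub>N\<^esub> = \<one>\<^bsub>K\<^esub>" "\<zero>\<^bsub>N\<^esub> = \<zero>\<^bsub>K\<^esub>"
  by (simp_all add: local_normalization_def curve_local_ring_def)

lemma A_in_K: "y \<in> A_norm \<Longrightarrow> y \<in> carrier K"
  by (simp add: integral_closure_def)

lemma O_integral: "x \<in> O_v \<Longrightarrow> res x \<in> A_norm"
proof (rule integral_closureI[of x O_v "[:- x, 1:]"])
  assume x: "x \<in> O_v"
  then show "x \<in> G" using O_subset_G by blast
  show "Polynomial.coeff [:- x, 1:] i \<in> O_v" for i
    using x O_uminus O_1 O_0 by (auto simp: coeff_pCons split: nat.splits)
qed (simp_all add: O_subset_G I_0)

lemma A_add: "x \<in> G \<Longrightarrow> y \<in> G \<Longrightarrow> res x \<in> A_norm \<Longrightarrow> res y \<in> A_norm \<Longrightarrow> res (x + y) \<in> A_norm"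
  using abelian_monoid.a_closed[OF abelian_group.axioms(1)[OF ring.is_abelian_group[OF cring.axioms(1)[OF N_cring]]], of "res x" "res y"]
  by (simp add: N_simps K_add)

text \<open>
  A place of the function field, lifted to representatives by the value 0 on \<open>I\<close>, whose restriction to the
  local ring is evaluation at the point.
\<close>

definition place_at :: "(form fract \<times> complex) set \<Rightarrow> bool" where
  "place_at \<Gamma> \<longleftrightarrow> maximal_place \<Gamma> \<and> (\<forall>i \<in> I. (i, 0) \<in> \<Gamma>)
     \<and> (\<forall>g h e. homogeneous e g \<longrightarrow> homogeneous e h \<longrightarrow> form_eval h v \<noteq> 0
          \<longrightarrow> (form_fract g / form_fract h, form_eval g v / form_eval h v) \<in> \<Gamma>)"

lemma place_graph_of: "place_at \<Gamma> \<Longrightarrow> place_graph \<Gamma>"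
  by (simp add: place_at_def maximal_place_def)

lemma place_I: "place_at \<Gamma> \<Longrightarrow> i \<in> I \<Longrightarrow> (i, 0) \<in> \<Gamma>"
  by (simp add: place_at_def)

lemma place_O:
  "place_at \<Gamma> \<Longrightarrow> homogeneous e g \<Longrightarrow> homogeneous e h \<Longrightarrow> form_eval h v \<noteq> 0
    \<Longrightarrow> (form_fract g / form_fract h, form_eval g v / form_eval h v) \<in> \<Gamma>"
  by (simp add: place_at_def)

lemma place_const: "place_at \<Gamma> \<Longrightarrow> (form_fract (form_const c), c) \<in> \<Gamma>"
  using place_O[of \<Gamma> 0 "form_const c" 1]
  by (simp add: homogeneous_const homogeneous_1 form_eval_const ring_morphism_one[OF ring_morphism_form_fract]
      ring_morphism_one[OF ring_morphism_form_eval])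

lemma place_O_Domain: "place_at \<Gamma> \<Longrightarrow> x \<in> O_v \<Longrightarrow> x \<in> Domain \<Gamma>"
proof -
  assume \<Gamma>: "place_at \<Gamma>" and x: "x \<in> O_v"
  from x denom_v obtain e g h where "form_eval h v \<noteq> 0" "homogeneous e g" "homogeneous e h"
    "x = form_fract g / form_fract h" by (auto elim: form_fractionsE)
  then show "x \<in> Domain \<Gamma>" using place_O[OF \<Gamma>] by blast
qed

lemma place_cong:
  assumes "place_at \<Gamma>" "(x, z) \<in> \<Gamma>" "res x = res y"
  shows "(y, z) \<in> \<Gamma>"
proof -
  have "(x - y, 0) \<in> \<Gamma>" using assms res_eq_iff place_I by blast
  from place_graph_diff[OF place_graph_of[OF assms(1)] assms(2) this] show ?thesis by simp
qed

text \<open>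
  A place is defined on all of the integral closure because its domain is integrally closed in the
  ambient field and contains the local ring and \<open>I\<close>.
\<close>

lemma A_Domain:
  assumes \<Gamma>: "place_at \<Gamma>" and x: "res x \<in> A_norm"
  shows "x \<in> Domain \<Gamma>"
proof -
  obtain x' h where h: "x' \<in> G" "res x = res x'" "Polynomial.lead_coeff h = 1" "poly h x' = 0"
    "\<And>i. \<exists>a\<in>O_v. Polynomial.coeff h i - a \<in> I"
    using x O_subset_G O_0 O_1 by (rule integral_closureE) blast
  have "Polynomial.coeff h i \<in> Domain \<Gamma>" for i
  proof -
    obtain a where "a \<in> O_v" "Polynomial.coeff h i - a \<in> I" using h(5) by blast
    then obtain z where "(a, z) \<in> \<Gamma>" "res a = res (Polynomial.coeff h i)"
      using place_O_Domain[OF \<Gamma>] res_eq_iff by (metis DomainE)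
    then show ?thesis using place_cong[OF \<Gamma>] by blast
  qed
  then have "x' \<in> Domain \<Gamma>"
    using maximal_place_integrally_closed[of \<Gamma> h x'] \<Gamma> h unfolding place_at_def by blast
  then show ?thesis using place_cong[OF \<Gamma>] h(2) by (metis DomainE DomainI)
qed

text \<open>
  The elements of the normalization that vanish in the place: a point of the normalization.
\<close>

definition center :: "(form fract \<times> complex) set \<Rightarrow> form fract set set" where
  "center \<Gamma> = {res x | x. x \<in> G \<and> res x \<in> A_norm \<and> (x, 0) \<in> \<Gamma>}"

lemma center_iff:
  assumes "place_at \<Gamma>" "x \<in> G"
  shows "res x \<in> center \<Gamma> \<longleftrightarrow> res x \<in> A_norm \<and> (x, 0) \<in> \<Gamma>"
proof
  assume "res x \<in> center \<Gamma>"
  then obtain y where y: "res x = res y" "res y \<in> A_norm" "(y, 0) \<in> \<Gamma>" unfolding center_def by blast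
  then show "res x \<in> A_norm \<and> (x, 0) \<in> \<Gamma>" using place_cong[OF assms(1) y(3), of x] by simp
next
  assume "res x \<in> A_norm \<and> (x, 0) \<in> \<Gamma>"
  then show "res x \<in> center \<Gamma>" unfolding center_def using assms(2) by blast
qed

lemma center_prime:
  assumes \<Gamma>: "place_at \<Gamma>"
  shows "primeideal (center \<Gamma>) N"
proof (rule primeidealI)
  interpret N: cring N by (rule N_cring)
  note pg = place_graph_of[OF \<Gamma>]
  have rep: "\<exists>x\<in>G. a = res x" if "a \<in> carrier N" for a
  proof -
    have "a \<in> res ` G" using that A_in_K[of a] by (simp only: N_simps(1) K_carrier)
    then show ?thesis by blast
  qed
  have mul: "a \<otimes>\<^bsub>N\<^esub> b \<in> center \<Gamma>" if a: "a \<in> carrier N" and b: "b \<in> center \<Gamma>" for a b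
  proof -
    from rep[OF a] obtain x where x: "x \<in> G" "a = res x" by (rule bexE)
    from b obtain y where y: "b = res y" "y \<in> G" "res y \<in> A_norm" "(y, 0) \<in> \<Gamma>"
      unfolding center_def by (elim CollectE exE conjE)
    note y = y(2,1,3,4)
    have "res x \<in> A_norm" using a x(2) by (simp only: N_simps)
    then obtain z where "(x, z) \<in> \<Gamma>" using A_Domain[OF \<Gamma>, of x] by (auto simp only: Domain_iff)
    then have "(x * y, 0) \<in> \<Gamma>" using place_graph_mult[OF pg _ y(4), of x z] by simp
    moreover have "b \<in> carrier N" using y(2,3) by (simp only: N_simps)
    then have "a \<otimes>\<^bsub>N\<^esub> b \<in> carrier N" using a by (rule N.m_closed[rotated])
    moreover have ab: "a \<otimes>\<^bsub>N\<^esub> b = res (x * y)" using K_mult[OF x(1) y(1)] x(2) y(2) by (simp only: N_simps)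
    ultimately have "res (x * y) \<in> A_norm" "(x * y, 0) \<in> \<Gamma>" by (simp_all only: N_simps)
    then show ?thesis unfolding ab center_def using G_mult[OF x(1) y(1)] by blast
  qed
  have sub: "center \<Gamma> \<subseteq> carrier N" unfolding center_def N_simps by blast
  show "cring N" by (rule N_cring)
  show "ideal (center \<Gamma>) N"
  proof (rule idealI)
    show "ring N" by (rule N.ring_axioms)
    show "subgroup (center \<Gamma>) (add_monoid N)"
    proof (rule N.add.subgroupI)
      show "center \<Gamma> \<subseteq> carrier N" by (rule sub)
      have "res 0 \<in> center \<Gamma>"
        unfolding center_def using G_0 O_integral[OF O_0] place_graph_zero[OF pg] by blast
      then show "center \<Gamma> \<noteq> {}" by blast
    next
      fix a assume a: "a \<in> center \<Gamma>"
      then obtain x where x: "x \<in> G" "a = res x" "(x, 0) \<in> \<Gamma>" unfolding center_def by blast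
      have aN: "a \<in> carrier N" using a sub by blast
      have "\<ominus>\<^bsub>N\<^esub> a \<oplus>\<^bsub>K\<^esub> a = \<zero>\<^bsub>K\<^esub>" using N.l_neg[OF aN] by (simp add: N_simps)
      moreover have "\<ominus>\<^bsub>N\<^esub> a \<in> carrier N" using aN by simp
      moreover from this have "\<ominus>\<^bsub>N\<^esub> a \<in> carrier K" "a \<in> carrier K"
        using aN A_in_K by (simp_all only: N_simps)
      ultimately have "\<ominus>\<^bsub>K\<^esub> a = \<ominus>\<^bsub>N\<^esub> a"
        using K.minus_equality by blast
      then have mx: "\<ominus>\<^bsub>N\<^esub> a = res (- x)" using K_minus[OF x(1)] x(2) by simp
      have "res (- x) \<in> A_norm" using \<open>\<ominus>\<^bsub>N\<^esub> a \<in> carrier N\<close> unfolding mx by (simp only: N_simps)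
      moreover have "(- x, 0) \<in> \<Gamma>" using place_graph_diff[OF pg place_graph_zero[OF pg] x(3)] by simp
      ultimately show "\<ominus>\<^bsub>N\<^esub> a \<in> center \<Gamma>"
        unfolding center_def mx using G_uminus[OF x(1)] by blast
    next
      fix a b assume "a \<in> center \<Gamma>" "b \<in> center \<Gamma>"
      then obtain x y where x: "x \<in> G" "a = res x" "res x \<in> A_norm" "(x, 0) \<in> \<Gamma>"
        and y: "y \<in> G" "b = res y" "res y \<in> A_norm" "(y, 0) \<in> \<Gamma>" unfolding center_def by blast
      have "(x + y, 0) \<in> \<Gamma>" using place_graph_add[OF pg x(4) y(4)] by simp
      moreover have "a \<oplus>\<^bsub>N\<^esub> b = res (x + y)" using K_add[OF x(1) y(1)] x(2) y(2) by (simp only: N_simps)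
      ultimately show "a \<oplus>\<^bsub>N\<^esub> b \<in> center \<Gamma>"
        unfolding center_def using A_add[OF x(1) y(1) x(3) y(3)] G_add[OF x(1) y(1)] by auto
    qed
  next
    fix a x assume a: "a \<in> center \<Gamma>" and x: "x \<in> carrier N"
    show "x \<otimes>\<^bsub>N\<^esub> a \<in> center \<Gamma>" by (rule mul[OF x a])
    then show "a \<otimes>\<^bsub>N\<^esub> x \<in> center \<Gamma>" using N.m_comm[OF x, of a] a sub by auto
  qed
  have "res 1 \<notin> center \<Gamma>"
    using center_iff[OF \<Gamma> G_1] place_graph_value_unique[OF pg place_graph_one[OF pg], of 0] by auto
  moreover have "res 1 \<in> carrier N" using O_integral[OF O_1] N_simps by simp
  ultimately show "carrier N \<noteq> center \<Gamma>" by blast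
  fix a b assume ab: "a \<in> carrier N" "b \<in> carrier N" "a \<otimes>\<^bsub>N\<^esub> b \<in> center \<Gamma>"
  obtain x y where x: "x \<in> G" "a = res x" and y: "y \<in> G" "b = res y" using rep ab by blast
  have A: "res x \<in> A_norm" "res y \<in> A_norm" using ab x y by (simp_all only: N_simps)
  obtain z w where zw: "(x, z) \<in> \<Gamma>" "(y, w) \<in> \<Gamma>"
    using A_Domain[OF \<Gamma> A(1)] A_Domain[OF \<Gamma> A(2)] by (auto simp only: Domain_iff)
  have "res (x * y) \<in> center \<Gamma>" using ab(3) x y K_mult[OF x(1) y(1)] by (simp only: N_simps)
  then have "(x * y, 0) \<in> \<Gamma>" using center_iff[OF \<Gamma> G_mult[OF x(1) y(1)]] by blast
  then have "z * w = 0" using place_graph_value_unique[OF pg _ place_graph_mult[OF pg zw]] by metis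
  then show "a \<in> center \<Gamma> \<or> b \<in> center \<Gamma>"
    using zw A center_iff[OF \<Gamma> x(1)] center_iff[OF \<Gamma> y(1)] unfolding x(2) y(2) by (auto simp only: mult_eq_0_iff)
qed

lemma center_contraction:
  assumes \<Gamma>: "place_at \<Gamma>"
  shows "center \<Gamma> \<inter> curve_local_ring F v = curve_max_ideal F v"
proof (intro equalityI subsetI)
  fix y assume y: "y \<in> center \<Gamma> \<inter> curve_local_ring F v"
  then obtain x where x: "x \<in> O_v" "y = res x" unfolding curve_local_ring_def by blast
  obtain e g h where gh: "form_eval h v \<noteq> 0" "homogeneous e g" "homogeneous e h" "x = form_fract g / form_fract h"
    using x(1) denom_v by (auto elim: form_fractionsE)
  have "(x, 0) \<in> \<Gamma>" using center_iff[OF \<Gamma>, of x] y x O_subset_G by blast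
  moreover have "(x, form_eval g v / form_eval h v) \<in> \<Gamma>" using place_O[OF \<Gamma>] gh by blast
  ultimately have "form_eval g v / form_eval h v = 0" using place_graph_value_unique[OF place_graph_of[OF \<Gamma>]] by blast
  then have "form_eval g v = 0" using gh by simp
  then have "x \<in> form_fractions {g. form_eval g v = 0} {h. form_eval h v \<noteq> 0}"
    unfolding gh(4) using gh denom_v by (intro form_fractionsI) auto
  then show "y \<in> curve_max_ideal F v" using x(2) unfolding curve_max_ideal_def by blast
next
  fix y assume "y \<in> curve_max_ideal F v"
  then obtain x where x: "x \<in> form_fractions {g. form_eval g v = 0} {h. form_eval h v \<noteq> 0}" "y = res x"
    unfolding curve_max_ideal_def by blast
  obtain e g h where gh: "form_eval g v = 0" "form_eval h v \<noteq> 0" "homogeneous e g" "homogeneous e h"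
    "x = form_fract g / form_fract h"
    using x(1) denom_v by (auto elim: form_fractionsE)
  have xO: "x \<in> O_v" using x(1) unfolding form_fractions_def by blast
  have "(x, 0) \<in> \<Gamma>" using place_O[OF \<Gamma> gh(3,4,2)] gh by simp
  then have "res x \<in> center \<Gamma>" using center_iff[OF \<Gamma>, of x] xO O_subset_G O_integral by blast
  then show "y \<in> center \<Gamma> \<inter> curve_local_ring F v"
    using x(2) xO unfolding curve_local_ring_def by blast
qed

text \<open>
  Two places have the same centre, since the point has only one preimage. Subtracting from an integral
  element its value in the first place yields an element of that centre, so the element has the same value in the
  second place.
\<close>

theorem place_value_unique:
  assumes \<Gamma>: "place_at \<Gamma>\<^sub>1" "place_at \<Gamma>\<^sub>2" and x: "x \<in> G" "res x \<in> A_norm"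
    and z: "(x, z\<^sub>1) \<in> \<Gamma>\<^sub>1" "(x, z\<^sub>2) \<in> \<Gamma>\<^sub>2"
  shows "z\<^sub>1 = z\<^sub>2"
proof -
  have "center \<Gamma>\<^sub>1 \<in> normalization_preimages F v" "center \<Gamma>\<^sub>2 \<in> normalization_preimages F v"
    unfolding normalization_preimages_def using center_prime center_contraction \<Gamma> by blast+
  then have eq: "center \<Gamma>\<^sub>1 = center \<Gamma>\<^sub>2" using uni unfolding unibranch_def by blast
  let ?c = "form_fract (form_const z\<^sub>1)"
  have c: "- ?c \<in> O_v" by (intro O_uminus O_const)
  have G: "x + - ?c \<in> G" using c O_subset_G x by (intro G_add) auto
  have "res (x + - ?c) \<in> A_norm" using c O_subset_G x O_integral by (intro A_add) auto
  moreover have "(x + - ?c, 0) \<in> \<Gamma>\<^sub>1"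
    using place_graph_diff[OF place_graph_of[OF \<Gamma>(1)] z(1) place_const[OF \<Gamma>(1)], of z\<^sub>1] by simp
  ultimately have "res (x + - ?c) \<in> center \<Gamma>\<^sub>2" using center_iff[OF \<Gamma>(1) G] eq by blast
  then have "(x + - ?c, 0) \<in> \<Gamma>\<^sub>2" using center_iff[OF \<Gamma>(2) G] by blast
  moreover have "(x + - ?c, z\<^sub>2 - z\<^sub>1) \<in> \<Gamma>\<^sub>2"
    using place_graph_diff[OF place_graph_of[OF \<Gamma>(2)] z(2) place_const[OF \<Gamma>(2)], of z\<^sub>1] by simp
  ultimately have "0 = z\<^sub>2 - z\<^sub>1" by (rule place_graph_value_unique[OF place_graph_of[OF \<Gamma>(2)]])
  then show ?thesis by simp
qed

end

section \<open>Affine charts\<close>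

abbreviation dot3 :: "complex ^ 3 \<Rightarrow> complex ^ 3 \<Rightarrow> complex" where
  "dot3 w u \<equiv> w $ 1 * u $ 1 + w $ 2 * u $ 2 + w $ 3 * u $ 3"

text \<open>
  A basis of the three-dimensional space whose third vector represents the point, with its dual basis.
\<close>

locale frame =
  fixes e1 e2 v l1 l2 l3 :: "complex ^ 3"
  assumes dual: "dot3 l1 e1 = 1" "dot3 l1 e2 = 0" "dot3 l1 v = 0"
    "dot3 l2 e1 = 0" "dot3 l2 e2 = 1" "dot3 l2 v = 0"
    "dot3 l3 e1 = 0" "dot3 l3 e2 = 0" "dot3 l3 v = 1"
    and complete: "\<And>w. dot3 w e1 *s l1 + dot3 w e2 *s l2 + dot3 w v *s l3 = w"
begin

text \<open>
  The affine equation \<open>F(v + x e1 + y e2)\<close>.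
\<close>

definition chart :: "form \<Rightarrow> bipoly" where
  "chart = form_subst (\<lambda>c. [:[:c:]:]) [:[:v $ 1, e1 $ 1:], [:e2 $ 1:]:] [:[:v $ 2, e1 $ 2:], [:e2 $ 2:]:]
     [:[:v $ 3, e1 $ 3:], [:e2 $ 3:]:]"

lemma ring_morphism_chart: "ring_morphism chart"
  unfolding chart_def by (intro ring_morphism_form_subst ring_morphism_const2)

lemma chart_const: "chart (form_const c) = [:[:c:]:]"
  unfolding chart_def by (rule form_subst_const[OF ring_morphism_const2])

lemma chart_linear: "chart (linear_form w) = [:[:dot3 w v, dot3 w e1:], [:dot3 w e2:]:]"
  unfolding chart_def by (simp add: form_subst_linear_form ring_morphism_const2 algebra_simps)

lemma chart_dual: "chart (linear_form l1) = [:[:0, 1:]:]" "chart (linear_form l2) = [:0, 1:]" "chart (linear_form l3) = 1"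
  unfolding chart_linear dual by (simp_all add: one_pCons)

lemma poly_chart: "poly (poly (chart F) [:b:]) a = form_eval F (v + a *s e1 + b *s e2)"
proof (rule form_morphism_eqI[of "\<lambda>F. poly (poly (chart F) [:b:]) a"])
  show "ring_morphism (\<lambda>F. poly (poly (chart F) [:b:]) a)"
    by (rule ring_morphism_comp[OF ring_morphism_chart ring_morphism_comp[OF ring_morphism_poly ring_morphism_poly]])
qed (simp_all add: ring_morphism_form_eval chart_const form_eval_const chart_linear form_eval_linear_form algebra_simps)

lemma chart_at_origin: "bicoeff (chart F) 0 0 = form_eval F v"
  using poly_chart[of F 0 0] by (simp add: poly_0_coeff_0)

abbreviation "\<xi> \<equiv> form_fract (linear_form l1) / form_fract (linear_form l3)"
abbreviation "\<eta> \<equiv> form_fract (linear_form l2) / form_fract (linear_form l3)"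
abbreviation "const_fract \<equiv> \<lambda>c. form_fract (form_const c)"

lemma ring_morphism_const_fract: "ring_morphism const_fract"
  by (rule ring_morphism_comp[OF ring_morphism_form_const ring_morphism_form_fract])

text \<open>
  The inclusion of the polynomials in the affine coordinates into the rational functions:
  \<open>x\<close> and \<open>y\<close> go to the quotients \<open>\<xi>\<close> and \<open>\<eta>\<close> of linear forms.
\<close>

definition on_chart :: "bipoly \<Rightarrow> form fract" where
  "on_chart = subst (subst const_fract \<xi>) \<eta>"

lemma ring_morphism_on_chart: "ring_morphism on_chart"
  unfolding on_chart_def by (intro ring_morphism_subst ring_morphism_const_fract)

lemma on_chart_simps: "on_chart [:[:c:]:] = const_fract c" "on_chart [:[:0, 1:]:] = \<xi>" "on_chart [:0, 1:] = \<eta>"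
  unfolding on_chart_def
  by (simp_all add: subst_pCons ring_morphism_subst ring_morphism_const_fract ring_morphism_zero ring_morphism_one
      ring_morphism_zero[OF ring_morphism_const_fract, simplified] ring_morphism_one[OF ring_morphism_const_fract])

lemma l_nonzero: "linear_form l1 \<noteq> 0" "linear_form l2 \<noteq> 0" "linear_form l3 \<noteq> 0"
  using dual form_eval_linear_form[of l1 e1] form_eval_linear_form[of l2 e2] form_eval_linear_form[of l3 v]
  by (auto simp: form_eval_def)

lemma linear_form_complete:
  "linear_form w = form_const (dot3 w e1) * linear_form l1 + form_const (dot3 w e2) * linear_form l2
      + form_const (dot3 w v) * linear_form l3"
proof -
  have "w $ k = l1 $ k * dot3 w e1 + l2 $ k * dot3 w e2 + l3 $ k * dot3 w v" for k
    using arg_cong[OF complete[of w], of "\<lambda>u. u $ k"] by (simp add: algebra_simps)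
  note k = this[of 1] this[of 2] this[of 3]
  show ?thesis unfolding linear_form_def using k by simp
qed

text \<open>
  Dehomogenization and homogenization are inverse to each other up to a power of the third linear
  form: dividing the vector of variables by that form gives \<open>v + \<xi> e1 + \<eta> e2\<close>.
\<close>

lemma form_fract_chart:
  assumes "homogeneous d F"
  shows "form_fract F = form_fract (linear_form l3) ^ d * on_chart (chart F)"
proof -
  let ?\<zeta> = "form_fract (linear_form l3)"
  have z0: "?\<zeta> \<noteq> 0" using l_nonzero by (simp add: form_fract_eq_0)
  define A where "A k = on_chart (chart (linear_form (axis k 1)))" for k :: 3
  have A: "?\<zeta> * A k = form_fract (linear_form (axis k 1))" for k
  proof -
    let ?w = "axis k 1 :: complex ^ 3"
    have "chart (linear_form ?w) = [:[:dot3 ?w v:]:] + [:[:dot3 ?w e1:]:] * [:[:0, 1:]:] + [:[:dot3 ?w e2:]:] * [:0, 1:]"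
      unfolding chart_linear by simp
    then have "A k = const_fract (dot3 ?w v) + const_fract (dot3 ?w e1) * \<xi> + const_fract (dot3 ?w e2) * \<eta>"
      unfolding A_def by (simp only: ring_morphism_simps[OF ring_morphism_on_chart] on_chart_simps)
    then have "?\<zeta> * A k = const_fract (dot3 ?w v) * ?\<zeta> + const_fract (dot3 ?w e1) * form_fract (linear_form l1)
        + const_fract (dot3 ?w e2) * form_fract (linear_form l2)"
      using z0 by (simp add: field_simps)
    also have "\<dots> = form_fract (linear_form ?w)"
      by (subst (2) linear_form_complete) (simp only: ring_morphism_simps[OF ring_morphism_form_fract] add_ac)
    finally show ?thesis .
  qed
  have lin: "dot3 w u = w $ 1 * u $ 1 + w $ 2 * u $ 2 + w $ 3 * u $ 3" for w u by (rule refl)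
  have ax: "linear_form w = form_const (w $ 1) * linear_form (axis 1 1) + form_const (w $ 2) * linear_form (axis 2 1)
      + form_const (w $ 3) * linear_form (axis 3 1)" for w
    by (simp add: linear_form_def axis_def)
  have 1: "on_chart (chart F) = form_subst const_fract (A 1) (A 2) (A 3) F" for F
  proof (rule form_morphism_eqI[of "\<lambda>F. on_chart (chart F)"])
    show m: "ring_morphism (\<lambda>F. on_chart (chart F))" by (rule ring_morphism_comp[OF ring_morphism_chart ring_morphism_on_chart])
    show "ring_morphism (form_subst const_fract (A 1) (A 2) (A 3))" by (intro ring_morphism_form_subst ring_morphism_const_fract)
    show c: "on_chart (chart (form_const c)) = form_subst const_fract (A 1) (A 2) (A 3) (form_const c)" for c
      by (simp only: chart_const on_chart_simps form_subst_const[OF ring_morphism_const_fract])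
    show "on_chart (chart (linear_form w)) = form_subst const_fract (A 1) (A 2) (A 3) (linear_form w)" for w
      by (subst ax) (simp only: ring_morphism_simps[OF m] chart_const on_chart_simps A_def
          form_subst_linear_form[OF ring_morphism_const_fract])
  qed
  have 2: "form_fract F = form_subst const_fract (form_fract (linear_form (axis 1 1))) (form_fract (linear_form (axis 2 1)))
      (form_fract (linear_form (axis 3 1))) F"
  proof (rule form_morphism_eqI[of form_fract])
    note m = ring_morphism_form_fract
    show "ring_morphism form_fract" by (rule m)
    show "form_fract (linear_form w) = form_subst const_fract (form_fract (linear_form (axis 1 1)))
       (form_fract (linear_form (axis 2 1))) (form_fract (linear_form (axis 3 1))) (linear_form w)" for w
      by (subst ax) (simp only: ring_morphism_simps[OF m] form_subst_linear_form[OF ring_morphism_const_fract])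
  qed (simp_all only: form_subst_const[OF ring_morphism_const_fract] ring_morphism_form_subst ring_morphism_const_fract)
  show ?thesis
    unfolding 2 1 A[symmetric] by (rule form_subst_homogeneous[OF ring_morphism_const_fract assms])
qed

text \<open>
  Polynomials in the affine coordinates are regular at the point and have there the expected value.
\<close>

lemma on_chart_regular:
  "\<exists>k g. homogeneous k g \<and> on_chart P = form_fract g / form_fract (linear_form l3 ^ k) \<and> form_eval g v = bicoeff P 0 0"
proof -
  define S where "S = {(x, c). \<exists>k g. homogeneous k g \<and> x = form_fract g / form_fract (linear_form l3 ^ k) \<and> form_eval g v = c}"
  note m = ring_morphism_simps[OF ring_morphism_form_fract] ring_morphism_simps[OF ring_morphism_form_eval]
  have z0: "form_fract (linear_form l3) \<noteq> 0" using l_nonzero by (simp add: form_fract_eq_0)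
  have l3v: "form_eval (linear_form l3) v = 1" using dual by (simp add: form_eval_linear_form)
  have const: "(const_fract c, c) \<in> S" for c
    unfolding S_def by (intro CollectI case_prodI exI[of _ 0] exI[of _ "form_const c"])
      (simp add: homogeneous_const m form_eval_const)
  have \<xi>: "(\<xi>, 0) \<in> S"
    unfolding S_def using dual homogeneous_linear_form[of l1]
    by (intro CollectI case_prodI, rule_tac exI[of _ 1], rule_tac exI[of _ "linear_form l1"])
      (simp add: form_eval_linear_form)
  have \<eta>: "(\<eta>, 0) \<in> S"
    unfolding S_def using dual homogeneous_linear_form[of l2]
    by (intro CollectI case_prodI, rule_tac exI[of _ 1], rule_tac exI[of _ "linear_form l2"])
      (simp add: form_eval_linear_form)
  have add: "(x + y, a + b) \<in> S" if "(x, a) \<in> S" "(y, b) \<in> S" for x y a b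
  proof -
    obtain k g where g: "homogeneous k g" "x = form_fract g / form_fract (linear_form l3 ^ k)" "form_eval g v = a"
      using \<open>(x, a) \<in> S\<close> unfolding S_def by blast
    obtain l h where h: "homogeneous l h" "y = form_fract h / form_fract (linear_form l3 ^ l)" "form_eval h v = b"
      using \<open>(y, b) \<in> S\<close> unfolding S_def by blast
    have "homogeneous (k + l) (g * linear_form l3 ^ l + h * linear_form l3 ^ k)"
      using homogeneous_mult[OF g(1) homogeneous_power[OF homogeneous_linear_form, of l l3]]
        homogeneous_mult[OF h(1) homogeneous_power[OF homogeneous_linear_form, of k l3]]
      by (intro homogeneous_add) (simp_all add: add.commute)
    moreover have "x + y = form_fract (g * linear_form l3 ^ l + h * linear_form l3 ^ k) / form_fract (linear_form l3 ^ (k + l))"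
      unfolding g(2) h(2) using z0 by (simp add: m power_add add_frac_eq)
    moreover have "form_eval (g * linear_form l3 ^ l + h * linear_form l3 ^ k) v = a + b"
      by (simp add: m l3v g h)
    ultimately show ?thesis unfolding S_def by blast
  qed
  have mult: "(x * y, a * b) \<in> S" if "(x, a) \<in> S" "(y, b) \<in> S" for x y a b
  proof -
    obtain k g where g: "homogeneous k g" "x = form_fract g / form_fract (linear_form l3 ^ k)" "form_eval g v = a"
      using \<open>(x, a) \<in> S\<close> unfolding S_def by blast
    obtain l h where h: "homogeneous l h" "y = form_fract h / form_fract (linear_form l3 ^ l)" "form_eval h v = b"
      using \<open>(y, b) \<in> S\<close> unfolding S_def by blast
    have "homogeneous (k + l) (g * h)" "form_eval (g * h) v = a * b"
      "x * y = form_fract (g * h) / form_fract (linear_form l3 ^ (k + l))"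
      using homogeneous_mult g h by (simp_all add: m power_add)
    then show ?thesis unfolding S_def by blast
  qed
  have zero: "(0, 0) \<in> S" using const[of 0] by (simp add: ring_morphism_zero[OF ring_morphism_form_fract])
  have inner: "(subst const_fract \<xi> p, Polynomial.coeff p 0) \<in> S" for p
  proof (induction p)
    case 0 then show ?case using zero by simp
  next
    case (pCons c p)
    show ?case using add[OF const[of c] mult[OF \<xi> pCons(2)]] by (simp add: subst_pCons ring_morphism_const_fract)
  qed
  have "(on_chart P, bicoeff P 0 0) \<in> S"
  proof (induction P)
    case 0 then show ?case using zero by (simp add: on_chart_def)
  next
    case (pCons p P)
    show ?case using add[OF inner[of p] mult[OF \<eta> pCons(2)]]
      by (simp add: on_chart_def subst_pCons ring_morphism_subst[OF ring_morphism_const_fract])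
  qed
  then show ?thesis unfolding S_def by (simp only: mem_Collect_eq case_prod_conv)
qed

end

section \<open>Lowest coefficients\<close>

lemma coeff_mult_lowest:
  fixes A B :: "'a::comm_ring_1 poly"
  assumes A: "\<And>k. k < a \<Longrightarrow> Polynomial.coeff A k = 0" and B: "\<And>k. k < b \<Longrightarrow> Polynomial.coeff B k = 0"
  shows "k < a + b \<Longrightarrow> Polynomial.coeff (A * B) k = 0"
    and "Polynomial.coeff (A * B) (a + b) = Polynomial.coeff A a * Polynomial.coeff B b"
proof -
  have z: "Polynomial.coeff A i * Polynomial.coeff B (k - i) = 0" if "i \<le> k" "k \<le> a + b" "\<not> (k = a + b \<and> i = a)" for i k
    using A[of i] B[of "k - i"] that by (cases "i < a") auto
  show "k < a + b \<Longrightarrow> Polynomial.coeff (A * B) k = 0"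
    unfolding coeff_mult by (intro sum.neutral ballI z) auto
  have "Polynomial.coeff (A * B) (a + b) = (\<Sum>i\<le>a + b. if i = a then Polynomial.coeff A a * Polynomial.coeff B b else 0)"
    unfolding coeff_mult
  proof (intro sum.cong refl)
    fix i assume "i \<in> {..a + b}"
    then show "Polynomial.coeff A i * Polynomial.coeff B (a + b - i) = (if i = a then Polynomial.coeff A a * Polynomial.coeff B b else 0)"
      using z[of i "a + b"] by auto
  qed
  then show "Polynomial.coeff (A * B) (a + b) = Polynomial.coeff A a * Polynomial.coeff B b" by simp
qed

lemma coeff_prod_lowest:
  fixes A :: "'i \<Rightarrow> 'a::comm_ring_1 poly"
  assumes "\<And>i k. i \<in> U \<Longrightarrow> k < a \<Longrightarrow> Polynomial.coeff (A i) k = 0"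
  shows "(\<forall>k < card U * a. Polynomial.coeff (prod A U) k = 0)
     \<and> Polynomial.coeff (prod A U) (card U * a) = (\<Prod>i\<in>U. Polynomial.coeff (A i) a)"
  using assms
proof (induction U rule: infinite_finite_induct)
  case (insert i U)
  then have IH: "\<forall>k < card U * a. Polynomial.coeff (prod A U) k = 0"
     "Polynomial.coeff (prod A U) (card U * a) = (\<Prod>i\<in>U. Polynomial.coeff (A i) a)" by auto
  have c: "card (insert i U) * a = a + card U * a" using insert by simp
  have A1: "Polynomial.coeff (A i) k = 0" if "k < a" for k using insert.prems that by simp
  have P1: "Polynomial.coeff (prod A U) k = 0" if "k < card U * a" for k using IH(1) that by blast
  show ?case
    unfolding c prod.insert[OF insert(1,2)]
    by (intro conjI allI impI coeff_mult_lowest(1)[OF A1 P1]) (simp_all only: coeff_mult_lowest(2)[OF A1 P1] IH(2))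
qed auto

text \<open>
  The order of \<open>P\<close> in the outer variable is at least \<open>n\<close>, and \<open>z\<close> is the value at \<open>c\<close> of the coefficient of
  order \<open>n\<close>. The order may be larger, in which case \<open>z\<close> is 0; this makes the relation additive.
\<close>

definition lowest_value :: "nat \<Rightarrow> complex \<Rightarrow> bipoly \<Rightarrow> complex \<Rightarrow> bool" where
  "lowest_value n c P z \<longleftrightarrow> (\<forall>k<n. Polynomial.coeff P k = 0) \<and> poly (Polynomial.coeff P n) c = z"

lemma lowest_value_mult:
  "lowest_value n c P z \<Longrightarrow> lowest_value k c Q w \<Longrightarrow> lowest_value (n + k) c (P * Q) (z * w)"
  unfolding lowest_value_def
proof (intro conjI allI impI; elim conjE)
  assume "\<forall>i<n. Polynomial.coeff P i = 0" "\<forall>i<k. Polynomial.coeff Q i = 0"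
  then have P: "\<And>i. i < n \<Longrightarrow> Polynomial.coeff P i = 0" and Q: "\<And>i. i < k \<Longrightarrow> Polynomial.coeff Q i = 0" by blast+
  show "Polynomial.coeff (P * Q) i = 0" if "i < n + k" for i by (rule coeff_mult_lowest(1)[OF P Q that])
  show "poly (Polynomial.coeff P n) c = z \<Longrightarrow> poly (Polynomial.coeff Q k) c = w
    \<Longrightarrow> poly (Polynomial.coeff (P * Q) (n + k)) c = z * w"
    by (simp add: coeff_mult_lowest(2)[OF P Q])
qed

lemma lowest_value_diff:
  "lowest_value n c P z \<Longrightarrow> lowest_value n c Q w \<Longrightarrow> lowest_value n c (P - Q) (z - w)"
  by (auto simp: lowest_value_def)

text \<open>
  The lowest coefficient of a multiple of \<open>Q\<close> is a multiple of the lowest coefficient of \<open>Q\<close>, as the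
  coefficients form an integral domain.
\<close>

lemma lowest_value_multiple_root:
  assumes Q: "\<And>k. k < M \<Longrightarrow> Polynomial.coeff Q k = 0" "poly (Polynomial.coeff Q M) c = 0" "Polynomial.coeff Q M \<noteq> 0"
    and dvd: "Q dvd P" and P: "lowest_value n c P z"
  shows "z = 0"
proof -
  obtain B where PB: "P = Q * B" using dvd by (auto simp: dvd_def)
  show ?thesis
  proof (cases "B = 0")
    case True
    then show ?thesis using P PB by (simp add: lowest_value_def)
  next
    case False
    define b where "b = (LEAST k. Polynomial.coeff B k \<noteq> 0)"
    have b1: "Polynomial.coeff B b \<noteq> 0"
      unfolding b_def by (rule LeastI[of _ "Polynomial.degree B"]) (simp add: False)
    have b2: "Polynomial.coeff B k = 0" if "k < b" for k
      using not_less_Least[of k "\<lambda>k. Polynomial.coeff B k \<noteq> 0"] that unfolding b_def by blast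
    have low: "Polynomial.coeff P k = 0" if "k < M + b" for k
      unfolding PB by (rule coeff_mult_lowest(1)[OF Q(1) b2 that])
    have top: "Polynomial.coeff P (M + b) = Polynomial.coeff Q M * Polynomial.coeff B b"
      unfolding PB by (rule coeff_mult_lowest(2)[OF Q(1) b2])
    then have "Polynomial.coeff P (M + b) \<noteq> 0" using b1 Q(3) by simp
    then have "n \<le> M + b" using P unfolding lowest_value_def by (metis not_le)
    then consider "n < M + b" | "n = M + b" by linarith
    then show ?thesis
    proof cases
      case 1
      then show ?thesis using low[of n] P by (simp add: lowest_value_def)
    next
      case 2
      then show ?thesis using top P Q(2) by (simp add: lowest_value_def)
    qed
  qed
qed

section \<open>Weighted initial forms at a unibranch point\<close>

locale unibranch_chart = frame e1 e2 v l1 l2 l3 + unibranch_form F v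
  for e1 e2 v l1 l2 l3 :: "complex ^ 3" and F :: form +
  fixes d :: nat
  assumes hom_F: "homogeneous d F" and d2: "d \<ge> 2"
begin

text \<open>
  Restricted to the line spanned by a vector, \<open>F\<close> becomes a multiple of \<open>s^d\<close>, and a multiple of this has no
  linear term.
\<close>

lemma not_F_dvd_linear:
  assumes "linear_form w \<noteq> 0"
  shows "\<not> F dvd linear_form w"
proof
  assume "F dvd linear_form w"
  then obtain k where k: "linear_form w = F * k" by (auto simp: dvd_def)
  obtain u where u: "dot3 w u \<noteq> 0"
  proof (rule ccontr)
    assume "\<not> thesis"
    then have "dot3 w u = 0" for u using that by blast
    from this[of "axis 1 1"] this[of "axis 2 1"] this[of "axis 3 1"]
    show False using assms by (simp add: linear_form_def axis_def)
  qed
  let ?s = "[:0, 1:] :: complex poly"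
  let ?e = "form_subst (\<lambda>c. [:c:]) (?s * [:u $ 1:]) (?s * [:u $ 2:]) (?s * [:u $ 3:])"
  note m = ring_morphism_form_subst[OF ring_morphism_const, of "?s * [:u $ 1:]" "?s * [:u $ 2:]" "?s * [:u $ 3:]"]
  have "?e (linear_form w) = ?e F * ?e k" unfolding k by (rule ring_morphism_mult[OF m])
  also have "?e F = ?s ^ d * form_subst (\<lambda>c. [:c:]) [:u $ 1:] [:u $ 2:] [:u $ 3:] F"
    by (rule form_subst_homogeneous[OF ring_morphism_const hom_F])
  also have "?s ^ d = Polynomial.monom 1 d" by (simp add: monom_altdef)
  finally have "Polynomial.coeff (?e (linear_form w)) 1 = 0"
    using d2 by (simp add: coeff_monom_mult mult.assoc)
  moreover have "?e (linear_form w) = [:0, dot3 w u:]"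
    by (simp add: form_subst_linear_form ring_morphism_const algebra_simps)
  ultimately show False using u by simp
qed

lemma eta_in_O: "\<eta> \<in> O_v"
  using dual homogeneous_linear_form
  by (auto intro!: form_fractionsI[OF _ _ _ _ denom_v, where e = 1] simp: form_eval_linear_form)

lemma inverse_xi_in_G: "inverse \<xi> \<in> G"
proof -
  have "form_fract (linear_form l3) / form_fract (linear_form l1) \<in> G"
    using not_F_dvd_linear l_nonzero homogeneous_linear_form
    by (auto intro!: form_fractionsI[OF _ _ _ _ denom, where e = 1])
  then show ?thesis by simp
qed

lemma xi_nonzero: "\<xi> \<noteq> 0"
  using l_nonzero by (simp add: form_fract_eq_0)

lemma on_chart_in_O: "on_chart P \<in> O_v"
proof -
  obtain k g where g: "homogeneous k g" "on_chart P = form_fract g / form_fract (linear_form l3 ^ k)"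
    using on_chart_regular by blast
  have "homogeneous k (linear_form l3 ^ k)" using homogeneous_power[OF homogeneous_linear_form, of k l3] by simp
  moreover have "form_eval (linear_form l3 ^ k) v \<noteq> 0"
    using dual by (simp add: ring_morphism_power[OF ring_morphism_form_eval] form_eval_linear_form)
  ultimately show ?thesis unfolding g(2) using g(1) by (intro form_fractionsI[OF _ _ _ _ denom_v]) auto
qed

lemma on_chart_unit:
  assumes "bicoeff P 0 0 \<noteq> 0"
  shows "inverse (on_chart P) \<in> O_v" "on_chart P \<noteq> 0"
proof -
  obtain k g where g: "homogeneous k g" "on_chart P = form_fract g / form_fract (linear_form l3 ^ k)"
    "form_eval g v = bicoeff P 0 0"
    using on_chart_regular by blast
  have "homogeneous k (linear_form l3 ^ k)" using homogeneous_power[OF homogeneous_linear_form, of k l3] by simp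
  moreover have "inverse (on_chart P) = form_fract (linear_form l3 ^ k) / form_fract g" using g(2) by simp
  ultimately show "inverse (on_chart P) \<in> O_v"
    using g assms by (auto intro!: form_fractionsI[OF _ _ _ _ denom_v])
  have "g \<noteq> 0" using g(3) assms by (auto simp: form_eval_def)
  then show "on_chart P \<noteq> 0"
    unfolding g(2) using l_nonzero by (simp add: form_fract_eq_0)
qed

lemma on_chart_F_in_I: "on_chart (chart F) \<in> I"
proof -
  have z: "form_fract (linear_form l3) \<noteq> 0" using l_nonzero by (simp add: form_fract_eq_0)
  have "on_chart (chart F) = form_fract F / form_fract (linear_form l3 ^ d)"
    using form_fract_chart[OF hom_F] z by (simp add: ring_morphism_power[OF ring_morphism_form_fract])
  moreover have "form_eval (linear_form l3 ^ d) v \<noteq> 0"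
    using dual by (simp add: ring_morphism_power[OF ring_morphism_form_eval] form_eval_linear_form)
  then have "\<not> F dvd linear_form l3 ^ d" by (rule not_F_dvd)
  ultimately show ?thesis
    unfolding generic_ideal_def using hom_F homogeneous_power[OF homogeneous_linear_form, of d l3]
    by (auto intro!: form_fractionsI[OF _ _ _ _ denom])
qed

lemma weighted_subst_coeff_0:
  assumes "p > 0" "q > 0"
  shows "Polynomial.coeff (weighted_subst p q P) 0 = [:bicoeff P 0 0:]"
proof (rule poly_eqI)
  fix j
  show "Polynomial.coeff (Polynomial.coeff (weighted_subst p q P) 0) j = Polynomial.coeff [:bicoeff P 0 0:] j"
    unfolding weighted_subst_coeff[OF assms(1)] using assms by (cases j) auto
qed

text \<open>
  The local ring at a point of the exceptional curve of the weighted blow-up: fractions are compared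
  through their lowest terms after the substitution \<open>x = t^p\<close>, \<open>y = z t^q\<close>, evaluated at \<open>z = c\<close>. As \<open>c\<close> is
  a root of the initial form of \<open>F\<close>, multiples of \<open>F\<close> have value 0, so this descends to the curve.
\<close>

lemma weighted_place:
  assumes pq: "p > 0" "q > 0"
    and low: "\<And>k. k < M \<Longrightarrow> Polynomial.coeff (weighted_subst p q (chart F)) k = 0"
    and root: "poly (Polynomial.coeff (weighted_subst p q (chart F)) M) c = 0"
    and nz: "Polynomial.coeff (weighted_subst p q (chart F)) M \<noteq> 0"
  shows "\<exists>\<Gamma>. place_at \<Gamma> \<and> (\<eta> ^ p / \<xi> ^ q, c ^ p) \<in> \<Gamma>"
proof -
  define \<theta> where "\<theta> g = weighted_subst p q (chart g)" for g
  have \<theta>: "ring_morphism \<theta>"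
    unfolding \<theta>_def by (rule ring_morphism_comp[OF ring_morphism_chart ring_morphism_weighted_subst])
  note m = ring_morphism_simps[OF ring_morphism_form_fract]
  have root_value: "z = 0" if "F dvd g" "lowest_value n c (\<theta> g) z" for g n z
    using low nz root by (intro lowest_value_multiple_root[OF _ _ _ ring_morphism_dvd[OF \<theta> that(1)] that(2)]) (simp_all add: \<theta>_def)
  \<comment> \<open>Numerator and denominator are compared at the same order \<open>n\<close>; elements of \<open>I\<close> get the value 0.\<close>
  define \<Gamma> where "\<Gamma> = {(form_fract g / form_fract h + i, z / w) | g h i z w n e.
      homogeneous e g \<and> homogeneous e h \<and> lowest_value n c (\<theta> g) z \<and> lowest_value n c (\<theta> h) w \<and> w \<noteq> 0 \<and> i \<in> I}"
  have in_\<Gamma>: "(form_fract g / form_fract h + i, z / w) \<in> \<Gamma>"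
    if "homogeneous e g" "homogeneous e h" "lowest_value n c (\<theta> g) z" "lowest_value n c (\<theta> h) w" "w \<noteq> 0" "i \<in> I"
    for g h i z w n e
    unfolding \<Gamma>_def using that by blast
  have one: "lowest_value 0 c (\<theta> 1) 1" by (simp add: lowest_value_def ring_morphism_one[OF \<theta>])
  have const: "lowest_value 0 c (\<theta> g) (form_eval g v)" for g
    by (simp add: lowest_value_def \<theta>_def weighted_subst_coeff_0[OF pq] chart_at_origin)
  have pg: "place_graph \<Gamma>"
    unfolding place_graph_def
  proof (intro conjI allI impI)
    show "(1, 1) \<in> \<Gamma>" using in_\<Gamma>[OF homogeneous_1 homogeneous_1 one one _ I_0] by (simp add: m)
  next
    fix a z b w assume "(a, z) \<in> \<Gamma>" "(b, w) \<in> \<Gamma>"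
    then obtain g h i s t n e g' h' i' s' t' n' e' where
      a: "a = form_fract g / form_fract h + i" "z = s / t" "homogeneous e g" "homogeneous e h"
      "lowest_value n c (\<theta> g) s" "lowest_value n c (\<theta> h) t" "t \<noteq> 0" "i \<in> I" and
      b: "b = form_fract g' / form_fract h' + i'" "w = s' / t'" "homogeneous e' g'" "homogeneous e' h'"
      "lowest_value n' c (\<theta> g') s'" "lowest_value n' c (\<theta> h') t'" "t' \<noteq> 0" "i' \<in> I"
      unfolding \<Gamma>_def by (elim CollectE exE conjE Pair_inject) blast
    have nd: "\<not> F dvd h" "\<not> F dvd h'" using root_value a b by blast+
    then have h0: "form_fract h \<noteq> 0" "form_fract h' \<noteq> 0" by (auto simp: form_fract_eq_0)
    have hh: "homogeneous (e + e') (h * h')" "lowest_value (n + n') c (\<theta> (h * h')) (t * t')" "t * t' \<noteq> 0"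
      using homogeneous_mult[OF a(4) b(4)] lowest_value_mult[OF a(6) b(6)] a b by (simp_all add: ring_morphism_mult[OF \<theta>])
    have "homogeneous (e + e') (g * h' - g' * h)"
      using homogeneous_add[OF homogeneous_mult[OF a(3) b(4)] homogeneous_uminus, of "g' * h"]
        homogeneous_mult[OF b(3) a(4)] by (simp add: add.commute)
    moreover have "lowest_value (n + n') c (\<theta> (g * h' - g' * h)) (s * t' - s' * t)"
      using lowest_value_diff[OF lowest_value_mult[OF a(5) b(6)], of "\<theta> g' * \<theta> h" "s' * t"] lowest_value_mult[OF b(5) a(6)]
      by (simp add: ring_morphism_simps[OF \<theta>] add.commute)
    ultimately have "(form_fract (g * h' - g' * h) / form_fract (h * h') + (i - i'), (s * t' - s' * t) / (t * t')) \<in> \<Gamma>"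
      using hh a b I_diff by (intro in_\<Gamma>) auto
    moreover have "form_fract (g * h' - g' * h) / form_fract (h * h') + (i - i') = a - b"
      unfolding a b using h0 by (simp add: m diff_frac_eq)
    moreover have "(s * t' - s' * t) / (t * t') = z - w" unfolding a b using a(7) b(7) by (simp add: diff_frac_eq)
    ultimately show "(a - b, z - w) \<in> \<Gamma>" by simp
    have G: "form_fract g / form_fract h \<in> G" "form_fract g' / form_fract h' \<in> G"
      using a b nd by (auto intro!: form_fractionsI[OF _ _ _ _ denom])
    have "(form_fract g / form_fract h) * i' + i * (form_fract g' / form_fract h' + i') \<in> I"
      using G a b I_subset_G by (intro I_add I_mult I_multL G_add) auto
    moreover have "homogeneous (e + e') (g * g')" "lowest_value (n + n') c (\<theta> (g * g')) (s * s')"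
      using homogeneous_mult[OF a(3) b(3)] lowest_value_mult[OF a(5) b(5)] by (simp_all add: ring_morphism_mult[OF \<theta>])
    ultimately have "(form_fract (g * g') / form_fract (h * h') + ((form_fract g / form_fract h) * i' + i * (form_fract g' / form_fract h' + i')),
        (s * s') / (t * t')) \<in> \<Gamma>"
      using hh by (intro in_\<Gamma>) auto
    moreover have "form_fract (g * g') / form_fract (h * h') + ((form_fract g / form_fract h) * i' + i * (form_fract g' / form_fract h' + i')) = a * b"
      unfolding a b by (simp add: m algebra_simps)
    ultimately show "(a * b, z * w) \<in> \<Gamma>" unfolding a(2) b(2) by simp
  next
    fix z assume "(0, z) \<in> \<Gamma>"
    then obtain g h i s t n e where
      a: "0 = form_fract g / form_fract h + i" "z = s / t" "homogeneous e g" "homogeneous e h"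
      "lowest_value n c (\<theta> g) s" "lowest_value n c (\<theta> h) t" "t \<noteq> 0" "i \<in> I"
      unfolding \<Gamma>_def by (elim CollectE exE conjE Pair_inject) blast
    obtain g' h' e' where i: "F dvd g'" "\<not> F dvd h'" "h' \<noteq> 0" "i = form_fract g' / form_fract h'"
      using a(8) denom unfolding generic_ideal_def by (auto elim: form_fractionsE)
    have "\<not> F dvd h" using root_value a by blast
    then have "form_fract h \<noteq> 0" by (auto simp: form_fract_eq_0)
    moreover have "form_fract h' \<noteq> 0" using i by (simp add: form_fract_eq_0)
    ultimately have "form_fract g * form_fract h' + form_fract g' * form_fract h = 0"
      using a(1) unfolding i(4) by (simp add: add_frac_eq)
    then have "form_fract (g * h' + g' * h) = 0" by (simp add: m)
    then have "g * h' = - (g' * h)" by (simp add: form_fract_eq_0 eq_neg_iff_add_eq_0)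
    then have "F dvd g * h'" using i(1) by (metis dvd_minus_iff dvd_mult2)
    then have "F dvd g" using i(2) prime_elem_dvd_mult_iff[OF prime_F] by blast
    then have "s = 0" using root_value a(5) by blast
    then show "z = 0" using a(2) by simp
  qed
  have O: "(form_fract g / form_fract h, form_eval g v / form_eval h v) \<in> \<Gamma>"
    if "homogeneous e g" "homogeneous e h" "form_eval h v \<noteq> 0" for g h e
    using in_\<Gamma>[OF that(1,2) const const that(3) I_0] by simp
  have onto: "\<exists>a. (a, z) \<in> \<Gamma>" for z
    using O[OF homogeneous_const[of z] homogeneous_1]
    by (auto simp: ring_morphism_one[OF ring_morphism_form_eval] form_eval_const)
  have "lowest_value (p * q) c (\<theta> (linear_form l2 ^ p * linear_form l3 ^ q)) (c ^ p)"
  proof -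
    have "\<theta> (linear_form l2 ^ p * linear_form l3 ^ q) = weighted_subst p q (bimonom 1 0 p)"
      unfolding \<theta>_def by (simp add: ring_morphism_simps[OF ring_morphism_chart] chart_dual monom_altdef pCons_one)
    then show ?thesis unfolding weighted_subst_bimonom by (simp add: lowest_value_def poly_monom mult.commute)
  qed
  moreover have "lowest_value (p * q) c (\<theta> (linear_form l1 ^ q * linear_form l3 ^ p)) 1"
  proof -
    have "\<theta> (linear_form l1 ^ q * linear_form l3 ^ p) = weighted_subst p q (bimonom 1 q 0)"
      unfolding \<theta>_def by (simp add: ring_morphism_simps[OF ring_morphism_chart] chart_dual monom_altdef poly_const_pow)
    then show ?thesis unfolding weighted_subst_bimonom by (simp add: lowest_value_def poly_monom mult.commute)
  qed
  moreover have "homogeneous (p + q) (linear_form l2 ^ p * linear_form l3 ^ q)" "homogeneous (p + q) (linear_form l1 ^ q * linear_form l3 ^ p)"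
    using homogeneous_mult[OF homogeneous_power[OF homogeneous_linear_form] homogeneous_power[OF homogeneous_linear_form]]
    by (metis mult_1 , metis mult_1 add.commute)
  ultimately have "(form_fract (linear_form l2 ^ p * linear_form l3 ^ q) / form_fract (linear_form l1 ^ q * linear_form l3 ^ p) + 0, c ^ p / 1) \<in> \<Gamma>"
    using I_0 by (intro in_\<Gamma>) auto
  moreover have "form_fract (linear_form l2 ^ p * linear_form l3 ^ q) / form_fract (linear_form l1 ^ q * linear_form l3 ^ p) = \<eta> ^ p / \<xi> ^ q"
    using l_nonzero by (simp add: m power_divide)
  ultimately have u: "(\<eta> ^ p / \<xi> ^ q, c ^ p) \<in> \<Gamma>" by simp
  have I: "(i, 0) \<in> \<Gamma>" if "i \<in> I" for i
  proof -
    have "lowest_value 0 c (\<theta> 0) 0" by (simp add: lowest_value_def ring_morphism_zero[OF \<theta>])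
    from in_\<Gamma>[OF homogeneous_0 homogeneous_1 this one _ that] show ?thesis by (simp add: m)
  qed
  obtain \<Gamma>' where "maximal_place \<Gamma>'" "\<Gamma> \<subseteq> \<Gamma>'" using maximal_place_exists[OF pg onto] by blast
  then have "place_at \<Gamma>'" "(\<eta> ^ p / \<xi> ^ q, c ^ p) \<in> \<Gamma>'" unfolding place_at_def using I O u by blast+
  then show ?thesis by blast
qed

end

section \<open>The norm to the ring in x and y^p\<close>

definition roots_unity :: "nat \<Rightarrow> complex set" where
  "roots_unity p = {z. z ^ p = 1}"

lemma roots_unity_nontrivial:
  assumes "p > 0" "\<not> p dvd j"
  shows "\<exists>\<omega>\<in>roots_unity p. \<omega> ^ j \<noteq> 1"
proof -
  have bij: "bij_betw (\<lambda>k. cis (2 * pi * real k / real p)) {..<p} {z. z ^ p = 1}"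
    using Complex.bij_betw_roots_unity[OF assms(1)] .
  define \<omega> where "\<omega> = cis (2 * pi * real 1 / real p)"
  have pow: "\<omega> ^ k = cis (2 * pi * real k / real p)" for k
    unfolding \<omega>_def by (simp add: Complex.DeMoivre algebra_simps)
  have "\<omega> ^ p = 1" unfolding pow using assms(1) by simp
  then have "\<omega> ^ j = \<omega> ^ (j mod p)"
    by (metis div_mult_mod_eq mult.commute mult_1 power_add power_mult power_one)
  moreover have "\<omega> ^ (j mod p) \<noteq> 1"
  proof
    assume "\<omega> ^ (j mod p) = 1"
    then have "cis (2 * pi * real (j mod p) / real p) = cis (2 * pi * real 0 / real p)" unfolding pow by simp
    then have "j mod p = 0"
      using inj_onD[OF bij_betw_imp_inj_on[OF bij], of "j mod p" 0] assms(1) by simp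
    then show False using assms(2) by auto
  qed
  ultimately show ?thesis using \<open>\<omega> ^ p = 1\<close> unfolding roots_unity_def by force
qed

text \<open>
  The substitution \<open>y \<mapsto> \<zeta> y\<close>.
\<close>

definition twist :: "complex \<Rightarrow> bipoly \<Rightarrow> bipoly" where
  "twist \<zeta> P = pcompose P [:0, [:\<zeta>:]:]"

lemma coeff_twist: "Polynomial.coeff (twist \<zeta> P) j = Polynomial.smult (\<zeta> ^ j) (Polynomial.coeff P j)"
  unfolding twist_def coeff_pcompose_linear by (simp add: poly_const_pow)

lemma twist_prod: "twist \<zeta> (prod P A) = (\<Prod>i\<in>A. twist \<zeta> (P i))"
  unfolding twist_def by (rule pcompose_prod)

lemma twist_twist: "twist \<zeta> (twist \<omega> P) = twist (\<zeta> * \<omega>) P"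
  by (rule poly_eqI) (simp add: coeff_twist power_mult_distrib)

lemma twist_1: "twist 1 P = P"
  by (rule poly_eqI) (simp add: coeff_twist)

text \<open>
  The norm of \<open>P\<close> over the polynomials in \<open>x\<close> and \<open>y^p\<close>. It is a multiple of \<open>P\<close>, and its least weight is
  \<open>p\<close> times that of \<open>P\<close>.
\<close>

definition cyclic_norm :: "nat \<Rightarrow> bipoly \<Rightarrow> bipoly" where
  "cyclic_norm p P = (\<Prod>\<zeta>\<in>roots_unity p. twist \<zeta> P)"

context
  fixes p :: nat assumes p: "p > 0"
begin

lemma finite_roots_unity: "finite (roots_unity p)" and card_roots_unity: "card (roots_unity p) = p"
  using finite_roots_unity[of p] card_roots_unity_eq[of p] p by (simp_all add: roots_unity_def)

lemma dvd_cyclic_norm: "P dvd cyclic_norm p P"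
  unfolding cyclic_norm_def using dvd_prodI[OF finite_roots_unity, of 1 "\<lambda>\<zeta>. twist \<zeta> P"]
  by (simp add: twist_1 roots_unity_def)

text \<open>
  The norm is invariant under \<open>y \<mapsto> \<omega> y\<close> for every \<open>p\<close>-th root of unity \<open>\<omega>\<close>.
\<close>

lemma cyclic_norm_coeff:
  assumes "\<not> p dvd j"
  shows "Polynomial.coeff (cyclic_norm p P) j = 0"
proof -
  obtain \<omega> where \<omega>: "\<omega> \<in> roots_unity p" "\<omega> ^ j \<noteq> 1" using roots_unity_nontrivial[OF p assms] by blast
  then have "\<omega> ^ p = 1" by (simp add: roots_unity_def)
  then have \<omega>0: "\<omega> \<noteq> 0" using p by (auto simp: zero_power)
  have "bij_betw (\<lambda>\<zeta>. \<omega> * \<zeta>) (roots_unity p) (roots_unity p)"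
  proof (rule bij_betwI[of _ _ _ "\<lambda>\<zeta>. \<zeta> / \<omega>"])
    show "(\<lambda>\<zeta>. \<omega> * \<zeta>) \<in> roots_unity p \<rightarrow> roots_unity p" "(\<lambda>\<zeta>. \<zeta> / \<omega>) \<in> roots_unity p \<rightarrow> roots_unity p"
      using \<open>\<omega> ^ p = 1\<close> by (auto simp: roots_unity_def power_mult_distrib power_divide)
  qed (use \<omega>0 in auto)
  then have "(\<Prod>\<zeta>\<in>roots_unity p. twist (\<omega> * \<zeta>) P) = cyclic_norm p P"
    unfolding cyclic_norm_def by (rule prod.reindex_bij_betw)
  then have "twist \<omega> (cyclic_norm p P) = cyclic_norm p P"
    by (simp add: cyclic_norm_def twist_prod twist_twist)
  then have "Polynomial.smult (\<omega> ^ j) (Polynomial.coeff (cyclic_norm p P) j) = Polynomial.coeff (cyclic_norm p P) j"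
    using coeff_twist[of \<omega> "cyclic_norm p P" j] by simp
  then have "Polynomial.smult (\<omega> ^ j - 1) (Polynomial.coeff (cyclic_norm p P) j) = 0"
    by (simp add: smult_diff_left)
  then show ?thesis using \<omega>(2) by simp
qed

definition weight_ge :: "nat \<Rightarrow> nat \<Rightarrow> bipoly \<Rightarrow> bool" where
  "weight_ge q w P \<longleftrightarrow> (\<forall>i j. bicoeff P i j \<noteq> 0 \<longrightarrow> w \<le> p * i + q * j)"

lemma weight_ge_mult:
  assumes "weight_ge q a P" "weight_ge q b Q"
  shows "weight_ge q (a + b) (P * Q)"
  unfolding weight_ge_def
proof (intro allI impI)
  fix i j assume "bicoeff (P * Q) i j \<noteq> 0"
  then obtain j' where j': "j' \<le> j" "Polynomial.coeff (Polynomial.coeff P j' * Polynomial.coeff Q (j - j')) i \<noteq> 0"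
    unfolding coeff_mult[of P] coeff_sum by (auto elim!: sum.not_neutral_contains_not_neutral)
  then obtain i' where i': "i' \<le> i" "bicoeff P i' j' * bicoeff Q (i - i') (j - j') \<noteq> 0"
    unfolding coeff_mult[of "Polynomial.coeff P j'"] by (auto elim!: sum.not_neutral_contains_not_neutral)
  then have "a \<le> p * i' + q * j'" "b \<le> p * (i - i') + q * (j - j')"
    using assms unfolding weight_ge_def by auto
  moreover have "p * i = p * i' + p * (i - i')" "q * j = q * j' + q * (j - j')"
    using i' j' by (simp_all flip: add_mult_distrib2)
  ultimately show "a + b \<le> p * i + q * j" by linarith
qed

lemma weight_ge_prod:
  assumes "\<And>x. x \<in> A \<Longrightarrow> weight_ge q w (P x)"
  shows "weight_ge q (card A * w) (prod P A)"
  using assms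
proof (induction A rule: infinite_finite_induct)
  case (insert x A)
  then show ?case using weight_ge_mult[of q w "P x" "card A * w" "prod P A"] by simp
qed (auto simp: weight_ge_def)

lemma cyclic_norm_weight:
  assumes "weight_ge q w P"
  shows "weight_ge q (p * w) (cyclic_norm p P)"
proof -
  have "weight_ge q w (twist \<zeta> P)" for \<zeta>
    using assms unfolding weight_ge_def by (simp add: coeff_twist)
  then show ?thesis
    unfolding cyclic_norm_def using weight_ge_prod[of "roots_unity p" q w "\<lambda>\<zeta>. twist \<zeta> P"] card_roots_unity by simp
qed

lemma cyclic_norm_lowest:
  assumes q: "q > 0" and w: "weight_ge q (q * m) P" and m: "bicoeff P 0 m \<noteq> 0"
  shows "bicoeff (cyclic_norm p P) 0 (p * m) \<noteq> 0"
proof -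
  have low: "Polynomial.coeff (at_line 0 (twist \<zeta> P)) k = 0" if "k < m" for \<zeta> k
  proof -
    have "bicoeff P 0 k = 0"
    proof (rule ccontr)
      assume "bicoeff P 0 k \<noteq> 0"
      then have "q * m \<le> q * k" using w unfolding weight_ge_def by fastforce
      then show False using q that by simp
    qed
    then show ?thesis by (simp add: coeff_at_line coeff_twist poly_0_coeff_0)
  qed
  have "at_line 0 (prod f A) = (\<Prod>x\<in>A. at_line 0 (f x))" for f :: "complex \<Rightarrow> bipoly" and A
    by (induction A rule: infinite_finite_induct) (simp_all add: at_line_one at_line_mult)
  then have "at_line 0 (cyclic_norm p P) = (\<Prod>\<zeta>\<in>roots_unity p. at_line 0 (twist \<zeta> P))"
    unfolding cyclic_norm_def by blast
  then have "Polynomial.coeff (at_line 0 (cyclic_norm p P)) (p * m)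
      = (\<Prod>\<zeta>\<in>roots_unity p. Polynomial.coeff (at_line 0 (twist \<zeta> P)) m)"
    using coeff_prod_lowest[of "roots_unity p" m "\<lambda>\<zeta>. at_line 0 (twist \<zeta> P)"] low card_roots_unity by simp
  also have "\<dots> = (\<Prod>\<zeta>\<in>roots_unity p. \<zeta> ^ m * bicoeff P 0 m)"
    by (simp add: coeff_at_line coeff_twist poly_0_coeff_0)
  also have "\<dots> \<noteq> 0"
    using m p finite_roots_unity by (auto simp: roots_unity_def zero_power)
  finally show ?thesis by (simp add: coeff_at_line poly_0_coeff_0)
qed

end

context unibranch_chart
begin

text \<open>
  Dividing the norm of the equation by \<open>x^(q m)\<close> gives a relation for \<open>u = y^p / x^q\<close>. Its
  coefficients are regular by the weight condition, and the one of \<open>u^m\<close>, which collects all terms divisible by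
  \<open>y^(p m)\<close>, is a unit because \<open>y^m\<close> occurs in the equation.
\<close>

lemma slope_integral:
  assumes pq: "p > 0" "q > 0"
    and w: "\<And>i j. bicoeff (chart F) i j \<noteq> 0 \<Longrightarrow> q * m \<le> p * i + q * j"
    and m: "bicoeff (chart F) 0 m \<noteq> 0"
  shows "\<eta> ^ p / \<xi> ^ q \<in> G" "res (\<eta> ^ p / \<xi> ^ q) \<in> A_norm"
proof -
  define u where "u = \<eta> ^ p / \<xi> ^ q"
  define n where "n = cyclic_norm p (chart F)"
  have OG: "x \<in> G" if "x \<in> O_v" for x using that O_subset_G by blast
  have uG: "u \<in> G"
  proof -
    have "u = \<eta> ^ p * inverse \<xi> ^ q" by (simp only: u_def power_inverse divide_inverse[of "\<eta> ^ p" "\<xi> ^ q"])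
    then show ?thesis using G_mult[OF G_power[OF OG[OF eta_in_O]] G_power[OF inverse_xi_in_G]] by metis
  qed
  have x0: "\<xi> ^ k \<noteq> 0" for k using xi_nonzero by simp
  have eta_u: "\<eta> ^ (p * b) = \<xi> ^ (q * b) * u ^ b" for b
  proof -
    have "E ^ (p * b) = Q ^ (q * b) * (E ^ p / Q ^ q) ^ b" if "Q \<noteq> 0" for E Q :: "form fract"
      using that by (simp add: power_mult power_divide)
    then show ?thesis unfolding u_def using xi_nonzero by blast
  qed
  have w': "weight_ge p q (q * m) (chart F)" unfolding weight_ge_def[OF pq(1)] using w by blast
  have n_weight: "p * (q * m) \<le> p * i + q * j" if "bicoeff n i j \<noteq> 0" for i j
    using cyclic_norm_weight[OF pq(1) w'] that unfolding weight_ge_def[OF pq(1)] n_def by blast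
  have n_low: "bicoeff n 0 (p * m) \<noteq> 0" unfolding n_def by (rule cyclic_norm_lowest[OF pq w' m])
  have nI: "on_chart n \<in> I"
  proof -
    obtain k where "n = chart F * k" using dvd_cyclic_norm[OF pq(1), of "chart F"] unfolding n_def by (auto simp: dvd_def)
    then show ?thesis
      using I_mult[OF on_chart_F_in_I OG[OF on_chart_in_O, of k]] by (simp add: ring_morphism_mult[OF ring_morphism_on_chart])
  qed
  \<comment> \<open>The norm is split into its terms below \<open>y^(p m)\<close> and \<open>y^(p m) T\<close>.\<close>
  define T where "T = poly_shift (p * m) n"
  have T0: "bicoeff T 0 0 \<noteq> 0" using n_low by (simp add: T_def coeff_poly_shift)
  \<comment> \<open>The coefficient of \<open>y^(p b)\<close> in the norm is divisible by \<open>x^(q (m - b))\<close>.\<close>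
  define M where "M b = poly_shift (q * (m - b)) (Polynomial.coeff n (p * b))" for b
  have coeff_M: "Polynomial.coeff n (p * b) = Polynomial.monom 1 (q * (m - b)) * M b" if "b < m" for b
  proof (rule poly_eqI)
    fix i
    have "bicoeff n i (p * b) = 0" if "i < q * (m - b)"
    proof (rule ccontr)
      assume "bicoeff n i (p * b) \<noteq> 0"
      then have "p * (q * m) \<le> p * i + q * (p * b)" by (rule n_weight)
      also have "\<dots> = p * (i + q * b)" by (simp add: algebra_simps)
      finally have "q * m \<le> i + q * b" using pq by simp
      moreover have "q * m = q * (m - b) + q * b" using \<open>b < m\<close> by (simp flip: add_mult_distrib2)
      ultimately show False using that by linarith
    qed
    then show "bicoeff n i (p * b) = Polynomial.coeff (Polynomial.monom 1 (q * (m - b)) * M b) i"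
      by (simp add: coeff_monom_mult M_def coeff_poly_shift)
  qed
  have split: "n = (\<Sum>b<m. Polynomial.monom (Polynomial.coeff n (p * b)) (p * b)) + Polynomial.monom 1 (p * m) * T"
  proof (rule poly_eqI)
    fix j
    have "Polynomial.coeff (\<Sum>b<m. Polynomial.monom (Polynomial.coeff n (p * b)) (p * b)) j
        = (\<Sum>b<m. if p * b = j then Polynomial.coeff n j else 0)"
      unfolding coeff_sum by (intro sum.cong refl) auto
    also have "\<dots> = (if j < p * m then Polynomial.coeff n j else 0)"
    proof (cases "p dvd j")
      case True
      then obtain b where b: "j = p * b" by (auto simp: dvd_def)
      have "(p * b' = j) = (b' = b)" for b' using b pq by auto
      then show ?thesis using b pq by simp
    next
      case False
      then have "p * b \<noteq> j" for b by auto
      then show ?thesis using cyclic_norm_coeff[OF pq(1) False, of "chart F"] by (simp add: n_def)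
    qed
    finally have 1: "Polynomial.coeff (\<Sum>b<m. Polynomial.monom (Polynomial.coeff n (p * b)) (p * b)) j = \<dots>" .
    have 2: "Polynomial.coeff (Polynomial.monom 1 (p * m) * T) j = (if p * m \<le> j then Polynomial.coeff n j else 0)"
      unfolding coeff_monom_mult T_def coeff_poly_shift by auto
    show "Polynomial.coeff n j = Polynomial.coeff ((\<Sum>b<m. Polynomial.monom (Polynomial.coeff n (p * b)) (p * b)) + Polynomial.monom 1 (p * m) * T) j"
      unfolding coeff_add 1 2 by auto
  qed
  note oc = ring_morphism_simps[OF ring_morphism_on_chart]
  have oc_monom: "on_chart (Polynomial.monom P j) = on_chart [:P:] * \<eta> ^ j" for P j
    unfolding on_chart_def by (simp add: subst_monom subst_const ring_morphism_subst[OF ring_morphism_const_fract])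
  have oc_x: "on_chart [:Polynomial.monom 1 i * P:] = \<xi> ^ i * on_chart [:P:]" for i P
    unfolding on_chart_def
    by (simp add: subst_monom subst_const subst_mult ring_morphism_subst[OF ring_morphism_const_fract]
        ring_morphism_const_fract ring_morphism_one[OF ring_morphism_const_fract])
  have summand: "on_chart (Polynomial.monom (Polynomial.coeff n (p * b)) (p * b)) = \<xi> ^ (q * m) * (on_chart [:M b:] * u ^ b)" if "b < m" for b
  proof -
    have "q * m = q * (m - b) + q * b" using that by (simp flip: add_mult_distrib2)
    then show ?thesis unfolding oc_monom coeff_M[OF that] oc_x eta_u by (simp add: power_add mult_ac)
  qed
  have "on_chart n = (\<Sum>b<m. \<xi> ^ (q * m) * (on_chart [:M b:] * u ^ b)) + \<xi> ^ (q * m) * (on_chart T * u ^ m)"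
  proof -
    have "on_chart n = (\<Sum>b<m. on_chart (Polynomial.monom (Polynomial.coeff n (p * b)) (p * b))) + on_chart (Polynomial.monom 1 (p * m)) * on_chart T"
      by (subst split) (simp only: oc)
    moreover have "on_chart (Polynomial.monom 1 (p * m)) = \<xi> ^ (q * m) * u ^ m"
      unfolding oc_monom eta_u by (simp add: oc pCons_one)
    ultimately show ?thesis using summand by (simp add: mult_ac)
  qed
  then have n_eq: "on_chart n = \<xi> ^ (q * m) * ((\<Sum>b<m. on_chart [:M b:] * u ^ b) + on_chart T * u ^ m)"
    by (simp only: sum_distrib_left distrib_left)
  have cancel: "inverse \<xi> ^ (q * m) * (\<xi> ^ (q * m) * S) = S" for S
    using x0[of "q * m"] by (simp only: power_inverse mult.assoc[symmetric] left_inverse mult_1 not_False_eq_True)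
  have rel: "(\<Sum>b<m. on_chart [:M b:] * u ^ b) + on_chart T * u ^ m = inverse \<xi> ^ (q * m) * on_chart n"
    unfolding n_eq by (rule cancel[symmetric])
  have relI: "(\<Sum>b<m. on_chart [:M b:] * u ^ b) + on_chart T * u ^ m \<in> I"
    unfolding rel by (rule I_multL[OF G_power[OF inverse_xi_in_G] nI])
  let ?t = "inverse (on_chart T)"
  have t: "?t \<in> O_v" "on_chart T \<noteq> 0" using on_chart_unit[OF T0] by blast+
  define h where "h = (\<Sum>b<m. Polynomial.monom (?t * on_chart [:M b:]) b) + Polynomial.monom 1 m"
  have coeff_h: "Polynomial.coeff h k = (if k < m then ?t * on_chart [:M k:] else if k = m then 1 else 0)" for k
    by (auto simp: h_def coeff_sum)
  have "poly h u = ?t * ((\<Sum>b<m. on_chart [:M b:] * u ^ b) + on_chart T * u ^ m)"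
    using t(2) by (simp add: h_def poly_sum poly_monom sum_distrib_left distrib_left mult_ac)
  then have hI: "poly h u \<in> I" using I_multL[OF OG[OF t(1)] relI] by (simp only:)
  have deg: "Polynomial.degree h = m"
  proof (rule antisym)
    show "Polynomial.degree h \<le> m" by (rule degree_le) (simp add: coeff_h)
    show "m \<le> Polynomial.degree h" by (rule le_degree) (simp add: coeff_h)
  qed
  have "res u \<in> A_norm"
  proof (rule integral_closureI[OF uG O_subset_G _ _ hI])
    show "Polynomial.coeff h k \<in> O_v" for k
      unfolding coeff_h using O_mult[OF t(1) on_chart_in_O] O_1 O_0 by simp
    show "Polynomial.lead_coeff h = 1" unfolding deg by (simp add: coeff_h)
  qed
  then show "\<eta> ^ p / \<xi> ^ q \<in> G" "res (\<eta> ^ p / \<xi> ^ q) \<in> A_norm" using uG by (simp_all add: u_def)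
qed

text \<open>
  Each root of the initial form gives a place with value \<open>c^p\<close> on the integral element \<open>y^p / x^q\<close>, and
  at a unibranch point all places agree on integral elements.
\<close>

theorem initial_form_roots:
  assumes pq: "p > 0" "q > 0"
    and w: "\<And>i j. bicoeff (chart F) i j \<noteq> 0 \<Longrightarrow> q * m \<le> p * i + q * j"
    and m: "bicoeff (chart F) 0 m \<noteq> 0"
    and c: "poly (Polynomial.coeff (weighted_subst p q (chart F)) (q * m)) c\<^sub>1 = 0"
      "poly (Polynomial.coeff (weighted_subst p q (chart F)) (q * m)) c\<^sub>2 = 0"
  shows "c\<^sub>1 ^ p = c\<^sub>2 ^ p"
proof -
  have low: "Polynomial.coeff (weighted_subst p q (chart F)) k = 0" if "k < q * m" for k
  proof (rule poly_eqI)
    fix j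
    show "Polynomial.coeff (Polynomial.coeff (weighted_subst p q (chart F)) k) j = Polynomial.coeff 0 j"
    proof (cases "q * j \<le> k \<and> p dvd k - q * j")
      case True
      then have "p * ((k - q * j) div p) + q * j = k" by simp
      then have "bicoeff (chart F) ((k - q * j) div p) j = 0" using w that by (metis not_le)
      then show ?thesis unfolding weighted_subst_coeff[OF pq(1)] by simp
    next
      case False
      then show ?thesis unfolding weighted_subst_coeff[OF pq(1)] by (subst if_not_P) simp_all
    qed
  qed
  have "Polynomial.coeff (Polynomial.coeff (weighted_subst p q (chart F)) (q * m)) m \<noteq> 0"
    unfolding weighted_subst_coeff[OF pq(1)] using m by simp
  then have nz: "Polynomial.coeff (weighted_subst p q (chart F)) (q * m) \<noteq> 0" by auto
  obtain \<Gamma>1 where g1: "place_at \<Gamma>1" "(\<eta> ^ p / \<xi> ^ q, c\<^sub>1 ^ p) \<in> \<Gamma>1" using weighted_place[OF pq low c(1) nz] by blast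
  obtain \<Gamma>2 where g2: "place_at \<Gamma>2" "(\<eta> ^ p / \<xi> ^ q, c\<^sub>2 ^ p) \<in> \<Gamma>2" using weighted_place[OF pq low c(2) nz] by blast
  show ?thesis by (rule place_value_unique[OF g1(1) g2(1) slope_integral[OF pq w m] g1(2) g2(2)])
qed

end

section \<open>Intersection multiplicity with a line\<close>

lemma fraction_ring_ideal:
  assumes D: "denominators D" and sub: "J \<subseteq> form_fractions UNIV D" and zero: "0 \<in> J"
    and add: "\<And>x y. x \<in> J \<Longrightarrow> y \<in> J \<Longrightarrow> x + y \<in> J"
    and mult: "\<And>x y. x \<in> J \<Longrightarrow> y \<in> form_fractions UNIV D \<Longrightarrow> x * y \<in> J"
  shows "ideal J (fraction_ring (form_fractions UNIV D))"
proof -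
  let ?S = "form_fractions UNIV D"
  interpret R: cring "fraction_ring ?S" by (rule fraction_ring_cring[OF D])
  have m1: "- 1 \<in> ?S" using form_fractions_uminus[OF D UNIV_I form_fractions_1[OF D]] .
  have uminus: "- x \<in> J" if "x \<in> J" for x using mult[OF that m1] by simp
  show ?thesis
  proof (rule idealI)
    show "ring (fraction_ring ?S)" by (rule R.ring_axioms)
    show "subgroup J (add_monoid (fraction_ring ?S))"
    proof (rule R.add.subgroupI)
      show "J \<subseteq> carrier (fraction_ring ?S)" using sub by (simp add: ring_of_type_algebra_simps)
      show "J \<noteq> {}" using zero by blast
    next
      fix a assume a: "a \<in> J"
      have "\<ominus>\<^bsub>fraction_ring ?S\<^esub> a = - a"
        using a sub uminus[OF a] by (intro R.minus_equality) (auto simp: ring_of_type_algebra_simps)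
      then show "\<ominus>\<^bsub>fraction_ring ?S\<^esub> a \<in> J" using uminus[OF a] by simp
    next
      fix a b assume "a \<in> J" "b \<in> J"
      then show "a \<oplus>\<^bsub>fraction_ring ?S\<^esub> b \<in> J" using add by (simp add: ring_of_type_algebra_simps)
    qed
  next
    fix a x assume "a \<in> J" "x \<in> carrier (fraction_ring ?S)"
    then show "x \<otimes>\<^bsub>fraction_ring ?S\<^esub> a \<in> J" "a \<otimes>\<^bsub>fraction_ring ?S\<^esub> x \<in> J"
      using mult[of a x] by (simp_all add: ring_of_type_algebra_simps mult.commute)
  qed
qed

lemma fraction_coset: "J +>\<^bsub>fraction_ring S\<^esub> x = {j + x | j. j \<in> J}"
  unfolding a_r_coset_def' by (auto simp: ring_of_type_algebra_simps)

context frame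
begin

text \<open>
  Restriction to the axis \<open>y = 0\<close>, the line through the point in the direction \<open>e1\<close>.
\<close>

definition line :: "form \<Rightarrow> complex poly" where
  "line g = Polynomial.coeff (chart g) 0"

lemma ring_morphism_line: "ring_morphism line"
  unfolding line_def poly_0_coeff_0[symmetric] by (rule ring_morphism_comp[OF ring_morphism_chart ring_morphism_poly])

lemmas line_simps = ring_morphism_simps[OF ring_morphism_line]

lemma line_linear: "line (linear_form l1) = [:0, 1:]" "line (linear_form l2) = 0" "line (linear_form l3) = 1"
  by (simp_all add: line_def chart_dual)

lemma line_const: "line (form_const c) = [:c:]"
  by (simp add: line_def chart_const)

lemma line_at_origin: "poly (line g) 0 = form_eval g v"
  by (simp add: line_def poly_0_coeff_0 chart_at_origin)

lemma coprime_monom_line: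
  assumes "form_eval h v \<noteq> 0"
  shows "coprime (Polynomial.monom 1 k) (line h)"
proof (rule no_common_root_bezout)
  fix b assume "poly (Polynomial.monom 1 k) b = 0" "poly (line h) b = 0"
  then show False using assms line_at_origin[of h] by (auto simp: poly_monom)
qed

abbreviation "R_v \<equiv> form_fractions UNIV {h. form_eval h v \<noteq> 0}"

text \<open>
  The functions whose restriction to the axis \<open>y = 0\<close> vanishes to order at least \<open>k\<close> at the point.
\<close>

definition order_ideal :: "nat \<Rightarrow> form fract set" where
  "order_ideal k = form_fractions {g. Polynomial.monom 1 k dvd line g} {h. form_eval h v \<noteq> 0}"

lemma order_ideal_subset: "order_ideal k \<subseteq> R_v"
  unfolding order_ideal_def form_fractions_def by blast

lemma order_ideal_0: "0 \<in> order_ideal k"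
  unfolding order_ideal_def by (rule form_fractions_0[OF denominators_eval]) (simp add: line_simps)

lemma order_ideal_add: "x \<in> order_ideal k \<Longrightarrow> y \<in> order_ideal k \<Longrightarrow> x + y \<in> order_ideal k"
  unfolding order_ideal_def by (rule form_fractions_add[OF denominators_eval]) (simp_all add: line_simps)

lemma order_ideal_mult: "x \<in> order_ideal k \<Longrightarrow> y \<in> R_v \<Longrightarrow> x * y \<in> order_ideal k"
  unfolding order_ideal_def by (rule form_fractions_mult[OF denominators_eval]) (simp_all add: line_simps)

lemma order_ideal_uminus: "x \<in> order_ideal k \<Longrightarrow> - x \<in> order_ideal k"
  unfolding order_ideal_def by (rule form_fractions_uminus[OF denominators_eval]) (simp_all add: line_simps)

lemma order_ideal_diff: "x \<in> order_ideal k \<Longrightarrow> y \<in> order_ideal k \<Longrightarrow> x - y \<in> order_ideal k"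
  using order_ideal_add[of x k "- y"] order_ideal_uminus[of y k] by simp

lemma order_ideal_ideal: "ideal (order_ideal k) (local_ring v)"
  unfolding local_ring_def
  by (intro fraction_ring_ideal denominators_eval order_ideal_subset order_ideal_0 order_ideal_add order_ideal_mult)

lemma order_idealI:
  "homogeneous e g \<Longrightarrow> homogeneous e h \<Longrightarrow> form_eval h v \<noteq> 0 \<Longrightarrow> Polynomial.monom 1 k dvd line g
    \<Longrightarrow> form_fract g / form_fract h \<in> order_ideal k"
  unfolding order_ideal_def by (intro form_fractionsI denominators_eval) auto

text \<open>
  The order does not depend on the representation of the fraction, as denominators are coprime to
  powers of \<open>x\<close> on the axis.
\<close>

lemma order_ideal_iff:
  assumes "form_eval h v \<noteq> 0" and mem: "form_fract g / form_fract h \<in> order_ideal k"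
  shows "Polynomial.monom 1 k dvd line g"
proof -
  obtain e g' h' where gh: "Polynomial.monom 1 k dvd line g'" "form_eval h' v \<noteq> 0" "h' \<noteq> 0"
    "form_fract g / form_fract h = form_fract g' / form_fract h'"
    using mem denominators_eval unfolding order_ideal_def by (auto elim: form_fractionsE)
  have "h \<noteq> 0" using assms by (auto simp: form_eval_def)
  then have "form_fract (g * h') = form_fract (g' * h)"
    using gh by (simp add: ring_morphism_mult[OF ring_morphism_form_fract] form_fract_eq_0 frac_eq_eq)
  then have "line (g * h') = line (g' * h)" by (simp add: form_fract_eq_iff)
  then have "Polynomial.monom 1 k dvd line g * line h'" using gh(1) by (simp add: line_simps)
  then show ?thesis using coprime_monom_line[OF gh(2)] by (simp add: coprime_dvd_mult_left_iff)
qed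

lemma order_ideal_antimono: "k \<le> l \<Longrightarrow> order_ideal l \<subseteq> order_ideal k"
proof -
  assume "k \<le> l"
  then have "Polynomial.monom (1::complex) k dvd Polynomial.monom 1 l"
    by (simp add: monom_1_dvd_iff')
  then show ?thesis unfolding order_ideal_def form_fractions_def by (blast intro: dvd_trans)
qed

lemma order_ideal_zero: "order_ideal 0 = R_v"
  unfolding order_ideal_def by (simp add: monom_0 pCons_one)

lemma xi_power: "\<xi> ^ k = form_fract (linear_form l1 ^ k) / form_fract (linear_form l3 ^ k)"
  by (simp add: ring_morphism_power[OF ring_morphism_form_fract] power_divide)

lemma l3_power: "homogeneous k (linear_form l3 ^ k)" "form_eval (linear_form l3 ^ k) v = 1"
  using homogeneous_power[OF homogeneous_linear_form, of k l3] dual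
  by (simp_all add: ring_morphism_power[OF ring_morphism_form_eval] form_eval_linear_form)

lemma xi_power_order: "\<xi> ^ k \<in> order_ideal l \<longleftrightarrow> l \<le> k"
proof
  assume "\<xi> ^ k \<in> order_ideal l"
  then have "Polynomial.monom 1 l dvd line (linear_form l1 ^ k)"
    unfolding xi_power by (intro order_ideal_iff[of "linear_form l3 ^ k"]) (simp_all add: l3_power)
  then have "Polynomial.monom 1 l dvd (Polynomial.monom 1 k :: complex poly)"
    by (simp add: line_simps line_linear monom_altdef)
  then show "l \<le> k" unfolding monom_1_dvd_iff' by (auto simp: not_le[symmetric])
next
  assume "l \<le> k"
  then have "Polynomial.monom 1 l dvd (Polynomial.monom 1 k :: complex poly)" by (simp add: monom_1_dvd_iff')
  then have "Polynomial.monom 1 l dvd line (linear_form l1 ^ k)" by (simp add: line_simps line_linear monom_altdef)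
  then show "\<xi> ^ k \<in> order_ideal l"
    unfolding xi_power using homogeneous_power[OF homogeneous_linear_form, of k l1]
    by (intro order_idealI[of k]) (simp_all add: l3_power)
qed

lemma order_ideal_step:
  assumes "x \<in> order_ideal k"
  shows "\<exists>c. x - const_fract c * \<xi> ^ k \<in> order_ideal (Suc k)"
proof -
  obtain e g h where gh: "Polynomial.monom 1 k dvd line g" "form_eval h v \<noteq> 0" "h \<noteq> 0"
    "homogeneous e g" "homogeneous e h" "x = form_fract g / form_fract h"
    using assms denominators_eval unfolding order_ideal_def by (auto elim: form_fractionsE)
  obtain s where s: "line g = Polynomial.monom 1 k * s" using gh(1) by (auto simp: dvd_def)
  define c where "c = poly s 0 / form_eval h v"
  let ?g = "g * linear_form l3 ^ k - form_const c * linear_form l1 ^ k * h"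
  have z: "form_fract (linear_form l3) \<noteq> 0" using l_nonzero by (simp add: form_fract_eq_0)
  have x: "x - const_fract c * \<xi> ^ k = form_fract ?g / form_fract (h * linear_form l3 ^ k)"
  proof -
    have "form_fract ?g = form_fract g * form_fract (linear_form l3) ^ k
        - const_fract c * form_fract (linear_form l1) ^ k * form_fract h"
      "form_fract (h * linear_form l3 ^ k) = form_fract h * form_fract (linear_form l3) ^ k"
      by (simp_all only: ring_morphism_simps[OF ring_morphism_form_fract])
    then show ?thesis
      unfolding gh(6) using z gh(3) by (simp add: power_divide form_fract_eq_0 diff_frac_eq mult_ac)
  qed
  have "line ?g = Polynomial.monom 1 k * (s - [:c:] * line h)"
    by (simp only: line_simps line_linear line_const s monom_altdef) (simp add: algebra_simps)
  moreover have "poly (s - [:c:] * line h) 0 = 0" by (simp add: line_at_origin c_def gh(2))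
  then have "[:- 0, 1:] dvd s - [:c:] * line h" by (simp only: poly_eq_0_iff_dvd)
  then have "[:0, 1:] dvd s - [:c:] * line h" by (simp only: minus_zero)
  ultimately have "Polynomial.monom 1 k * [:0, 1:] dvd line ?g" by (metis mult_dvd_mono dvd_refl)
  then have "Polynomial.monom 1 (Suc k) dvd line ?g" by (simp add: monom_Suc)
  moreover have "homogeneous (e + k) ?g"
  proof -
    have "homogeneous (e + k) (g * linear_form l3 ^ k)" by (intro homogeneous_mult gh l3_power)
    moreover have "homogeneous (0 + k + e) (form_const c * linear_form l1 ^ k * h)"
      using homogeneous_power[OF homogeneous_linear_form, of k l1]
      by (intro homogeneous_mult gh homogeneous_const) simp
    ultimately show ?thesis
      using homogeneous_add[OF _ homogeneous_uminus, of "e + k" "g * linear_form l3 ^ k"] by (simp add: add.commute)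
  qed
  moreover have "homogeneous (e + k) (h * linear_form l3 ^ k)" by (intro homogeneous_mult gh l3_power)
  ultimately have "x - const_fract c * \<xi> ^ k \<in> order_ideal (Suc k)"
    unfolding x by (intro order_idealI[of "e + k"])
      (simp_all add: ring_morphism_mult[OF ring_morphism_form_eval] l3_power gh(2))
  then show ?thesis by blast
qed

text \<open>
  Up to units, regular functions are polynomials in \<open>x\<close> and \<open>y\<close>. Modulo \<open>y\<close> they become polynomials in
  \<open>x\<close>, and \<open>F\<close> becomes a unit times \<open>x^N\<close>.
\<close>

lemma order_ideal_generated:
  assumes F: "homogeneous d F" "line F \<noteq> 0" and L: "L = form_const \<kappa> * linear_form l2" "\<kappa> \<noteq> 0"
    and N: "\<And>i. i < N \<Longrightarrow> Polynomial.coeff (line F) i = 0" "Polynomial.coeff (line F) N \<noteq> 0"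
  shows "Idl\<^bsub>local_ring v\<^esub> (form_fractions {F, L} {h. form_eval h v \<noteq> 0}) = order_ideal N"
proof (rule antisym)
  let ?S = "form_fractions {F, L} {h. form_eval h v \<noteq> 0}"
  interpret R: cring "local_ring v" unfolding local_ring_def by (rule fraction_ring_cring[OF denominators_eval])
  note simps = ring_of_type_algebra_simps[of "form_fractions UNIV {h. form_eval h v \<noteq> 0}", folded local_ring_def]
  have Fdvd: "Polynomial.monom 1 N dvd line F" using N by (simp add: monom_1_dvd_iff')
  have "?S \<subseteq> order_ideal N"
  proof
    fix x assume "x \<in> ?S"
    then obtain e g h where g: "g \<in> {F, L}" "h \<in> {h. form_eval h v \<noteq> 0}" "h \<noteq> 0" "homogeneous e g" "homogeneous e h"
      "x = form_fract g / form_fract h"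
      using denominators_eval by (rule form_fractionsE)
    then have gh: "g \<in> {F, L}" "form_eval h v \<noteq> 0" "homogeneous e g" "homogeneous e h" "x = form_fract g / form_fract h"
      by blast+
    have "line L = 0" by (simp only: L(1) line_simps line_linear mult_zero_right)
    then have "Polynomial.monom 1 N dvd line g" using gh(1) Fdvd by auto
    then show "x \<in> order_ideal N" unfolding gh(5) using gh by (intro order_idealI) auto
  qed
  then show "Idl\<^bsub>local_ring v\<^esub> ?S \<subseteq> order_ideal N" by (rule R.genideal_minimal[OF order_ideal_ideal])
  define J where "J = Idl\<^bsub>local_ring v\<^esub> ?S"
  have Sub: "?S \<subseteq> carrier (local_ring v)" unfolding simps form_fractions_def by blast
  have J: "ideal J (local_ring v)" unfolding J_def by (rule R.genideal_ideal[OF Sub])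
  have SJ: "x \<in> J" if "x \<in> ?S" for x using that R.genideal_self[OF Sub] unfolding J_def by blast
  have Jmult: "x * y \<in> J" if "x \<in> J" "y \<in> R_v" for x y
    using ideal.I_r_closed[OF J that(1), of y] that(2) by (simp add: simps)
  have Jadd: "x + y \<in> J" if "x \<in> J" "y \<in> J" for x y
    using additive_subgroup.a_closed[OF ideal.axioms(1)[OF J] that] by (simp add: simps)
  have reg: "on_chart P \<in> R_v" for P
  proof -
    obtain k g where g: "homogeneous k g" "on_chart P = form_fract g / form_fract (linear_form l3 ^ k)"
      using on_chart_regular by blast
    then show ?thesis using form_fractionsI[OF UNIV_I _ g(1) l3_power(1) denominators_eval] l3_power(2) by simp
  qed
  have m1: "- 1 \<in> R_v" by (rule form_fractions_uminus[OF denominators_eval UNIV_I form_fractions_1[OF denominators_eval]])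
  have z: "form_fract (linear_form l3) \<noteq> 0" using l_nonzero by (simp add: form_fract_eq_0)
  have eta: "\<eta> \<in> J"
  proof -
    have "form_fract L / form_fract (linear_form l3) \<in> J"
      using homogeneous_mult[OF homogeneous_const homogeneous_linear_form, of \<kappa> l2] l3_power[of 1] homogeneous_linear_form[of l3] L
      by (intro SJ form_fractionsI[where e = 1]) (simp_all add: denominators_eval)
    then have "form_fract L / form_fract (linear_form l3) * const_fract (1 / \<kappa>) \<in> J"
      by (rule Jmult) (rule form_fractions_const[OF denominators_eval])
    moreover have "form_fract L / form_fract (linear_form l3) * const_fract (1 / \<kappa>) = \<eta>"
    proof -
      have one: "const_fract \<kappa> * const_fract (1 / \<kappa>) = 1"
        using ring_morphism_mult[OF ring_morphism_const_fract, of \<kappa> "1 / \<kappa>"] ring_morphism_one[OF ring_morphism_const_fract] L(2)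
          nonzero_mult_div_cancel_left[OF L(2), of 1]
        by (simp only: times_divide_eq_right)
      have "form_fract L = const_fract \<kappa> * form_fract (linear_form l2)"
        unfolding L(1) by (rule ring_morphism_mult[OF ring_morphism_form_fract])
      moreover have "a * b / z * c = (a * c) * (b / z)" for a b c z :: "form fract" by simp
      ultimately show ?thesis using one by (simp only: mult_1)
    qed
    ultimately show ?thesis by (simp only:)
  qed
  have split: "on_chart P - on_chart [:Polynomial.coeff P 0:] \<in> J" for P
  proof -
    have "P = [:Polynomial.coeff P 0:] + [:0, 1:] * poly_shift 1 P"
      by (rule poly_eqI) (auto simp: coeff_pCons coeff_poly_shift split: nat.splits)
    then have "on_chart P = on_chart ([:Polynomial.coeff P 0:] + [:0, 1:] * poly_shift 1 P)" by (rule arg_cong)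
    also have "\<dots> = on_chart [:Polynomial.coeff P 0:] + \<eta> * on_chart (poly_shift 1 P)"
      by (simp only: ring_morphism_add[OF ring_morphism_on_chart] ring_morphism_mult[OF ring_morphism_on_chart] on_chart_simps(3))
    finally show ?thesis using Jmult[OF eta reg] by simp
  qed
  have FJ: "on_chart (chart F) \<in> J"
  proof -
    have "on_chart (chart F) = form_fract F / form_fract (linear_form l3 ^ d)"
      using form_fract_chart[OF F(1)] z by (simp add: ring_morphism_power[OF ring_morphism_form_fract])
    then show ?thesis using F l3_power
      by (simp only:) (intro SJ form_fractionsI[of _ _ _ _ d] denominators_eval, auto)
  qed
  have xN: "\<xi> ^ N \<in> J"
  proof -
    obtain r where r: "line F = Polynomial.monom 1 N * r" using Fdvd by (auto simp: dvd_def)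
    have r0: "Polynomial.coeff r 0 \<noteq> 0" using N(2) unfolding r by (simp add: coeff_monom_mult)
    have "on_chart [:line F:] \<in> J"
      using Jadd[OF FJ Jmult[OF split[of "chart F"] m1]] by (simp add: line_def)
    moreover have "on_chart [:line F:] = \<xi> ^ N * on_chart [:r:]"
      unfolding r on_chart_def
      by (simp add: subst_monom subst_const subst_mult ring_morphism_subst[OF ring_morphism_const_fract]
          ring_morphism_const_fract ring_morphism_one[OF ring_morphism_const_fract])
    moreover obtain k g where g: "homogeneous k g" "on_chart [:r:] = form_fract g / form_fract (linear_form l3 ^ k)"
      "form_eval g v = Polynomial.coeff r 0"
      using on_chart_regular[of "[:r:]"] by auto
    have inv: "form_fract (linear_form l3 ^ k) / form_fract g \<in> R_v"
      using g r0 by (intro form_fractionsI[of _ _ _ _ k] denominators_eval l3_power) auto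
    have "g \<noteq> 0" using g(3) r0 by (auto simp: form_eval_def)
    then have "on_chart [:r:] * (form_fract (linear_form l3 ^ k) / form_fract g) = 1"
      unfolding g(2) using l_nonzero by (simp add: form_fract_eq_0)
    ultimately show ?thesis using Jmult[OF _ inv, of "\<xi> ^ N * on_chart [:r:]"] by (simp add: mult.assoc)
  qed
  show "order_ideal N \<subseteq> J"
  proof
    fix x assume "x \<in> order_ideal N"
    then obtain e g h where gh: "Polynomial.monom 1 N dvd line g" "form_eval h v \<noteq> 0"
      "homogeneous e g" "homogeneous e h" "x = form_fract g / form_fract h"
      using denominators_eval unfolding order_ideal_def by (auto elim: form_fractionsE)
    obtain s where s: "line g = Polynomial.monom 1 N * s" using gh(1) by (auto simp: dvd_def)
    have "on_chart [:line g:] = \<xi> ^ N * on_chart [:s:]"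
      unfolding s on_chart_def
      by (simp add: subst_monom subst_const subst_mult ring_morphism_subst[OF ring_morphism_const_fract]
          ring_morphism_const_fract ring_morphism_one[OF ring_morphism_const_fract])
    then have "on_chart [:line g:] \<in> J" using Jmult[OF xN reg] by simp
    then have "on_chart (chart g) \<in> J"
      using Jadd[OF split[of "chart g"], of "on_chart [:Polynomial.coeff (chart g) 0:]"] by (simp add: line_def)
    moreover have "form_fract (linear_form l3 ^ e) / form_fract h \<in> R_v"
      using gh by (intro form_fractionsI[of _ _ _ _ e] denominators_eval l3_power) auto
    ultimately have "on_chart (chart g) * (form_fract (linear_form l3 ^ e) / form_fract h) \<in> J" by (rule Jmult)
    moreover have "on_chart (chart g) * (form_fract (linear_form l3 ^ e) / form_fract h) = x"
      unfolding gh(5) form_fract_chart[OF gh(3)] by (simp add: ring_morphism_power[OF ring_morphism_form_fract])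
    ultimately show "x \<in> J" by simp
  qed
qed

text \<open>
  The images of the order ideals filter the intersection ring by one-dimensional steps, each spanned by
  a power of \<open>x\<close>, and there are \<open>N\<close> of them.
\<close>

theorem intersection_multiplicity_line:
  assumes F: "homogeneous d F" "line F \<noteq> 0" "form_eval F v = 0" and L: "L = form_const \<kappa> * linear_form l2" "\<kappa> \<noteq> 0"
    and N: "\<And>i. i < N \<Longrightarrow> Polynomial.coeff (line F) i = 0" "Polynomial.coeff (line F) N \<noteq> 0"
    and mult: "has_intersection_multiplicity F L v n"
  shows "n = N"
proof -
  interpret R: cring "local_ring v" unfolding local_ring_def by (rule fraction_ring_cring[OF denominators_eval])
  note simps = ring_of_type_algebra_simps[of "form_fractions UNIV {h. form_eval h v \<noteq> 0}", folded local_ring_def]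
  define J where "J = order_ideal N"
  have J: "ideal J (local_ring v)" unfolding J_def by (rule order_ideal_ideal)
  define Q where "Q = local_ring v Quot J"
  interpret Q: cring Q unfolding Q_def by (rule ideal.quotient_is_cring[OF J R.cring_axioms])
  define \<pi> where "\<pi> x = J +>\<^bsub>local_ring v\<^esub> x" for x
  have \<pi>_eq: "\<pi> x = {j + x | j. j \<in> J}" for x
    unfolding \<pi>_def local_ring_def by (rule fraction_coset)
  have \<pi>_iff: "\<pi> x = \<pi> y \<longleftrightarrow> x - y \<in> J" for x y
  proof
    assume "\<pi> x = \<pi> y"
    moreover have "x \<in> \<pi> x" unfolding \<pi>_eq J_def using order_ideal_0 by force
    ultimately show "x - y \<in> J" unfolding \<pi>_eq by force
  next
    assume d: "x - y \<in> J"
    have "j + x \<in> \<pi> y" if "j \<in> J" for j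
      unfolding \<pi>_eq using that d order_ideal_add[of j N "x - y"] by (intro CollectI exI[of _ "j + (x - y)"]) (simp add: J_def)
    moreover have "j + y \<in> \<pi> x" if "j \<in> J" for j
      unfolding \<pi>_eq using that d order_ideal_diff[of j N "x - y"] by (intro CollectI exI[of _ "j - (x - y)"]) (simp add: J_def)
    ultimately show "\<pi> x = \<pi> y" unfolding \<pi>_eq by blast
  qed
  have hom: "\<pi> \<in> ring_hom (local_ring v) Q"
    unfolding \<pi>_def Q_def by (rule ideal.rcos_ring_hom[OF J])
  have \<pi>_mult: "\<pi> x \<otimes>\<^bsub>Q\<^esub> \<pi> y = \<pi> (x * y)" if "x \<in> R_v" "y \<in> R_v" for x y
    using ring_hom_mult[OF hom, of x y] that by (simp add: simps)
  have \<pi>_add: "\<pi> x \<oplus>\<^bsub>Q\<^esub> \<pi> y = \<pi> (x + y)" if "x \<in> R_v" "y \<in> R_v" for x y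
    using ring_hom_add[OF hom, of x y] that by (simp add: simps)
  have \<pi>_zero: "\<zero>\<^bsub>Q\<^esub> = \<pi> 0"
  proof -
    have "\<pi> 0 = J" unfolding \<pi>_eq by simp
    then show ?thesis by (simp add: Q_def FactRing_def)
  qed
  have \<pi>_one: "\<one>\<^bsub>Q\<^esub> = \<pi> 1"
    using ring_hom_one[OF hom] by (simp add: simps)
  have carrier: "carrier Q = \<pi> ` R_v"
    unfolding Q_def FactRing_def A_RCOSETS_def' by (auto simp: \<pi>_def simps)
  have const: "const_fract c \<in> R_v" for c by (rule form_fractions_const[OF denominators_eval])
  define C where "C = range (\<lambda>c. \<pi> (const_fract c))"
  have N0: "N \<noteq> 0"
  proof
    assume "N = 0"
    then show False using N(2) line_at_origin[of F] F(3) by (simp add: poly_0_coeff_0)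
  qed
  have one_ne: "\<one>\<^bsub>Q\<^esub> \<noteq> \<zero>\<^bsub>Q\<^esub>"
    using xi_power_order[of 0 N] N0 by (simp add: \<pi>_one \<pi>_zero \<pi>_iff J_def)
  have subfield: "subfield C Q"
  proof -
    let ?K = "ring_of_type_algebra :: complex ring"
    interpret K: Ring.field ?K by (rule field_from_type_algebra)
    have "ring_hom_ring ?K Q (\<lambda>c. \<pi> (const_fract c))"
    proof (rule ring_hom_ringI)
      show "ring ?K" by (rule K.ring_axioms)
      show "ring Q" by (rule Q.ring_axioms)
      show "\<pi> (const_fract c) \<in> carrier Q" for c using const carrier by blast
    qed (simp_all add: ring_of_type_algebra_def \<pi>_mult \<pi>_add const \<pi>_one ring_morphism_mult[OF ring_morphism_const_fract, symmetric]
        ring_morphism_add[OF ring_morphism_const_fract, symmetric] ring_morphism_one[OF ring_morphism_const_fract, simplified]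
        del: mult_pCons_left mult_pCons_right add_pCons)
    from ring_hom_ring.img_is_subfield(2)[OF this K.carrier_is_subfield one_ne]
    show ?thesis by (simp add: C_def ring_of_type_algebra_def)
  qed
  have xi_R: "\<xi> ^ k \<in> R_v" for k using xi_power_order[of k 0] order_ideal_zero by simp
  have dim: "Q.dimension i C (\<pi> ` order_ideal (N - i))" if "i \<le> N" for i
    using that
  proof (induction i)
    case 0
    have "\<pi> ` order_ideal N = {\<pi> 0}"
    proof (intro equalityI subsetI)
      fix y assume "y \<in> \<pi> ` order_ideal N"
      then obtain x where x: "y = \<pi> x" "x \<in> order_ideal N" by (rule imageE)
      have "\<pi> x = \<pi> 0" using x(2) by (simp add: \<pi>_iff J_def)
      then show "y \<in> {\<pi> 0}" using x(1) by (simp only: singleton_iff)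
    next
      fix y assume "y \<in> {\<pi> 0}"
      then have y: "y = \<pi> 0" by (rule singletonD)
      show "y \<in> \<pi> ` order_ideal N" unfolding y by (rule imageI[OF order_ideal_0])
    qed
    then show ?case by (simp only: \<pi>_zero[symmetric] diff_zero Q.zero_dim)
  next
    case (Suc i)
    \<comment> \<open>The next step of the filtration is spanned by \<open>x^k\<close>.\<close>
    define k where "k = N - Suc i"
    have k: "N - i = Suc k" using Suc.prems by (simp add: k_def)
    let ?E = "\<pi> ` order_ideal (Suc k)"
    have "\<pi> (\<xi> ^ k) \<notin> ?E"
    proof
      assume "\<pi> (\<xi> ^ k) \<in> ?E"
      then obtain x where x: "\<pi> (\<xi> ^ k) = \<pi> x" "x \<in> order_ideal (Suc k)" by (rule imageE)
      note x = x(2) x(1)[unfolded \<pi>_iff]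
      have "\<xi> ^ k - x \<in> order_ideal (Suc k)"
      proof (rule subsetD[OF order_ideal_antimono])
        show "Suc k \<le> N" using k by linarith
        show "\<xi> ^ k - x \<in> order_ideal N" using x(2) unfolding J_def .
      qed
      then have "\<xi> ^ k \<in> order_ideal (Suc k)" using order_ideal_add[OF _ x(1), of "\<xi> ^ k - x"] by simp
      then show False using xi_power_order[of k "Suc k"] by simp
    qed
    moreover have "Q.dimension i C ?E" using Suc k by simp
    moreover have "\<pi> (\<xi> ^ k) \<in> carrier Q" using xi_R carrier by blast
    ultimately have dimS: "Q.dimension (Suc i) C (Q.line_extension C (\<pi> (\<xi> ^ k)) ?E)" by (intro Q.Suc_dim)
    have "Q.line_extension C (\<pi> (\<xi> ^ k)) ?E = \<pi> ` order_ideal k"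
    proof (intro equalityI subsetI)
      fix u assume "u \<in> Q.line_extension C (\<pi> (\<xi> ^ k)) ?E"
      then obtain c x where u: "x \<in> order_ideal (Suc k)" "u = \<pi> (const_fract c) \<otimes>\<^bsub>Q\<^esub> \<pi> (\<xi> ^ k) \<oplus>\<^bsub>Q\<^esub> \<pi> x"
        unfolding Q.line_extension_mem_iff C_def by blast
      have cx: "\<xi> ^ k * const_fract c \<in> order_ideal k"
        using xi_power_order[of k k] const by (intro order_ideal_mult) simp_all
      have xk: "x \<in> order_ideal k" using u(1) order_ideal_antimono[of k "Suc k"] by auto
      have "u = \<pi> (const_fract c * \<xi> ^ k + x)"
        unfolding u(2) \<pi>_mult[OF const xi_R]
      proof (rule \<pi>_add)
        show "const_fract c * \<xi> ^ k \<in> R_v" using cx order_ideal_subset by (auto simp: mult.commute)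
        show "x \<in> R_v" using xk order_ideal_subset by auto
      qed
      moreover have "const_fract c * \<xi> ^ k + x \<in> order_ideal k" using order_ideal_add[OF cx xk] by (simp add: mult.commute)
      ultimately show "u \<in> \<pi> ` order_ideal k" by blast
    next
      fix u assume "u \<in> \<pi> ` order_ideal k"
      then obtain x where x: "x \<in> order_ideal k" "u = \<pi> x" by blast
      obtain c where c: "x - const_fract c * \<xi> ^ k \<in> order_ideal (Suc k)" using order_ideal_step[OF x(1)] by blast
      have cR: "const_fract c * \<xi> ^ k \<in> R_v" using const xi_R form_fractions_mult[OF denominators_eval UNIV_I] by blast
      have "u = \<pi> (const_fract c * \<xi> ^ k) \<oplus>\<^bsub>Q\<^esub> \<pi> (x - const_fract c * \<xi> ^ k)"
        unfolding x(2) \<pi>_add[OF cR subsetD[OF order_ideal_subset c]] by simp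
      also have "\<pi> (const_fract c * \<xi> ^ k) = \<pi> (const_fract c) \<otimes>\<^bsub>Q\<^esub> \<pi> (\<xi> ^ k)" using \<pi>_mult[OF const xi_R] by simp
      finally show "u \<in> Q.line_extension C (\<pi> (\<xi> ^ k)) ?E"
        unfolding Q.line_extension_mem_iff C_def using c by blast
    qed
    then show ?case using dimS by (simp add: k_def)
  qed
  have "Q.dimension N C (carrier Q)" using dim[of N] by (simp add: order_ideal_zero carrier)
  moreover have "Q.dimension n C (carrier Q)"
  proof -
    have gen: "Idl\<^bsub>local_ring v\<^esub> (form_fractions {F, L} {h. form_eval h v \<noteq> 0}) = order_ideal N"
      by (rule order_ideal_generated[OF F(1,2) L]) (fact N)+
    have "intersection_ring F L v = Q"
      unfolding intersection_ring_def Q_def J_def gen by (rule refl)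
    moreover have "intersection_constants F L v = C"
      unfolding intersection_constants_def C_def \<pi>_def J_def gen form_fract_def by (rule refl)
    ultimately show ?thesis using mult unfolding has_intersection_multiplicity_def by simp
  qed
  ultimately show ?thesis using Q.dimension_is_inj[OF subfield] by blast
qed

end

section \<open>Multiplicity and tangent line\<close>

lemma subst_eq_map_poly: "ring_morphism h \<Longrightarrow> map_poly h p = subst (\<lambda>c. [:h c:]) [:0, 1:] p"
proof (induction p)
  case (pCons c p)
  have "ring_morphism (\<lambda>c. [:h c:])" by (rule ring_morphism_comp[OF pCons.prems ring_morphism_const])
  then show ?case using pCons by (simp add: subst_pCons map_poly_pCons ring_morphism_zero)
qed simp

lemma ring_morphism_map_poly: "ring_morphism h \<Longrightarrow> ring_morphism (map_poly h)"
  using ring_morphism_subst[OF ring_morphism_comp[OF _ ring_morphism_const], of h "[:0, 1:]"] subst_eq_map_poly[of h]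
  by (simp add: ring_morphism_def)

lemma ring_morphism_pcompose: "ring_morphism (\<lambda>p. pcompose p q)"
  by (simp add: ring_morphism_def pcompose_add pcompose_mult pcompose_1)

lemma ring_morphism_translate: "ring_morphism (translate v)"
  unfolding translate_def
  by (rule ring_morphism_comp[OF ring_morphism_pcompose ring_morphism_comp[OF ring_morphism_map_poly ring_morphism_map_poly]])
    (intro ring_morphism_map_poly ring_morphism_pcompose)+

lemma translate_const: "translate v (form_const c) = form_const c"
  by (simp add: translate_def map_poly_pCons)

lemma translate_linear: "translate v (linear_form w) = linear_form w + form_const (dot3 w v)"
  by (simp add: translate_def linear_form_def map_poly_pCons pcompose_pCons algebra_simps)

lemma form_eval_translate: "form_eval (translate v F) w = form_eval F (v + w)"
proof (rule form_morphism_eqI[of "\<lambda>F. form_eval (translate v F) w"])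
  show "ring_morphism (\<lambda>F. form_eval (translate v F) w)"
    by (rule ring_morphism_comp[OF ring_morphism_translate ring_morphism_form_eval])
qed (simp_all only: ring_morphism_form_eval translate_const form_eval_const translate_linear
    ring_morphism_add[OF ring_morphism_form_eval] form_eval_linear_form vector_add_component, simp_all add: algebra_simps)

text \<open>
  Translation by the opposite vector is an inverse.
\<close>

lemma translate_nonzero:
  assumes "F \<noteq> 0" shows "translate v F \<noteq> 0"
proof
  assume z: "translate v F = 0"
  have "translate (- v) (translate v F) = F"
  proof (rule form_morphism_eqI[of "\<lambda>F. translate (- v) (translate v F)" "\<lambda>F. F"])
    show "ring_morphism (\<lambda>F. translate (- v) (translate v F))"
      by (rule ring_morphism_comp[OF ring_morphism_translate ring_morphism_translate])
    show "ring_morphism (\<lambda>F::form. F)" by (simp add: ring_morphism_def)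
    show "translate (- v) (translate v (linear_form w)) = linear_form w" for w
      by (simp only: translate_linear translate_const ring_morphism_add[OF ring_morphism_translate]) simp
  qed (simp only: translate_const)
  then show False using assms z ring_morphism_zero[OF ring_morphism_translate] by metis
qed

lemma tricoeff_homogeneous_part:
  "tricoeff (homogeneous_part s P) i j k = (if i + j + k = s then tricoeff P i j k else 0)"
proof -
  have "tricoeff (homogeneous_part s P) i j k
      = (\<Sum>i'\<le>s. \<Sum>j'\<le>s - i'. if i' = i \<and> j' = j \<and> s - i' - j' = k then tricoeff P i j k else 0)"
    unfolding homogeneous_part_def coeff_sum by (intro sum.cong refl) auto
  also have "\<dots> = (\<Sum>i'\<le>s. if i' = i then (if j \<le> s - i \<and> s - i - j = k then tricoeff P i j k else 0) else 0)"
  proof (intro sum.cong refl)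
    fix i' assume "i' \<in> {..s}"
    have "(\<Sum>j'\<le>s - i'. if i' = i \<and> j' = j \<and> s - i' - j' = k then tricoeff P i j k else 0)
       = (\<Sum>j'\<le>s - i'. if j' = j then (if i' = i \<and> s - i' - j = k then tricoeff P i j k else 0) else 0)"
      by (intro sum.cong refl) auto
    then show "(\<Sum>j'\<le>s - i'. if i' = i \<and> j' = j \<and> s - i' - j' = k then tricoeff P i j k else 0)
       = (if i' = i then (if j \<le> s - i \<and> s - i - j = k then tricoeff P i j k else 0) else 0)"
      by auto
  qed
  also have "\<dots> = (if i + j + k = s then tricoeff P i j k else 0)" by auto
  finally show ?thesis .
qed

lemma homogeneous_homogeneous_part: "homogeneous s (homogeneous_part s P)"
  by (rule homogeneousI) (simp add: tricoeff_homogeneous_part split: if_splits)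

text \<open>
  The restriction \<open>t \<mapsto> P(t w)\<close> to a line through the origin. Its coefficients are the values at \<open>w\<close> of the
  homogeneous parts of \<open>P\<close>, so \<open>ray w (translate v F)\<close> is the Taylor expansion of \<open>F\<close> at \<open>v\<close> in the
  direction \<open>w\<close>.
\<close>

definition ray :: "complex ^ 3 \<Rightarrow> form \<Rightarrow> complex poly" where
  "ray w = form_subst (\<lambda>c. [:c:]) [:0, w $ 1:] [:0, w $ 2:] [:0, w $ 3:]"

lemma ring_morphism_ray: "ring_morphism (ray w)"
  unfolding ray_def by (intro ring_morphism_form_subst ring_morphism_const)

lemma poly_ray: "poly (ray w P) t = form_eval P (t *s w)"
proof (rule form_morphism_eqI[of "\<lambda>P. poly (ray w P) t"])
  show "ring_morphism (\<lambda>P. poly (ray w P) t)" by (rule ring_morphism_comp[OF ring_morphism_ray ring_morphism_poly])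
qed (simp_all add: ring_morphism_form_eval ray_def form_subst_const[OF ring_morphism_const] form_eval_const
    form_subst_linear_form[OF ring_morphism_const] form_eval_linear_form algebra_simps)

lemma poly_eqI_infinite:
  fixes p q :: "complex poly"
  assumes "\<And>t. poly p t = poly q t" shows "p = q"
  using assms poly_eq_poly_eq_iff by blast

lemma ray_homogeneous: "homogeneous s P \<Longrightarrow> ray w P = Polynomial.monom (form_eval P w) s"
  by (rule poly_eqI_infinite) (simp add: poly_ray form_eval_scale poly_monom mult.commute)

lemma form_eq_sum_homogeneous_parts: "\<exists>n. P = (\<Sum>s\<le>n. homogeneous_part s P)"
proof -
  have "\<exists>n. \<forall>i j k. tricoeff P i j k \<noteq> 0 \<longrightarrow> i + j + k \<le> n"
  proof -
    define b where "b i = Polynomial.degree (Polynomial.coeff P i)" for i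
    define c where "c i j = Polynomial.degree (Polynomial.coeff (Polynomial.coeff P i) j)" for i j
    let ?T = "(SIGMA i:{..Polynomial.degree P}. SIGMA j:{..b i}. {..c i j})"
    have fin: "finite ?T" by simp
    have "i + j + k \<le> (\<Sum>(i, j, k)\<in>?T. i + j + k)" if nz: "tricoeff P i j k \<noteq> 0" for i j k
    proof -
      have "(i, j, k) \<in> ?T"
        using nz le_degree[of P i] le_degree[of "Polynomial.coeff P i" j] le_degree[of "Polynomial.coeff (Polynomial.coeff P i) j" k]
        by (auto simp: b_def c_def) (metis coeff_0)+
      then show ?thesis using member_le_sum[of "(i, j, k)" ?T "\<lambda>(i, j, k). i + j + k"] fin by simp
    qed
    then show ?thesis by blast
  qed
  then obtain n where n: "\<And>i j k. tricoeff P i j k \<noteq> 0 \<Longrightarrow> i + j + k \<le> n" by blast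
  have "tricoeff P i j k = tricoeff (\<Sum>s\<le>n. homogeneous_part s P) i j k" for i j k
  proof -
    have "tricoeff (\<Sum>s\<le>n. homogeneous_part s P) i j k = (\<Sum>s\<le>n. if s = i + j + k then tricoeff P i j k else 0)"
      unfolding coeff_sum by (intro sum.cong refl) (auto simp: tricoeff_homogeneous_part)
    also have "\<dots> = (if i + j + k \<le> n then tricoeff P i j k else 0)" by simp
    also have "\<dots> = tricoeff P i j k"
    proof (cases "i + j + k \<le> n")
      case False
      then have "tricoeff P i j k = 0" using n by blast
      then show ?thesis by (simp only: if_cancel)
    qed (simp only: if_True)
    finally show ?thesis by (rule sym)
  qed
  then have "P = (\<Sum>s\<le>n. homogeneous_part s P)" by (intro poly_eqI) simp
  then show ?thesis by blast
qed

lemma coeff_ray: "Polynomial.coeff (ray w P) s = form_eval (homogeneous_part s P) w"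
proof -
  obtain n where n: "P = (\<Sum>s\<le>n. homogeneous_part s P)" using form_eq_sum_homogeneous_parts by blast
  have "ray w P = (\<Sum>s\<le>n. ray w (homogeneous_part s P))"
    using n ring_morphism_sum[OF ring_morphism_ray, of w "\<lambda>s. homogeneous_part s P" "{..n}"] by metis
  then have "ray w P = (\<Sum>s\<le>n. Polynomial.monom (form_eval (homogeneous_part s P) w) s)"
    by (simp only: ray_homogeneous[OF homogeneous_homogeneous_part])
  then have "Polynomial.coeff (ray w P) s = (if s \<le> n then form_eval (homogeneous_part s P) w else 0)"
    by (simp add: coeff_sum)
  moreover have "form_eval (homogeneous_part s P) w = 0" if "\<not> s \<le> n"
  proof -
    have "homogeneous_part s P = 0"
    proof (intro poly_eqI)
      fix i j k
      have "tricoeff P i j k = 0" if "i + j + k = s"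
      proof -
        have "tricoeff P i j k = tricoeff (\<Sum>s\<le>n. homogeneous_part s P) i j k" using n by metis
        also have "\<dots> = (\<Sum>s\<le>n. if i + j + k = s then tricoeff P i j k else 0)"
          by (simp only: coeff_sum tricoeff_homogeneous_part)
        also have "\<dots> = 0" using that \<open>\<not> s \<le> n\<close> by (intro sum.neutral) auto
        finally show ?thesis .
      qed
      then show "tricoeff (homogeneous_part s P) i j k = tricoeff 0 i j k"
        unfolding tricoeff_homogeneous_part by simp
    qed
    then show ?thesis by (simp add: form_eval_def)
  qed
  ultimately show ?thesis by auto
qed

lemma poly_ray_translate: "poly (ray w (translate v F)) t = form_eval F (v + t *s w)"
  by (simp add: poly_ray form_eval_translate)

lemma multiplicity_part_nonzero:
  assumes "F \<noteq> 0" shows "homogeneous_part (multiplicity_at F v) (translate v F) \<noteq> 0"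
proof -
  obtain s where "homogeneous_part s (translate v F) \<noteq> 0"
  proof (rule ccontr)
    assume "\<not> thesis"
    then have "homogeneous_part s (translate v F) = 0" for s using that by blast
    then show False using form_eq_sum_homogeneous_parts[of "translate v F"] translate_nonzero[OF assms] by auto
  qed
  then show ?thesis unfolding multiplicity_at_def by (rule LeastI)
qed

lemma ray_translate_low: "s < multiplicity_at F v \<Longrightarrow> Polynomial.coeff (ray w (translate v F)) s = 0"
  unfolding coeff_ray multiplicity_at_def by (drule not_less_Least) (simp add: form_eval_def)

text \<open>
  The tangent cone is the limit of \<open>F(v + t w) / t^m\<close> for \<open>t \<rightarrow> 0\<close>. Adding a multiple of \<open>v\<close> to \<open>w\<close>
  rescales \<open>v + t w\<close> by a factor that tends to 1.
\<close>

lemma tangent_cone_invariant: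
  fixes v w :: "complex ^ 3" and F :: form
  assumes hom: "homogeneous d F"
  defines "H \<equiv> homogeneous_part (multiplicity_at F v) (translate v F)"
  shows "form_eval H (w + \<gamma> *s v) = form_eval H w"
proof -
  let ?m = "multiplicity_at F v"
  have "\<exists>q. ray u (translate v F) = Polynomial.monom 1 ?m * q" for u
    using ray_translate_low[of _ F v u] by (simp add: monom_1_dvd_iff'[unfolded dvd_def])
  then obtain q where q: "\<And>u. ray u (translate v F) = Polynomial.monom 1 ?m * q u" by metis
  have H: "form_eval H u = poly (q u) 0" for u
    unfolding H_def coeff_ray[symmetric] q by (simp add: coeff_monom_mult poly_0_coeff_0)
  let ?u = "w + \<gamma> *s v"
  let ?g = "\<lambda>t. (1 + t * \<gamma>) ^ d / (1 + t * \<gamma>) ^ ?m * poly (q w) (t / (1 + t * \<gamma>))"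
  have eq: "poly (q ?u) t = ?g t" if t: "t \<noteq> 0" "1 + t * \<gamma> \<noteq> 0" for t
  proof -
    let ?s = "1 + t * \<gamma>"
    have "t ^ ?m * poly (q ?u) t = form_eval F (v + t *s ?u)"
      using poly_ray_translate[of ?u v F t] by (simp add: q poly_monom)
    also have "v + t *s ?u = ?s *s (v + (t / ?s) *s w)"
      using t(2) by (simp add: vec_eq_iff field_simps)
    also have "form_eval F \<dots> = ?s ^ d * form_eval F (v + (t / ?s) *s w)" by (rule form_eval_scale[OF hom])
    also have "form_eval F (v + (t / ?s) *s w) = (t / ?s) ^ ?m * poly (q w) (t / ?s)"
      using poly_ray_translate[of w v F "t / ?s"] by (simp add: q poly_monom)
    finally have "t ^ ?m * poly (q ?u) t = t ^ ?m * ?g t" by (simp add: power_divide)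
    moreover have "t ^ ?m \<noteq> 0" using t(1) by simp
    ultimately show ?thesis using mult_left_cancel by blast
  qed
  have lim: "(\<lambda>t. poly (q ?u) t) \<midarrow>0\<rightarrow> poly (q ?u) 0" by (intro tendsto_intros)
  have lim_g: "?g \<midarrow>0\<rightarrow> (1 + 0 * \<gamma>) ^ d / (1 + 0 * \<gamma>) ^ ?m * poly (q w) (0 / (1 + 0 * \<gamma>))"
    by (intro tendsto_intros) auto
  have ev: "\<forall>\<^sub>F t in at 0. poly (q ?u) t = ?g t"
  proof -
    have "(\<lambda>t. 1 + t * \<gamma>) \<midarrow>0\<rightarrow> 1 + 0 * \<gamma>" by (intro tendsto_intros)
    then have "\<forall>\<^sub>F t in at 0. 1 + t * \<gamma> \<noteq> 0" by (rule tendsto_imp_eventually_ne) simp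
    moreover have "\<forall>\<^sub>F t in at (0::complex). t \<noteq> 0" by (rule eventually_neq_at_within)
    ultimately show ?thesis by eventually_elim (rule eq)
  qed
  have "poly (q ?u) 0 = (1 + 0 * \<gamma>) ^ d / (1 + 0 * \<gamma>) ^ ?m * poly (q w) (0 / (1 + 0 * \<gamma>))"
    by (rule LIM_unique[OF lim]) (rule tendsto_cong[OF ev, THEN iffD2, OF lim_g])
  then show ?thesis by (simp add: H)
qed

lemma bipoly_morphism_eqI:
  fixes h k :: "bipoly \<Rightarrow> 'a::comm_ring_1"
  assumes m: "ring_morphism h" "ring_morphism k" and c: "\<And>c. h [:[:c:]:] = k [:[:c:]:]"
    and x: "h [:[:0, 1:]:] = k [:[:0, 1:]:]" and y: "h [:0, 1:] = k [:0, 1:]"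
  shows "h P = k P"
proof -
  have "h [:p:] = k [:p:]" for p
    using ring_morphism_comp[OF ring_morphism_const m(1)] ring_morphism_comp[OF ring_morphism_const m(2)]
    by (rule ring_morphism_poly_eqI) (simp_all only: c x)
  from ring_morphism_poly_eqI[OF m this y] show ?thesis .
qed

lemma weighted_subst_generators:
  "weighted_subst p q [:[:c:]:] = [:[:c:]:]" "weighted_subst p q [:[:0, 1:]:] = Polynomial.monom 1 p"
  "weighted_subst p q [:0, 1:] = bimonom 1 1 q"
  unfolding weighted_subst_def
  by (simp_all add: subst_pCons ring_morphism_subst[OF ring_morphism_const2] ring_morphism_const2 pCons_one
      ring_morphism_one[OF ring_morphism_subst[OF ring_morphism_const2]]
      ring_morphism_one[OF ring_morphism_subst[OF ring_morphism_subst[OF ring_morphism_const2]]])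

lemma poly_weighted_subst_11: "poly (poly (weighted_subst 1 1 P) [:t:]) z = poly (poly P [:z * t:]) t"
proof (rule bipoly_morphism_eqI[of "\<lambda>P. poly (poly (weighted_subst 1 1 P) [:t:]) z"])
  show "ring_morphism (\<lambda>P. poly (poly (weighted_subst 1 1 P) [:t:]) z)"
    by (rule ring_morphism_comp[OF ring_morphism_weighted_subst ring_morphism_comp[OF ring_morphism_poly ring_morphism_poly]])
  show "ring_morphism (\<lambda>P. poly (poly P [:z * t:]) t)"
    by (rule ring_morphism_comp[OF ring_morphism_poly ring_morphism_poly])
qed (simp_all only: weighted_subst_generators, simp_all add: poly_monom)

definition total_le :: "nat \<Rightarrow> bipoly \<Rightarrow> bool" where
  "total_le n P \<longleftrightarrow> (\<forall>i j. bicoeff P i j \<noteq> 0 \<longrightarrow> i + j \<le> n)"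

lemma total_le_mult:
  assumes "total_le a P" "total_le b Q"
  shows "total_le (a + b) (P * Q)"
  unfolding total_le_def
proof (intro allI impI)
  fix i j assume "bicoeff (P * Q) i j \<noteq> 0"
  then obtain j' where j': "j' \<le> j" "Polynomial.coeff (Polynomial.coeff P j' * Polynomial.coeff Q (j - j')) i \<noteq> 0"
    unfolding coeff_mult[of P] coeff_sum by (auto elim!: sum.not_neutral_contains_not_neutral)
  then obtain i' where i': "i' \<le> i" "bicoeff P i' j' * bicoeff Q (i - i') (j - j') \<noteq> 0"
    unfolding coeff_mult[of "Polynomial.coeff P j'"] by (auto elim!: sum.not_neutral_contains_not_neutral)
  then have "bicoeff P i' j' \<noteq> 0" "bicoeff Q (i - i') (j - j') \<noteq> 0" by auto
  then have "i' + j' \<le> a" "(i - i') + (j - j') \<le> b"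
    using assms unfolding total_le_def by blast+
  then show "i + j \<le> a + b" using i' j' by linarith
qed

lemma total_le_power: "total_le a P \<Longrightarrow> total_le (a * n) (P ^ n)"
proof (induction n)
  case 0
  show ?case by (auto simp: total_le_def of_bool_def split: if_splits)
next
  case (Suc n)
  then show ?case using total_le_mult[of a P "a * n" "P ^ n"] by simp
qed

lemma total_le_sum:
  assumes "\<And>x. x \<in> A \<Longrightarrow> total_le n (f x)"
  shows "total_le n (sum f A)"
  unfolding total_le_def
proof (intro allI impI)
  fix i j assume "bicoeff (sum f A) i j \<noteq> 0"
  then obtain x where "x \<in> A" "bicoeff (f x) i j \<noteq> 0"
    unfolding coeff_sum by (auto elim!: sum.not_neutral_contains_not_neutral)
  then show "i + j \<le> n" using assms unfolding total_le_def by blast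
qed

context frame
begin

lemma total_le_chart:
  assumes "homogeneous d F"
  shows "total_le d (chart F)"
proof -
  define T where "T k = [:[:v $ k, e1 $ k:], [:e2 $ k:]:]" for k
  have T: "total_le 1 (T k)" for k
    by (auto simp: total_le_def T_def coeff_pCons split: nat.splits if_splits)
  have mon: "total_le d (chart (Polynomial.monom (Polynomial.monom (Polynomial.monom (tricoeff F i j k) k) j) i))" for i j k
  proof (cases "tricoeff F i j k = 0")
    case True
    then show ?thesis by (simp only: monom_eq_0 ring_morphism_zero[OF ring_morphism_chart]) (simp add: total_le_def)
  next
    case False
    then have d: "d = 0 + k + j + i" using assms homogeneousD by fastforce
    have c: "total_le 0 [:[:c:]:]" for c by (auto simp: total_le_def coeff_pCons split: nat.splits if_splits)
    have "total_le (0 + k + j + i) ([:[:tricoeff F i j k:]:] * T 3 ^ k * T 2 ^ j * T 1 ^ i)"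
      using total_le_power[OF T, of k] total_le_power[OF T, of j] total_le_power[OF T, of i]
      by (intro total_le_mult c) simp_all
    moreover have "chart (Polynomial.monom (Polynomial.monom (Polynomial.monom (tricoeff F i j k) k) j) i)
      = [:[:tricoeff F i j k:]:] * T 3 ^ k * T 2 ^ j * T 1 ^ i"
      unfolding chart_def form_subst_def T_def by (simp only: subst_monom ring_morphism_subst ring_morphism_const2)
    ultimately show ?thesis unfolding d by (simp only:)
  qed
  have "F = (\<Sum>i\<le>Polynomial.degree F. Polynomial.monom (Polynomial.coeff F i) i)"
    by (simp add: poly_as_sum_of_monoms)
  also have "\<dots> = (\<Sum>i\<le>Polynomial.degree F. \<Sum>j\<le>Polynomial.degree (Polynomial.coeff F i).
      \<Sum>k\<le>Polynomial.degree (Polynomial.coeff (Polynomial.coeff F i) j).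
        Polynomial.monom (Polynomial.monom (Polynomial.monom (tricoeff F i j k) k) j) i)"
    by (intro sum.cong refl) (subst bipoly_sum_monoms, simp add: monom_sum)
  finally show ?thesis
    by (rule ssubst[where P = "\<lambda>F. total_le d (chart F)"])
      (simp only: ring_morphism_sum[OF ring_morphism_chart], intro total_le_sum mon)
qed

lemma chart_ray: "poly (poly (weighted_subst 1 1 (chart F)) [:t:]) z = poly (ray (e1 + z *s e2) (translate v F)) t"
  unfolding poly_weighted_subst_11 poly_chart poly_ray_translate
  by (rule arg_cong[of _ _ "form_eval F"]) (simp add: vec_eq_iff algebra_simps)

lemma chart_initial_coeff:
  "poly (Polynomial.coeff (weighted_subst 1 1 (chart F)) s) z = form_eval (homogeneous_part s (translate v F)) (e1 + z *s e2)"
proof -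
  let ?P = "weighted_subst 1 1 (chart F)"
  have "map_poly (\<lambda>p. poly p z) ?P = ray (e1 + z *s e2) (translate v F)"
  proof (rule poly_eqI_infinite)
    fix t
    have "poly (map_poly (\<lambda>p. poly p z) ?P) t = poly (poly ?P [:t:]) z"
      using poly_at_line[of z ?P t] by (simp add: at_line_def)
    then show "poly (map_poly (\<lambda>p. poly p z) ?P) t = poly (ray (e1 + z *s e2) (translate v F)) t"
      by (simp only: chart_ray)
  qed
  then have "Polynomial.coeff (map_poly (\<lambda>p. poly p z) ?P) s = Polynomial.coeff (ray (e1 + z *s e2) (translate v F)) s"
    by simp
  then show ?thesis by (simp add: coeff_map_poly coeff_ray)
qed

lemma chart_x_axis: "bicoeff (chart F) i 0 = form_eval (homogeneous_part i (translate v F)) e1"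
proof -
  have "Polynomial.coeff (chart F) 0 = ray e1 (translate v F)"
  proof (rule poly_eqI_infinite)
    fix t
    have "poly (Polynomial.coeff (chart F) 0) t = poly (poly (chart F) [:0:]) t" by (simp add: poly_0_coeff_0)
    then show "poly (Polynomial.coeff (chart F) 0) t = poly (ray e1 (translate v F)) t"
      unfolding poly_chart poly_ray_translate by simp
  qed
  then show ?thesis by (simp add: coeff_ray)
qed

lemma chart_y_axis: "bicoeff (chart F) 0 j = form_eval (homogeneous_part j (translate v F)) e2"
proof -
  have "at_line 0 (chart F) = ray e2 (translate v F)"
    by (rule poly_eqI_infinite) (simp only: poly_at_line poly_chart poly_ray_translate, simp)
  then have "Polynomial.coeff (at_line 0 (chart F)) j = Polynomial.coeff (ray e2 (translate v F)) j" by simp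
  then show ?thesis by (simp add: coeff_at_line coeff_ray poly_0_coeff_0)
qed

text \<open>
  By homogeneity \<open>F(u v + w) = u^d F(v + w / u)\<close>, so the expansion of \<open>F\<close> at \<open>w\<close> in the direction \<open>v\<close> is
  the reversed expansion at \<open>v\<close> in the direction \<open>w\<close>; its constant term is the top coefficient.
\<close>

lemma chart_top_coeff:
  assumes "homogeneous d F"
  shows "poly (Polynomial.coeff (weighted_subst 1 1 (chart F)) d) z = form_eval F (e1 + z *s e2)"
proof -
  let ?w = "e1 + z *s e2"
  have deg: "Polynomial.degree (ray ?w (translate v F)) \<le> d"
  proof (rule degree_le, intro allI impI)
    fix s assume s: "d < s"
    have "Polynomial.coeff (weighted_subst 1 1 (chart F)) s = 0"
    proof (rule poly_eqI)
      fix j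
      have "bicoeff (chart F) (s - j) j = 0" if "j \<le> s"
        using total_le_chart[OF assms] s that unfolding total_le_def by (metis le_add_diff_inverse2 not_le)
      then show "Polynomial.coeff (Polynomial.coeff (weighted_subst 1 1 (chart F)) s) j = Polynomial.coeff 0 j"
        unfolding weighted_subst_1_coeff by simp
    qed
    then show "Polynomial.coeff (ray ?w (translate v F)) s = 0"
      unfolding coeff_ray chart_initial_coeff[symmetric] by simp
  qed
  define R where "R = ray v (translate ?w F)"
  let ?c = "\<lambda>s. form_eval (homogeneous_part s (translate v F)) ?w"
  define S where "S = (\<Sum>s\<le>d. Polynomial.monom (?c s) (d - s))"
  have "poly R u = poly S u" if "u \<noteq> 0" for u
  proof -
    have "poly R u = form_eval F (u *s (v + (1 / u) *s ?w))"
      unfolding R_def poly_ray_translate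
      by (rule arg_cong[of _ _ "form_eval F"]) (use that in \<open>simp add: vec_eq_iff field_simps\<close>)
    also have "\<dots> = u ^ d * poly (ray ?w (translate v F)) (1 / u)"
      unfolding form_eval_scale[OF assms] poly_ray_translate by (rule refl)
    also have "\<dots> = u ^ d * (\<Sum>s\<le>d. ?c s * (1 / u) ^ s)"
      unfolding poly_eq_sum[OF deg] coeff_ray by (rule refl)
    also have "\<dots> = (\<Sum>s\<le>d. ?c s * u ^ (d - s))"
      unfolding sum_distrib_left using that by (intro sum.cong refl) (simp add: power_diff power_divide)
    also have "\<dots> = poly S u" by (simp add: S_def poly_sum poly_monom)
    finally show ?thesis .
  qed
  then have "{u. u \<noteq> 0} \<subseteq> {u. poly (R - S) u = 0}" by auto
  moreover have "infinite {u::complex. u \<noteq> 0}"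
    using infinite_UNIV_char_0[where 'a = complex] finite_Diff_insert[of UNIV 0 "{}"]
    by (metis (no_types, lifting) Collect_cong Compl_eq_Diff_UNIV Diff_empty finite_insert singleton_conv Collect_neg_eq)
  ultimately have "R - S = 0" using poly_roots_finite finite_subset by blast
  then have "poly R 0 = poly S 0" by simp
  moreover have "poly R 0 = form_eval F ?w" unfolding R_def poly_ray_translate by simp
  moreover have "poly S 0 = (\<Sum>s\<le>d. if s = d then ?c d else 0)"
    unfolding S_def poly_sum poly_monom by (intro sum.cong refl) (auto simp: zero_power)
  ultimately show ?thesis unfolding chart_initial_coeff by simp
qed

end

section \<open>Coordinates adapted to a tangent line\<close>

definition cross :: "complex ^ 3 \<Rightarrow> complex ^ 3 \<Rightarrow> complex ^ 3" where
  "cross a b = vector [a $ 2 * b $ 3 - a $ 3 * b $ 2, a $ 3 * b $ 1 - a $ 1 * b $ 3, a $ 1 * b $ 2 - a $ 2 * b $ 1]"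

lemma cross_component: "cross a b $ 1 = a $ 2 * b $ 3 - a $ 3 * b $ 2" "cross a b $ 2 = a $ 3 * b $ 1 - a $ 1 * b $ 3"
  "cross a b $ 3 = a $ 1 * b $ 2 - a $ 2 * b $ 1"
  by (simp_all add: cross_def)

lemma frame_of_basis:
  assumes "dot3 e1 (cross e2 v) \<noteq> 0"
  shows "\<exists>l1 l2 l3. frame e1 e2 v l1 l2 l3"
proof -
  define D where "D = dot3 e1 (cross e2 v)"
  have D: "D \<noteq> 0" using assms by (simp add: D_def)
  let ?l1 = "(1 / D) *s cross e2 v" and ?l2 = "(1 / D) *s cross v e1" and ?l3 = "(1 / D) *s cross e1 e2"
  have scale: "dot3 ((1 / D) *s a) b = dot3 a b / D" for a b by (simp add: add_divide_distrib)
  have "frame e1 e2 v ?l1 ?l2 ?l3"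
  proof
    have "dot3 (cross e2 v) e1 = D" "dot3 (cross v e1) e2 = D" "dot3 (cross e1 e2) v = D"
      unfolding D_def cross_component by (simp_all add: algebra_simps)
    then show "dot3 ?l1 e1 = 1" "dot3 ?l2 e2 = 1" "dot3 ?l3 v = 1" unfolding scale using D by simp_all
    have "dot3 (cross e2 v) e2 = 0" "dot3 (cross e2 v) v = 0" "dot3 (cross v e1) e1 = 0" "dot3 (cross v e1) v = 0"
      "dot3 (cross e1 e2) e1 = 0" "dot3 (cross e1 e2) e2 = 0"
      unfolding cross_component by (simp_all add: algebra_simps)
    then show "dot3 ?l1 e2 = 0" "dot3 ?l1 v = 0" "dot3 ?l2 e1 = 0" "dot3 ?l2 v = 0" "dot3 ?l3 e1 = 0" "dot3 ?l3 e2 = 0"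
      unfolding scale by simp_all
    fix w
    have "dot3 w e1 * cross e2 v $ k + dot3 w e2 * cross v e1 $ k + dot3 w v * cross e1 e2 $ k = D * w $ k" if "k \<in> {1, 2, 3}" for k
      using that unfolding D_def by (elim insertE emptyE; simp only: cross_component; simp add: algebra_simps)
    then have "dot3 w e1 * cross e2 v $ k + dot3 w e2 * cross v e1 $ k + dot3 w v * cross e1 e2 $ k = D * w $ k" for k
      using exhaust_3[of k] by blast
    then have comp: "(dot3 w e1 * cross e2 v $ k + dot3 w e2 * cross v e1 $ k + dot3 w v * cross e1 e2 $ k) / D = w $ k" for k
      using D by simp
    show "dot3 w e1 *s ?l1 + dot3 w e2 *s ?l2 + dot3 w v *s ?l3 = w"
    proof -
      have "a * (1 / D * x) + b * (1 / D * y) + c * (1 / D * z) = (a * x + b * y + c * z) / D" for a b c x y z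
        by (simp add: add_divide_distrib)
      then show ?thesis
        using comp unfolding vec_eq_iff vector_add_component vector_smult_component by (simp only: simp_thms)
    qed
  qed
  then show ?thesis by blast
qed

text \<open>
  The vector \<open>e1\<close> is \<open>cross w z\<close>, which is orthogonal to \<open>w\<close> and whose cross product with \<open>v\<close> is a multiple
  of \<open>w\<close>.
\<close>

lemma frame_exists:
  assumes v: "v \<noteq> 0" and w: "dot3 w v = 0" "dot3 w e2 \<noteq> 0"
  shows "\<exists>e1 l1 l2 l3. frame e1 e2 v l1 l2 l3 \<and> dot3 w e1 = 0"
proof -
  obtain z where z: "dot3 v z \<noteq> 0"
  proof (rule ccontr)
    assume "\<not> thesis"
    then have "dot3 v z = 0" for z using that by blast
    from this[of "axis 1 1"] this[of "axis 2 1"] this[of "axis 3 1"]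
    have "v $ 1 = 0" "v $ 2 = 0" "v $ 3 = 0" by (simp_all add: axis_def)
    then have "v $ k = 0" for k using exhaust_3[of k] by auto
    then show False using v by (simp add: vec_eq_iff)
  qed
  let ?e1 = "cross w z"
  have "dot3 ?e1 (cross e2 v) = dot3 w e2 * dot3 v z - dot3 w v * dot3 z e2"
    unfolding cross_component by (simp add: algebra_simps)
  then have "dot3 ?e1 (cross e2 v) \<noteq> 0" using w z by simp
  moreover have "dot3 w ?e1 = 0" unfolding cross_component by (simp add: algebra_simps)
  ultimately show ?thesis using frame_of_basis by blast
qed

context frame
begin

lemma decompose: "u = dot3 l1 u *s e1 + dot3 l2 u *s e2 + dot3 l3 u *s v"
proof -
  have "u $ k = dot3 l1 u * e1 $ k + dot3 l2 u * e2 $ k + dot3 l3 u * v $ k" for k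
  proof -
    let ?w = "axis k 1 :: complex ^ 3"
    have d: "dot3 ?w x = x $ k" for x using exhaust_3[of k] by (auto simp: axis_def)
    have w: "?w $ i = e1 $ k * l1 $ i + e2 $ k * l2 $ i + v $ k * l3 $ i" for i
      using arg_cong[OF complete[of ?w], of "\<lambda>u. u $ i"] unfolding d by (simp)
    have "u $ k = dot3 ?w u" by (simp only: d)
    then show ?thesis unfolding w by (simp add: algebra_simps)
  qed
  then show ?thesis unfolding vec_eq_iff vector_add_component vector_smult_component by blast
qed

lemma swap: "frame e2 e1 v l2 l1 l3"
proof
  show "dot3 w e2 *s l2 + dot3 w e1 *s l1 + dot3 w v *s l3 = w" for w
    using complete[of w] by (simp only: add.commute[of "dot3 w e2 *s l2"])
qed (fact dual)+

end

section \<open>The Newton polygon of a unibranch point\<close>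

lemma only_zero_root_monom:
  fixes p :: "complex poly"
  assumes "p \<noteq> 0" "\<And>b. poly p b = 0 \<Longrightarrow> b = 0"
  shows "p = Polynomial.monom (Polynomial.lead_coeff p) (Polynomial.degree p)"
proof -
  obtain k where k: "Polynomial.monom 1 (Polynomial.degree p) = p * k"
    using only_zero_root_dvd_monom[OF assms] by (auto simp: dvd_def)
  then have "k \<noteq> 0" by auto
  then have "Polynomial.degree (p * k) = Polynomial.degree p + Polynomial.degree k" using assms(1) by (intro degree_mult_eq)
  then have "Polynomial.degree k = 0" using k[symmetric] by (simp add: degree_monom_eq)
  then obtain c where c: "k = [:c:]" by (auto elim: degree_eq_zeroE)
  have c0: "c \<noteq> 0" using \<open>k \<noteq> 0\<close> c by auto
  have p: "p = Polynomial.monom (1 / c) (Polynomial.degree p)"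
  proof -
    have "Polynomial.smult (1 / c) (Polynomial.monom 1 (Polynomial.degree p)) = p" unfolding k c using c0 by simp
    then show ?thesis by (simp add: smult_monom)
  qed
  then have "Polynomial.lead_coeff p = 1 / c" by (metis Polynomial.coeff_monom)
  then show ?thesis using p by simp
qed

context frame
begin

lemma low_coeff_zero:
  assumes "i + j < multiplicity_at F v"
  shows "bicoeff (chart F) i j = 0"
proof -
  have "poly (Polynomial.coeff (weighted_subst 1 1 (chart F)) (i + j)) z = 0" for z
    unfolding chart_initial_coeff using ray_translate_low[OF assms, of "e1 + z *s e2"] by (simp add: coeff_ray)
  then have "Polynomial.coeff (weighted_subst 1 1 (chart F)) (i + j) = 0"
    using poly_all_0_iff_0 by blast
  then show ?thesis using bicoeff_weighted_subst_1[where P = "chart F" and i = i and j = j] by (simp only: coeff_0)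
qed

end

context unibranch_chart
begin

text \<open>
  Otherwise \<open>y\<close> divides the affine equation; clearing denominators, the prime \<open>F\<close> divides the cofactor of
  \<open>y\<close>, and cancelling it shows that the form defining \<open>y = 0\<close> divides a power of one not vanishing at the point.
\<close>

lemma line_nonzero: "line F \<noteq> 0"
proof
  assume z: "line F = 0"
  define Q where "Q = poly_shift 1 (chart F)"
  have "chart F = [:0, 1:] * Q"
    using z by (intro poly_eqI) (auto simp: line_def Q_def coeff_pCons coeff_poly_shift split: nat.splits)
  then have "on_chart (chart F) = \<eta> * on_chart Q"
    by (simp only: ring_morphism_mult[OF ring_morphism_on_chart] on_chart_simps)
  moreover obtain k g where g: "homogeneous k g" "on_chart Q = form_fract g / form_fract (linear_form l3 ^ k)"
    using on_chart_regular by blast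
  ultimately have "form_fract F = form_fract (linear_form l3) ^ d * (\<eta> * (form_fract g / form_fract (linear_form l3 ^ k)))"
    using form_fract_chart[OF hom_F] by simp
  then have "form_fract F * form_fract (linear_form l3 ^ k * linear_form l3)
      = form_fract (linear_form l3 ^ d * linear_form l2 * g)"
    using l_nonzero by (simp add: ring_morphism_simps[OF ring_morphism_form_fract] form_fract_eq_0)
  then have eq: "F * (linear_form l3 ^ k * linear_form l3) = linear_form l3 ^ d * linear_form l2 * g"
    by (simp only: ring_morphism_mult[OF ring_morphism_form_fract, symmetric] form_fract_eq_iff)
  then have "F dvd linear_form l3 ^ d * linear_form l2 * g" by (metis dvd_triv_left)
  moreover have "\<not> F dvd linear_form l3 ^ d" "\<not> F dvd linear_form l2"
    using not_F_dvd_linear[OF l_nonzero(3)] not_F_dvd_linear[OF l_nonzero(2)] prime_elem_dvd_power[OF prime_F] by blast+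
  ultimately have "F dvd g" by (simp add: prime_elem_dvd_mult_iff[OF prime_F])
  then obtain g' where g': "g = F * g'" by (auto simp: dvd_def)
  have "F \<noteq> 0" using prime_F by auto
  then have "linear_form l3 ^ k * linear_form l3 = linear_form l3 ^ d * linear_form l2 * g'"
    using eq unfolding g' by (simp add: mult_ac)
  then have "form_eval (linear_form l3 ^ k * linear_form l3) v = form_eval (linear_form l3 ^ d * linear_form l2 * g') v" by simp
  then show False using dual by (simp add: ring_morphism_simps[OF ring_morphism_form_eval] form_eval_linear_form)
qed

abbreviation "mlt \<equiv> multiplicity_at F v"
abbreviation "tcone \<equiv> homogeneous_part mlt (translate v F)"

lemma chart_low: "bicoeff (chart F) i j \<noteq> 0 \<Longrightarrow> mlt \<le> i + j"
  using low_coeff_zero[of i j F] by (meson not_le)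

text \<open>
  The direction of the tangent line is a root of the initial form for the weights \<open>1, 1\<close>, and by
  \<open>initial_form_roots\<close> the only one.
\<close>

lemma tangent_cone_power:
  assumes w: "dot3 w e1 = 0" "dot3 w v = 0" and L: "linear_form w dvd tcone" and e2: "form_eval tcone e2 \<noteq> 0"
  shows "\<exists>\<kappa>. \<kappa> \<noteq> 0 \<and> (\<forall>u. form_eval tcone u = \<kappa> * dot3 w u ^ mlt)"
proof -
  let ?p = "Polynomial.coeff (weighted_subst 1 1 (chart F)) mlt"
  have p_eval: "poly ?p z = form_eval tcone (e1 + z *s e2)" for z by (rule chart_initial_coeff)
  obtain k where k: "tcone = linear_form w * k" using L by (auto simp: dvd_def)
  have coneL: "form_eval tcone u = dot3 w u * form_eval k u" for u
    unfolding k by (simp add: ring_morphism_mult[OF ring_morphism_form_eval] form_eval_linear_form)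
  have y: "bicoeff (chart F) 0 mlt = form_eval tcone e2" by (rule chart_y_axis)
  have p_m: "Polynomial.coeff ?p mlt = form_eval tcone e2"
    unfolding weighted_subst_1_coeff using y by simp
  have p0: "?p \<noteq> 0" using p_m e2 by auto
  have "poly ?p 0 = 0" unfolding p_eval coneL using w(1) by simp
  have roots: "c = 0" if "poly ?p c = 0" for c
  proof -
    have "c ^ 1 = 0 ^ 1"
    proof (rule initial_form_roots[of 1 1 mlt])
      show "bicoeff (chart F) 0 mlt \<noteq> 0" using y e2 by simp
      show "poly (Polynomial.coeff (weighted_subst 1 1 (chart F)) (1 * mlt)) c = 0" using that by simp
      show "poly (Polynomial.coeff (weighted_subst 1 1 (chart F)) (1 * mlt)) 0 = 0" using \<open>poly ?p 0 = 0\<close> by simp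
      show "1 * mlt \<le> 1 * i + 1 * j" if "bicoeff (chart F) i j \<noteq> 0" for i j using chart_low[OF that] by simp
    qed simp_all
    then show ?thesis by simp
  qed
  have "Polynomial.degree ?p = mlt"
  proof (rule antisym)
    show "Polynomial.degree ?p \<le> mlt"
      by (rule degree_le) (simp only: weighted_subst_1_coeff, simp)
    show "mlt \<le> Polynomial.degree ?p" by (rule le_degree) (simp only: p_m, rule e2)
  qed
  then have p_mon: "?p = Polynomial.monom (form_eval tcone e2) mlt"
    using only_zero_root_monom[OF p0 roots] p_m by simp
  let ?c = "form_eval tcone e2"
  have we2: "dot3 w e2 \<noteq> 0" using e2 coneL[of e2] by auto
  have cone_plane: "form_eval tcone (a *s e1 + b *s e2) = ?c * b ^ mlt" for a b
  proof (cases "a = 0")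
    case True
    then show ?thesis using form_eval_scale[OF homogeneous_homogeneous_part, of mlt "translate v F" b e2] by simp
  next
    case False
    have "a *s e1 + b *s e2 = a *s (e1 + (b / a) *s e2)" using False by (simp add: vec_eq_iff field_simps)
    then have "form_eval tcone (a *s e1 + b *s e2) = a ^ mlt * poly ?p (b / a)"
      using form_eval_scale[OF homogeneous_homogeneous_part] p_eval by metis
    then show ?thesis unfolding p_mon using False by (simp add: poly_monom power_divide)
  qed
  have "form_eval tcone u = (?c / dot3 w e2 ^ mlt) * dot3 w u ^ mlt" for u
  proof -
    have "form_eval tcone u = form_eval tcone ((dot3 l1 u *s e1 + dot3 l2 u *s e2) + dot3 l3 u *s v)"
      using decompose[of u] by simp
    also have "\<dots> = form_eval tcone (dot3 l1 u *s e1 + dot3 l2 u *s e2)" by (rule tangent_cone_invariant[OF hom_F])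
    also have "\<dots> = ?c * dot3 l2 u ^ mlt" by (rule cone_plane)
    finally have 1: "form_eval tcone u = ?c * dot3 l2 u ^ mlt" .
    have "dot3 w u = dot3 w e2 * dot3 l2 u"
    proof -
      define c where "c = dot3 w e2"
      have "w $ k = c * l2 $ k" for k
        using arg_cong[OF complete[of w], of "\<lambda>u. u $ k"]
        unfolding w vector_add_component vector_smult_component c_def[symmetric] by simp
      then have "dot3 w u = c * dot3 l2 u" by (simp only: distrib_left mult.assoc)
      then show ?thesis unfolding c_def .
    qed
    then show ?thesis unfolding 1 using we2 by (simp add: power_mult_distrib)
  qed
  moreover have "?c / dot3 w e2 ^ mlt \<noteq> 0" using e2 we2 by simp
  ultimately show ?thesis by blast
qed

text \<open>
  Among the monomials with exponent of \<open>y\<close> below the multiplicity, take one for which the slope seen from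
  \<open>y^m\<close> is least, and the corresponding weights \<open>p, q\<close>: all monomials then have weight at least that of \<open>y^m\<close>.
  The initial form is not a monomial, so it has a nonzero root; by \<open>initial_form_roots\<close> zero is
  not a root. So it contains a power of \<open>x\<close>, which lies on the line of slope
  \<open>q / p\<close> through \<open>y^m\<close>. As \<open>n\<close> is the least exponent of a power of \<open>x\<close> in the equation, and \<open>x^n\<close>
  has weight at least that of \<open>y^m\<close>, this power is \<open>x^n\<close> and the weights are proportional to \<open>m, n\<close>.
\<close>

theorem newton_polygon:
  assumes w: "dot3 w e1 = 0" "dot3 w v = 0" "w \<noteq> 0" and \<kappa>: "\<kappa> \<noteq> 0" and H: "\<And>u. form_eval tcone u = \<kappa> * dot3 w u ^ mlt"
    and n: "has_intersection_multiplicity F (linear_form w) v n"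
  shows "0 < mlt" "mlt < n" "n \<le> d" "bicoeff (chart F) 0 mlt \<noteq> 0" "bicoeff (chart F) n 0 \<noteq> 0"
    "\<And>i j. bicoeff (chart F) i j \<noteq> 0 \<Longrightarrow> mlt * n \<le> mlt * i + n * j"
proof -
  let ?f = "chart F"
  have we2: "dot3 w e2 \<noteq> 0"
  proof
    assume "dot3 w e2 = 0"
    then show False using complete[of w] w(3) unfolding w(1,2) by simp
  qed
  show m0: "bicoeff ?f 0 mlt \<noteq> 0" unfolding chart_y_axis H using \<kappa> we2 by simp
  have "bicoeff ?f 0 0 = 0" using chart_at_origin F_v by simp
  then show mpos: "0 < mlt" using m0 by (cases mlt) auto
  have xm: "bicoeff ?f mlt 0 = 0" unfolding chart_x_axis H using w(1) mpos by simp
  \<comment> \<open>The dimension in the definition of \<open>n\<close> is the vanishing order of \<open>F\<close> along its tangent line.\<close>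
  define N where "N = (LEAST i. Polynomial.coeff (line F) i \<noteq> 0)"
  have N: "Polynomial.coeff (line F) N \<noteq> 0"
    unfolding N_def by (rule LeastI[of _ "Polynomial.degree (line F)"]) (simp add: line_nonzero)
  have N': "Polynomial.coeff (line F) i = 0" if "i < N" for i
    using not_less_Least[of i "\<lambda>i. Polynomial.coeff (line F) i \<noteq> 0"] that unfolding N_def by blast
  have "linear_form w = form_const (dot3 w e2) * linear_form l2"
    by (subst linear_form_complete) (simp only: w, simp)
  then have nN: "n = N"
    by (rule intersection_multiplicity_line[OF hom_F line_nonzero F_v _ we2 _ N n]) (fact N')
  show n0: "bicoeff ?f n 0 \<noteq> 0" using N unfolding nN line_def .
  have below_n: "bicoeff ?f i 0 = 0" if "i < n" for i using N'[of i] that unfolding nN line_def .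
  have "mlt \<le> n" using chart_low[OF n0] by simp
  moreover have "n \<noteq> mlt" using xm n0 by auto
  ultimately show mn: "mlt < n" by simp
  show "n \<le> d" using total_le_chart[OF hom_F] n0 unfolding total_le_def by fastforce
  fix i j assume ij: "bicoeff ?f i j \<noteq> 0"
  show "mlt * n \<le> mlt * i + n * j"
  proof -
    define S where "S = {(i, j). bicoeff ?f i j \<noteq> 0 \<and> j < mlt}"
    have nS: "(n, 0) \<in> S" using n0 mpos by (simp add: S_def)
    have "S \<subseteq> {..d} \<times> {..d}" using total_le_chart[OF hom_F] unfolding S_def total_le_def by fastforce
    then have finS: "finite S" by (rule finite_subset) simp
    define slope where "slope = (\<lambda>(i::nat, j::nat). real i / real (mlt - j))"
    obtain i0 j0 where S0: "(i0, j0) \<in> S" and min: "\<And>i j. (i, j) \<in> S \<Longrightarrow> slope (i0, j0) \<le> slope (i, j)"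
    proof -
      have "S \<noteq> {}" using nS by blast
      then have "arg_min_on slope S \<in> S" "\<And>x. x \<in> S \<Longrightarrow> slope (arg_min_on slope S) \<le> slope x"
        using arg_min_if_finite(1)[OF finS] arg_min_least[OF finS] by blast+
      then show thesis using that by (cases "arg_min_on slope S") auto
    qed
    define p where "p = mlt - j0"
    define q where "q = i0"
    have j0: "j0 < mlt" "bicoeff ?f i0 j0 \<noteq> 0" using S0 by (auto simp: S_def)
    have p: "p > 0" using j0 by (simp add: p_def)
    have q: "q > 0" using chart_low[OF j0(2)] j0(1) by (simp add: q_def)
    have weight: "q * mlt \<le> p * i + q * j" if "bicoeff ?f i j \<noteq> 0" for i j
    proof (cases "j < mlt")
      case True
      then have "real q / real p \<le> real i / real (mlt - j)" using min[of i j] that by (simp add: S_def slope_def p_def q_def)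
      then have "real q * real (mlt - j) \<le> real p * real i" using p True by (simp add: field_simps)
      then have "q * (mlt - j) \<le> p * i" by (metis of_nat_le_iff of_nat_mult)
      moreover have "q * mlt = q * (mlt - j) + q * j" using True by (simp flip: add_mult_distrib2)
      ultimately show ?thesis by linarith
    next
      case False
      then have "q * mlt \<le> q * j" by simp
      then show ?thesis by linarith
    qed
    let ?P = "Polynomial.coeff (weighted_subst p q ?f) (q * mlt)"
    have Pm: "Polynomial.coeff ?P mlt \<noteq> 0" unfolding weighted_subst_coeff[OF p] using m0 by simp
    have degP: "Polynomial.degree ?P = mlt"
    proof (rule antisym)
      show "Polynomial.degree ?P \<le> mlt" using q by (intro degree_le) (simp add: weighted_subst_coeff[OF p])
      show "mlt \<le> Polynomial.degree ?P" using Pm by (rule le_degree)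
    qed
    have P0: "?P \<noteq> 0" using Pm by auto
    have "q * mlt - q * j0 = p * q" using j0 by (simp add: p_def diff_mult_distrib2 mult.commute)
    then have Pj0: "Polynomial.coeff ?P j0 \<noteq> 0"
      unfolding weighted_subst_coeff[OF p] using j0 p by (simp add: q_def)
    have "poly ?P 0 \<noteq> 0"
    proof
      assume root0: "poly ?P 0 = 0"
      have "c = 0" if "poly ?P c = 0" for c
      proof -
        have "c ^ p = 0 ^ p" by (rule initial_form_roots[OF p q _ m0 that root0]) (rule weight)
        then show ?thesis using p by (simp add: zero_power)
      qed
      then have "?P = Polynomial.monom (Polynomial.lead_coeff ?P) (Polynomial.degree ?P)" by (rule only_zero_root_monom[OF P0])
      then have "Polynomial.coeff ?P j0 = Polynomial.coeff (Polynomial.monom (Polynomial.lead_coeff ?P) mlt) j0"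
        unfolding degP by (rule arg_cong)
      then show False using Pj0 j0(1) by simp
    qed
    then have "Polynomial.coeff ?P 0 \<noteq> 0" by (simp add: poly_0_coeff_0)
    then have div: "p dvd q * mlt" "bicoeff ?f (q * mlt div p) 0 \<noteq> 0"
      unfolding weighted_subst_coeff[OF p] by (auto split: if_splits)
    then have "n \<le> q * mlt div p" using below_n by (meson not_le)
    then have "p * n \<le> q * mlt" using div(1) by (metis dvd_mult_div_cancel mult_le_mono2)
    moreover have "q * mlt \<le> p * n" using weight[OF n0] by simp
    ultimately have pn: "p * n = q * mlt" by simp
    have "p * (mlt * n) = mlt * (q * mlt)" using pn by (simp add: mult_ac)
    also have "\<dots> \<le> mlt * (p * i + q * j)" using weight[OF ij] by simp
    also have "\<dots> = p * (mlt * i) + (q * mlt) * j" by (simp add: algebra_simps)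
    also have "\<dots> = p * (mlt * i + n * j)" unfolding pn[symmetric] by (simp add: algebra_simps)
    finally show ?thesis using p by simp
  qed
qed

end

section \<open>Contact curves and the Euclidean algorithm\<close>

lemma euclid_seq_step: "euclid_seq m n (Suc (Suc j)) = euclid_seq m n j mod euclid_seq m n (Suc j)"
  by (simp add: minus_mult_div_eq_mod)

declare euclid_seq.simps(3) [simp del]

lemma euclid_seq_scale: "euclid_seq (k * m) (k * n) j = k * euclid_seq m n j"
proof (induction j rule: induct_nat_012)
  case (ge2 j)
  then show ?case by (simp add: euclid_seq_step)
qed simp_all

lemma contact_curve_scale:
  assumes "k > 0"
  shows "contact_curve (k * m) (k * n) = contact_curve m n"
proof -
  have len: "euclid_len (k * m) (k * n) = euclid_len m n"
    using assms by (simp add: euclid_len_def euclid_seq_scale)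
  have quot: "euclid_quot (k * m) (k * n) j = euclid_quot m n j" for j
    using assms by (simp add: euclid_quot_def euclid_seq_scale)
  show ?thesis
    by (simp add: contact_curve_def contact_edges_def contact_legs_def len quot)
qed

lemma contact_curve_slope:
  assumes "m > 0" "n > 0" "m' > 0" "n' > 0" "m' * n = m * n'"
  shows "contact_curve m n = contact_curve m' n'"
proof -
  have "contact_curve m n = contact_curve (m' * m) (m' * n)"
    by (rule contact_curve_scale[OF assms(3), symmetric])
  also have "\<dots> = contact_curve (m * m') (m * n')" by (simp only: assms(5)) (simp only: mult.commute)
  also have "\<dots> = contact_curve m' n'" by (rule contact_curve_scale[OF assms(1)])
  finally show ?thesis .
qed

context
  fixes m n :: nat
  assumes mn: "0 < m" "m < n"
begin

lemma euclid_seq_decreasing: "euclid_seq m n j > 0 \<Longrightarrow> euclid_seq m n (Suc j) < euclid_seq m n j"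
  by (cases j) (simp_all add: mn euclid_seq_step)

lemma euclid_len_zero: "euclid_seq m n (Suc (euclid_len m n)) = 0"
proof -
  have "\<exists>j. euclid_seq m n (Suc j) = 0"
  proof (rule ccontr)
    assume "\<not> ?thesis"
    then have pos: "euclid_seq m n j > 0" for j using mn by (cases j) auto
    have "euclid_seq m n j + j \<le> n" for j
    proof (induction j)
      case (Suc j)
      then show ?case using euclid_seq_decreasing[OF pos[of j]] by linarith
    qed simp
    from this[of "Suc n"] show False by simp
  qed
  then show ?thesis unfolding euclid_len_def by (rule LeastI_ex)
qed

lemma euclid_len_pos: "euclid_len m n \<ge> 1"
  using euclid_len_zero mn by (cases "euclid_len m n") auto

lemma euclid_seq_pos: "j \<le> euclid_len m n \<Longrightarrow> euclid_seq m n j > 0"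
proof (cases j)
  case (Suc i)
  assume "j \<le> euclid_len m n"
  then have "i < (LEAST j. euclid_seq m n (Suc j) = 0)" using Suc by (simp add: euclid_len_def)
  then show ?thesis using not_less_Least Suc by blast
qed (use mn in simp)

lemma euclid_quot_pos:
  assumes "1 \<le> j" "j \<le> euclid_len m n"
  shows "euclid_quot m n j \<ge> 1"
proof -
  obtain i where i: "j = Suc i" using assms by (cases j) auto
  have "euclid_seq m n j > 0" "euclid_seq m n i > 0" using assms i by (auto intro: euclid_seq_pos)
  then show ?thesis
    using euclid_seq_decreasing[of i] by (simp add: euclid_quot_def i div_greater_zero_iff Suc_le_eq)
qed

lemma tropical_curve_contact: "tropical_curve (contact_curve m n)"
proof -
  let ?r = "euclid_len m n"
  have fin: "finite {({A_vertex (j + 1), A_vertex (j - 1)}, real (euclid_quot m n j)) | j. 2 \<le> j \<and> j \<le> ?r - 1}"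
    by (rule finite_subset[of _ "(\<lambda>j. ({A_vertex (j + 1), A_vertex (j - 1)}, real (euclid_quot m n j))) ` {2..?r - 1}"]) auto
  have edges: "finite (contact_edges m n)"
    unfolding contact_edges_def Let_def using fin by simp
  have legs: "finite (contact_legs m n)"
    unfolding contact_legs_def Let_def by simp
  have q: "euclid_quot m n j > 0" if "1 \<le> j" "j \<le> ?r" for j using euclid_quot_pos[OF that] by simp
  have edge: "fst e \<subseteq> {C_vertex, E_vertex} \<union> A_vertex ` {1..?r} \<and> card (fst e) \<in> {1, 2} \<and> snd e > 0"
    if e: "e \<in> contact_edges m n" for e
  proof (cases "?r > 1")
    case True
    then consider "e = ({C_vertex, E_vertex}, 1)" | "e = ({E_vertex, A_vertex ?r}, 1)"
      | "e = ({E_vertex, A_vertex (?r - 1)}, real (euclid_quot m n ?r))"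
      | j where "2 \<le> j" "j \<le> ?r - 1" "e = ({A_vertex (j + 1), A_vertex (j - 1)}, real (euclid_quot m n j))"
      using e unfolding contact_edges_def Let_def by auto
    then show ?thesis
    proof cases
      case 4
      then have "j - 1 \<in> {1..?r}" "j + 1 \<in> {1..?r}" "j + 1 \<noteq> j - 1" "euclid_quot m n j > 0"
        using True q[of j] by auto
      then show ?thesis unfolding 4(3) by (simp only: fst_conv snd_conv of_nat_0_less_iff) auto
    qed (use True q[of ?r] in auto)
  next
    case False
    then have r: "?r = 1" using euclid_len_pos by linarith
    then show ?thesis using e unfolding contact_edges_def Let_def by auto
  qed
  have leg: "fst l \<in> {C_vertex, E_vertex} \<union> A_vertex ` {1..?r} \<and> snd l > 0" if l: "l \<in> contact_legs m n" for l
  proof (cases "?r > 1")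
    case True
    then show ?thesis using l unfolding contact_legs_def Let_def by (auto split: if_splits)
  next
    case False
    then have r: "?r = 1" using euclid_len_pos by linarith
    then have "n mod m = 0" using euclid_len_zero euclid_seq_step[of m n 0] by simp
    then obtain k where k: "n = m * k" by auto
    then have "k > 1" using mn by (cases k) auto
    moreover have "euclid_quot m n 1 = k" using k mn by (simp add: euclid_quot_def)
    ultimately show ?thesis using l r unfolding contact_legs_def Let_def by auto
  qed
  show ?thesis
    unfolding tropical_curve_def contact_curve_def using edges legs edge leg by simp
qed

end

lemma tropical_iso_refl: "tropical_curve \<Gamma> \<Longrightarrow> tropical_iso \<Gamma> \<Gamma>"
  unfolding tropical_iso_def by (intro conjI exI[of _ id]) auto

section \<open>Two curves meeting in one unibranch point\<close>

lemma nonzero_at_constant: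
  fixes p :: "'a::idom poly" and \<iota> :: "complex \<Rightarrow> 'a"
  assumes "p \<noteq> 0" "inj \<iota>"
  shows "\<exists>c. poly p (\<iota> c) \<noteq> 0"
proof (rule ccontr)
  assume "\<not> ?thesis"
  then have "range \<iota> \<subseteq> {x. poly p x = 0}" by auto
  then have "finite (range \<iota>)" using poly_roots_finite[OF assms(1)] finite_subset by blast
  then have "finite (UNIV :: complex set)" using assms(2) by (rule finite_imageD)
  then show False using infinite_UNIV_char_0[where 'a = complex] by blast
qed

lemma form_nonvanishing:
  assumes "F \<noteq> 0"
  shows "\<exists>u. form_eval F u \<noteq> 0"
proof -
  obtain a where a: "poly F [:[:a:]:] \<noteq> 0"
    using nonzero_at_constant[OF assms, of "\<lambda>c. [:[:c:]:]"] by (auto simp: inj_on_def)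
  obtain b where b: "poly (poly F [:[:a:]:]) [:b:] \<noteq> 0"
    using nonzero_at_constant[OF a, of "\<lambda>c. [:c:]"] by (auto simp: inj_on_def)
  obtain c where c: "poly (poly (poly F [:[:a:]:]) [:b:]) c \<noteq> 0"
    using nonzero_at_constant[OF b, of "\<lambda>c. c"] by (auto simp: inj_on_def)
  have "form_eval F (vector [a, b, c]) \<noteq> 0" using c by (simp add: form_eval_def)
  then show ?thesis by blast
qed

lemma homogeneous_1_linear_form:
  assumes "homogeneous 1 L"
  shows "\<exists>w. L = linear_form w"
proof -
  define w :: "complex ^ 3" where "w = vector [tricoeff L 1 0 0, tricoeff L 0 1 0, tricoeff L 0 0 1]"
  have "tricoeff L i j k = tricoeff (linear_form w) i j k" for i j k
  proof (cases "i + j + k = 1")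
    case True
    then consider "i = 1" "j = 0" "k = 0" | "i = 0" "j = 1" "k = 0" | "i = 0" "j = 0" "k = 1" by linarith
    then show ?thesis by cases (simp_all add: linear_form_def w_def)
  next
    case False
    then have "tricoeff L i j k = 0" "tricoeff (linear_form w) i j k = 0"
      using homogeneousD[OF assms] homogeneousD[OF homogeneous_linear_form] by blast+
    then show ?thesis by (simp only:)
  qed
  then have "L = linear_form w" by (intro poly_eqI) blast
  then show ?thesis by blast
qed

text \<open>
  What is used about an \<open>(m,n)\<close>-point, with \<open>w\<close> the coefficient vector of the tangent line: the tangent
  cone is a power of the line, and in all coordinates with this line as the axis \<open>y = 0\<close> the Newton polygon is
  the segment from \<open>y^m\<close> to \<open>x^n\<close>.
\<close>

definition tangent_data :: "form \<Rightarrow> nat \<Rightarrow> complex ^ 3 \<Rightarrow> nat \<Rightarrow> nat \<Rightarrow> complex ^ 3 \<Rightarrow> bool" where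
  "tangent_data F d v m n w \<longleftrightarrow> dot3 w v = 0 \<and> w \<noteq> 0 \<and> 0 < m \<and> m < n \<and> n \<le> d \<and> m = multiplicity_at F v
     \<and> (\<exists>\<kappa>. \<kappa> \<noteq> 0 \<and> (\<forall>u. form_eval (homogeneous_part m (translate v F)) u = \<kappa> * dot3 w u ^ m))
     \<and> (\<forall>e1 e2 l1 l2 l3. frame e1 e2 v l1 l2 l3 \<longrightarrow> dot3 w e1 = 0 \<longrightarrow>
          bicoeff (frame.chart e1 e2 v F) 0 m \<noteq> 0 \<and> bicoeff (frame.chart e1 e2 v F) n 0 \<noteq> 0
          \<and> (\<forall>i j. bicoeff (frame.chart e1 e2 v F) i j \<noteq> 0 \<longrightarrow> m * n \<le> m * i + n * j))"

lemma unibranch_chart_intro: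
  assumes "frame e1 e2 v l1 l2 l3" "prime_elem F" "unibranch F v" "homogeneous d F" "d \<ge> 2"
  shows "unibranch_chart e1 e2 v l1 l2 l3 F d"
  using assms
  by (intro unibranch_chart.intro unibranch_form.intro prime_form.intro unibranch_form_axioms.intro unibranch_chart_axioms.intro)

text \<open>
  Since the line divides the tangent cone, a vector outside the cone lies outside the line and completes
  coordinates in which the tangent cone can be computed. The formula for the cone then makes every
  choice of coordinates adapted to the line admissible.
\<close>

lemma mn_point_tangent_data:
  assumes F: "integral_plane_curve d F" "d \<ge> 2" and v: "v \<noteq> 0" and mn: "mn_point F v m n"
  shows "\<exists>w. tangent_data F d v m n w"
proof -
  have hom: "homogeneous d F" and prime: "prime_elem F"
    using F(1) form_irreducible_imp_prime unfolding integral_plane_curve_def by blast+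
  obtain L where uni: "unibranch F v" and m: "m = multiplicity_at F v" and L: "tangent_line F v L"
    and n: "has_intersection_multiplicity F L v n"
    using mn unfolding mn_point_def by blast
  obtain w where w: "L = linear_form w" using L homogeneous_1_linear_form unfolding tangent_line_def by blast
  have wv: "dot3 w v = 0" using L form_eval_linear_form[of w v] unfolding tangent_line_def w by simp
  have w0: "w \<noteq> 0" using L unfolding tangent_line_def w by (auto simp: linear_form_def)
  let ?H = "homogeneous_part (multiplicity_at F v) (translate v F)"
  have dvd: "linear_form w dvd ?H" using L unfolding tangent_line_def w by blast
  have "F \<noteq> 0" using prime by auto
  then obtain u where u: "form_eval ?H u \<noteq> 0" using form_nonvanishing multiplicity_part_nonzero by blast
  obtain k where k: "?H = linear_form w * k" using dvd by (auto simp: dvd_def)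
  have "dot3 w u \<noteq> 0"
    using u unfolding k by (simp add: ring_morphism_mult[OF ring_morphism_form_eval] form_eval_linear_form)
  then obtain e1 l1 l2 l3 where fr: "frame e1 u v l1 l2 l3" "dot3 w e1 = 0" using frame_exists[OF v wv] by blast
  interpret C: unibranch_chart e1 u v l1 l2 l3 F d by (rule unibranch_chart_intro[OF fr(1) prime uni hom F(2)])
  obtain \<kappa> where \<kappa>: "\<kappa> \<noteq> 0" "\<And>u. form_eval ?H u = \<kappa> * dot3 w u ^ multiplicity_at F v"
    using C.tangent_cone_power[OF fr(2) wv dvd u] by blast
  note newton = C.newton_polygon[OF fr(2) wv w0 \<kappa> n[unfolded w]]
  have "bicoeff (frame.chart e1 e2 v F) 0 m \<noteq> 0 \<and> bicoeff (frame.chart e1 e2 v F) n 0 \<noteq> 0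
      \<and> (\<forall>i j. bicoeff (frame.chart e1 e2 v F) i j \<noteq> 0 \<longrightarrow> m * n \<le> m * i + n * j)"
    if f: "frame e1 e2 v l1 l2 l3" "dot3 w e1 = 0" for e1 e2 l1 l2 l3
  proof -
    interpret D: unibranch_chart e1 e2 v l1 l2 l3 F d by (rule unibranch_chart_intro[OF f(1) prime uni hom F(2)])
    note N = D.newton_polygon[OF f(2) wv w0 \<kappa> n[unfolded w]]
    show ?thesis unfolding m using N(4,5,6) by blast
  qed
  then have "tangent_data F d v m n w"
    unfolding tangent_data_def using wv w0 newton(1,2,3) \<kappa> m by blast
  then show ?thesis by blast
qed

lemma common_zero:
  assumes "curve_points B \<inter> curve_points C = {proj_point v}" "u \<noteq> 0" "form_eval B u = 0" "form_eval C u = 0"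
  shows "\<exists>c. u = c *s v"
proof -
  have "proj_point u \<in> curve_points B \<inter> curve_points C" using assms(2-4) unfolding curve_points_def by blast
  then have "proj_point u = proj_point v" using assms(1) by blast
  moreover have "u \<in> proj_point u" unfolding proj_point_def by (rule CollectI, rule exI[of _ 1]) simp
  ultimately show ?thesis unfolding proj_point_def by blast
qed

context frame
begin

lemma top_coeff_y:
  assumes "homogeneous d F"
  shows "bicoeff (chart F) 0 d = form_eval F e2"
proof -
  interpret S: frame e2 e1 v l2 l1 l3 by (rule swap)
  have "form_eval F e2 = form_eval (homogeneous_part d (translate v F)) e2"
    using S.chart_top_coeff[OF assms, of 0] S.chart_initial_coeff[of F d 0] by simp
  then show ?thesis by (simp only: chart_y_axis)
qed

text \<open>
  In a chart whose direction \<open>e2\<close> is not on \<open>B\<close>, the affine equation of \<open>B\<close> is monic in \<open>y\<close> up to a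
  constant, and \<open>bezout_weighted_bound\<close> applies: common zeros of the top forms would be common points at infinity.
\<close>

lemma one_point_degree_bound:
  assumes B: "homogeneous b B" "form_eval B e2 \<noteq> 0" and C: "homogeneous c C"
    and common: "curve_points B \<inter> curve_points C = {proj_point v}"
    and pq: "p > 0" "q > 0"
    and f0: "bicoeff (chart B) 0 m \<noteq> 0" "\<And>i j. bicoeff (chart B) i j \<noteq> 0 \<Longrightarrow> q * m \<le> p * i + q * j"
    and g0: "bicoeff (chart C) n 0 \<noteq> 0"
      "\<And>i j. bicoeff (chart C) i j \<noteq> 0 \<Longrightarrow> (i, j) \<noteq> (n, 0) \<Longrightarrow> p * n < p * i + q * j"
  shows "b * c \<le> n * m"
proof -
  have tB: "i + j \<le> b" if "bicoeff (chart B) i j \<noteq> 0" for i j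
    using total_le_chart[OF B(1)] that unfolding total_le_def by blast
  have tC: "i + j \<le> c" if "bicoeff (chart C) i j \<noteq> 0" for i j
    using total_le_chart[OF C] that unfolding total_le_def by blast
  let ?c = "form_eval B e2"
  have top: "Polynomial.coeff (chart B) b = [:?c:]"
  proof (rule poly_eqI)
    fix i
    show "bicoeff (chart B) i b = Polynomial.coeff [:?c:] i"
    proof (cases i)
      case 0
      then show ?thesis using top_coeff_y[OF B(1)] by simp
    next
      case (Suc k)
      then have "bicoeff (chart B) i b = 0" using tB[where i = i and j = b] by (intro ccontr[of "bicoeff (chart B) i b = 0"]) linarith
      then show ?thesis using Suc by simp
    qed
  qed
  have deg: "Polynomial.degree (chart B) = b"
  proof (rule antisym)
    show "Polynomial.degree (chart B) \<le> b"
    proof (rule degree_le, intro allI impI poly_eqI)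
      fix j i assume "b < j"
      then show "bicoeff (chart B) i j = Polynomial.coeff 0 i"
        using tB[where i = i and j = j] by (intro ccontr[of "bicoeff (chart B) i j = Polynomial.coeff 0 i"]) simp
    qed
    show "b \<le> Polynomial.degree (chart B)" using top B(2) by (intro le_degree) simp
  qed
  show ?thesis
  proof (rule bezout_weighted_bound[of "chart B" b ?c "chart C" c p q m n])
    show "Polynomial.degree (chart B) = b" by (rule deg)
    show "Polynomial.lead_coeff (chart B) = [:?c:]" unfolding deg by (rule top)
    show "?c \<noteq> 0" by (rule B(2))
    show "i + j \<le> b" if "bicoeff (chart B) i j \<noteq> 0" for i j by (rule tB[OF that])
    show "i + j \<le> c" if "bicoeff (chart C) i j \<noteq> 0" for i j by (rule tC[OF that])
  next
    fix z
    assume "poly (Polynomial.coeff (weighted_subst 1 1 (chart B)) b) z = 0"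
      and "poly (Polynomial.coeff (weighted_subst 1 1 (chart C)) c) z = 0"
    then have 0: "form_eval B (e1 + z *s e2) = 0" "form_eval C (e1 + z *s e2) = 0"
      by (simp_all only: chart_top_coeff[OF B(1)] chart_top_coeff[OF C])
    have l1: "dot3 l1 (e1 + z *s e2) = 1"
    proof -
      have "dot3 l1 (e1 + z *s e2) = dot3 l1 e1 + z * dot3 l1 e2" by (simp add: algebra_simps)
      then show ?thesis unfolding dual by simp
    qed
    have "e1 + z *s e2 \<noteq> 0"
    proof
      assume zero: "e1 + z *s e2 = 0"
      show False using l1 unfolding zero by simp
    qed
    then obtain k where "e1 + z *s e2 = k *s v" using common_zero[OF common _ 0] by blast
    then have "dot3 l1 (k *s v) = 1" using l1 by simp
    moreover have "dot3 l1 (k *s v) = k * dot3 l1 v" by (simp add: algebra_simps)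
    ultimately show False using dual(3) by simp
  next
    fix x y
    assume "poly (poly (chart B) [:y:]) x = 0" "poly (poly (chart C) [:y:]) x = 0"
    then have 0: "form_eval B (v + x *s e1 + y *s e2) = 0" "form_eval C (v + x *s e1 + y *s e2) = 0"
      by (simp_all only: poly_chart)
    let ?u = "v + x *s e1 + y *s e2"
    have lin: "dot3 l ?u = dot3 l v + x * dot3 l e1 + y * dot3 l e2" for l by (simp add: algebra_simps)
    have l: "dot3 l1 ?u = x" "dot3 l2 ?u = y" "dot3 l3 ?u = 1"
      unfolding lin dual by simp_all
    have "?u \<noteq> 0"
    proof
      assume zero: "?u = 0"
      show False using l(3) unfolding zero by simp
    qed
    then obtain k where k: "?u = k *s v" using common_zero[OF common _ 0] by blast
    have kv: "dot3 l (k *s v) = k * dot3 l v" for l by (simp add: algebra_simps)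
    have "dot3 l1 ?u = 0" "dot3 l2 ?u = 0" unfolding k kv dual by simp_all
    then show "x = 0 \<and> y = 0" using l by simp
  qed (fact pq f0 g0)+
qed

end

text \<open>
  The equation does not vanish identically on a line through the point in a direction off its tangent cone.
\<close>

lemma point_off_curve:
  assumes "tangent_data B b v m n w" "dot3 w u \<noteq> 0"
  shows "\<exists>t. t \<noteq> 0 \<and> form_eval B (v + t *s u) \<noteq> 0"
proof -
  have "form_eval (homogeneous_part m (translate v B)) u \<noteq> 0"
    using assms unfolding tangent_data_def by auto
  then have "ray u (translate v B) \<noteq> 0" using coeff_ray[of u "translate v B" m] by auto
  then have "[:0, 1:] * ray u (translate v B) \<noteq> 0" by simp
  then obtain t where "poly ([:0, 1:] * ray u (translate v B)) t \<noteq> 0"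
    using poly_all_0_iff_0 by blast
  then have "t \<noteq> 0" "form_eval B (v + t *s u) \<noteq> 0" by (auto simp: poly_ray_translate)
  then show ?thesis by blast
qed

lemma dot3_shift: "dot3 w v = 0 \<Longrightarrow> dot3 w (v + t *s u) = t * dot3 w u"
  by (simp add: algebra_simps)

lemma degree_product_bound:
  fixes b c m n m' n' :: nat
  assumes "m' < n'" "n' \<le> b" "0 < k" "k \<le> c"
  shows "k * m' < b * c"
proof -
  have "k * m' < k * b" using assms by simp
  also have "\<dots> \<le> c * b" using assms by simp
  finally show ?thesis by (simp add: mult.commute)
qed

text \<open>
  With the tangent line of \<open>B\<close> as the axis \<open>y = 0\<close> and that of \<open>C\<close> as \<open>x = 0\<close>, the tangent cones are,
  up to constants, \<open>y^m'\<close> and \<open>x^m\<close>, so the weights \<open>1, 1\<close> bound the product of the degrees by the product of the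
  multiplicities.
\<close>

lemma distinct_tangents_impossible:
  assumes B: "homogeneous b B" "tangent_data B b v m' n' wB" and C: "homogeneous c C" "tangent_data C c v m n wC"
    and v: "v \<noteq> 0" and common: "curve_points B \<inter> curve_points C = {proj_point v}"
    and u: "dot3 wC u = 0" "dot3 wB u \<noteq> 0"
  shows False
proof -
  have Bd: "dot3 wB v = 0" "m' < n'" "n' \<le> b" "m' = multiplicity_at B v" using B(2) unfolding tangent_data_def by blast+
  have Cd: "dot3 wC v = 0" "wC \<noteq> 0" "0 < m" "m < n" "n \<le> c" "m = multiplicity_at C v"
    using C(2) unfolding tangent_data_def by blast+
  obtain \<kappa> where \<kappa>: "\<kappa> \<noteq> 0" "\<And>u. form_eval (homogeneous_part m (translate v C)) u = \<kappa> * dot3 wC u ^ m"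
    using C(2) unfolding tangent_data_def by blast
  obtain t where t: "t \<noteq> 0" "form_eval B (v + t *s u) \<noteq> 0" using point_off_curve[OF B(2) u(2)] by blast
  define e2 where "e2 = v + t *s u"
  have e2: "dot3 wC e2 = 0" "dot3 wB e2 \<noteq> 0"
    unfolding e2_def dot3_shift[OF Bd(1)] dot3_shift[OF Cd(1)] using u t by simp_all
  obtain e1 l1 l2 l3 where fr: "frame e1 e2 v l1 l2 l3" "dot3 wB e1 = 0" using frame_exists[OF v Bd(1) e2(2)] by blast
  interpret frame e1 e2 v l1 l2 l3 by (rule fr(1))
  have e1: "dot3 wC e1 \<noteq> 0"
  proof
    assume z: "dot3 wC e1 = 0"
    show False using complete[of wC] Cd(2) unfolding z e2 Cd(1) by simp
  qed
  have "poly (Polynomial.coeff (weighted_subst 1 1 (chart C)) m) z = poly [:\<kappa> * dot3 wC e1 ^ m:] z" for z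
  proof -
    have "dot3 wC (e1 + z *s e2) = dot3 wC e1 + z * dot3 wC e2" by (simp add: algebra_simps)
    then show ?thesis unfolding chart_initial_coeff \<kappa>(2) e2(1) by simp
  qed
  then have init: "Polynomial.coeff (weighted_subst 1 1 (chart C)) m = [:\<kappa> * dot3 wC e1 ^ m:]" by (rule poly_eqI_infinite)
  have "b * c \<le> m * m'"
  proof (rule one_point_degree_bound[OF B(1) _ C(1) common, of 1 1])
    show "form_eval B e2 \<noteq> 0" unfolding e2_def by (rule t(2))
    show "bicoeff (chart B) 0 m' \<noteq> 0" using B(2) fr unfolding tangent_data_def by blast
    show "1 * m' \<le> 1 * i + 1 * j" if "bicoeff (chart B) i j \<noteq> 0" for i j
      using low_coeff_zero[of i j B] that unfolding Bd(4) by (simp, meson not_le)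
    show "bicoeff (chart C) m 0 \<noteq> 0"
      using bicoeff_weighted_subst_1[where P = "chart C" and i = m and j = 0] init \<kappa>(1) e1 by simp
    show "1 * m < 1 * i + 1 * j" if nz: "bicoeff (chart C) i j \<noteq> 0" "(i, j) \<noteq> (m, 0)" for i j
    proof -
      have "m \<le> i + j" using low_coeff_zero[of i j C] nz(1) unfolding Cd(6) by (meson not_le)
      moreover have "i + j \<noteq> m"
      proof
        assume ij: "i + j = m"
        then have "j \<noteq> 0" using nz(2) by auto
        then have "bicoeff (chart C) i j = 0"
          using bicoeff_weighted_subst_1[where P = "chart C" and i = i and j = j] init ij by (cases j) simp_all
        then show False using nz(1) by simp
      qed
      ultimately show ?thesis by simp
    qed
  qed simp_all
  moreover have "m * m' < b * c" using degree_product_bound[of m' n' b m c] Bd Cd by simp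
  ultimately show False by simp
qed

text \<open>
  If the slope of \<open>C\<close> were smaller, then for the weights \<open>m'\<close> and \<open>n'\<close> the monomial \<open>x^n\<close> would be the
  entire initial form of \<open>C\<close>.
\<close>

lemma common_tangent_slope:
  assumes B: "homogeneous b B" "tangent_data B b v m' n' wB" and C: "homogeneous c C" "tangent_data C c v m n wC"
    and v: "v \<noteq> 0" and common: "curve_points B \<inter> curve_points C = {proj_point v}"
    and same: "\<And>u. dot3 wC u = 0 \<Longrightarrow> dot3 wB u = 0"
  shows "n' * m \<le> n * m'"
proof (rule ccontr)
  assume "\<not> n' * m \<le> n * m'"
  then have slope: "n * m' < n' * m" by simp
  have Bd: "dot3 wB v = 0" "wB \<noteq> 0" "0 < m'" "m' < n'" "n' \<le> b" using B(2) unfolding tangent_data_def by blast+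
  have Cd: "dot3 wC v = 0" "0 < m" "m < n" "n \<le> c" using C(2) unfolding tangent_data_def by blast+
  obtain u where u: "dot3 wB u \<noteq> 0"
  proof (rule ccontr)
    assume "\<not> thesis"
    then have "dot3 wB u = 0" for u using that by blast
    from this[of "axis 1 1"] this[of "axis 2 1"] this[of "axis 3 1"]
    have "wB $ 1 = 0" "wB $ 2 = 0" "wB $ 3 = 0" by (simp_all add: axis_def)
    then have "wB $ k = 0" for k using exhaust_3[of k] by auto
    then show False using Bd(2) by (simp add: vec_eq_iff)
  qed
  obtain t where t: "t \<noteq> 0" "form_eval B (v + t *s u) \<noteq> 0" using point_off_curve[OF B(2) u] by blast
  define e2 where "e2 = v + t *s u"
  have "dot3 wB e2 \<noteq> 0" unfolding e2_def dot3_shift[OF Bd(1)] using u t by simp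
  then have e2: "dot3 wC e2 \<noteq> 0" using same by blast
  obtain e1 l1 l2 l3 where fr: "frame e1 e2 v l1 l2 l3" "dot3 wC e1 = 0" using frame_exists[OF v Cd(1) e2] by blast
  have e1B: "dot3 wB e1 = 0" by (rule same[OF fr(2)])
  interpret frame e1 e2 v l1 l2 l3 by (rule fr(1))
  have f: "bicoeff (chart B) 0 m' \<noteq> 0" "\<And>i j. bicoeff (chart B) i j \<noteq> 0 \<Longrightarrow> m' * n' \<le> m' * i + n' * j"
    using B(2) fr(1) e1B unfolding tangent_data_def by blast+
  have g: "bicoeff (chart C) n 0 \<noteq> 0" "\<And>i j. bicoeff (chart C) i j \<noteq> 0 \<Longrightarrow> m * n \<le> m * i + n * j"
    using C(2) fr unfolding tangent_data_def by blast+
  have "b * c \<le> n * m'"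
  proof (rule one_point_degree_bound[OF B(1) _ C(1) common, of m' n'])
    show "form_eval B e2 \<noteq> 0" unfolding e2_def by (rule t(2))
    show "m' > 0" "n' > 0" using Bd by simp_all
    show "bicoeff (chart B) 0 m' \<noteq> 0" by (rule f(1))
    show "n' * m' \<le> m' * i + n' * j" if "bicoeff (chart B) i j \<noteq> 0" for i j
      using f(2)[OF that] by (simp add: mult.commute)
    show "bicoeff (chart C) n 0 \<noteq> 0" by (rule g(1))
    show "m' * n < m' * i + n' * j" if nz: "bicoeff (chart C) i j \<noteq> 0" "(i, j) \<noteq> (n, 0)" for i j
    proof (cases "j = 0")
      case True
      have "m * n \<le> m * i" using g(2)[OF nz(1)] True by simp
      then have "n \<le> i" using Cd(2) by simp
      moreover have "i \<noteq> n" using nz(2) True by simp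
      ultimately show ?thesis using Bd(3) True by simp
    next
      case False
      have "m * (m' * n) = m' * (m * n)" by (simp add: mult_ac)
      also have "\<dots> \<le> m' * (m * i + n * j)" using g(2)[OF nz(1)] by simp
      also have "\<dots> = m * (m' * i) + (n * m') * j" by (simp add: algebra_simps)
      also have "\<dots> < m * (m' * i) + (n' * m) * j" using slope False by simp
      also have "\<dots> = m * (m' * i + n' * j)" by (simp add: algebra_simps)
      finally show ?thesis using Cd(2) by simp
    qed
  qed
  moreover have "n * m' < b * c" using degree_product_bound[of m' n' b n c] Bd Cd by simp
  ultimately show False by simp
qed

theorem theorem1p1p1:
  fixes B C :: form and dB dC :: nat and v :: "complex ^ 3" and m n m' n' :: nat
  assumes "integral_plane_curve dB B" and "dB \<ge> 2"
    and "integral_plane_curve dC C" and "dC \<ge> 2"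
    and "v \<noteq> 0"
    and "curve_points B \<inter> curve_points C = {proj_point v}"
    and "mn_point B v m' n'"
    and "mn_point C v m n"
  shows "tropical_iso (contact_curve m n) (contact_curve m' n')
    \<and> real m' / real n' = real m / real n"
proof -
  obtain wB where B: "tangent_data B dB v m' n' wB" using mn_point_tangent_data[OF assms(1,2,5,7)] by blast
  obtain wC where C: "tangent_data C dC v m n wC" using mn_point_tangent_data[OF assms(3,4,5,8)] by blast
  have hB: "homogeneous dB B" and hC: "homogeneous dC C" using assms(1,3) unfolding integral_plane_curve_def by blast+
  have common': "curve_points C \<inter> curve_points B = {proj_point v}" using assms(6) by blast
  have same: "dot3 wB u = 0" if "dot3 wC u = 0" for u
    using distinct_tangents_impossible[OF hB B hC C assms(5,6) that] by blast
  have same': "dot3 wC u = 0" if "dot3 wB u = 0" for u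
    using distinct_tangents_impossible[OF hC C hB B assms(5) common' that] by blast
  have "n' * m \<le> n * m'" by (rule common_tangent_slope[OF hB B hC C assms(5,6) same])
  moreover have "n * m' \<le> n' * m" by (rule common_tangent_slope[OF hC C hB B assms(5) common' same'])
  ultimately have eq: "m' * n = m * n'" by (simp add: mult.commute)
  have pos: "0 < m" "m < n" "0 < m'" "m' < n'" using B C unfolding tangent_data_def by blast+
  have "contact_curve m n = contact_curve m' n'" using pos eq by (intro contact_curve_slope) simp_all
  then have "tropical_iso (contact_curve m n) (contact_curve m' n')"
    using tropical_iso_refl[OF tropical_curve_contact[OF pos(1,2)]] by simp
  moreover have "real m' * real n = real m * real n'" using eq by (metis of_nat_mult)
  then have "real m' / real n' = real m / real n" using pos by (simp add: frac_eq_eq)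
  ultimately show ?thesis by blast
qed

end
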